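(* For every transient birth and death chain on $\mathbb{Z}_+$, almost surely $$\sum_{i\in\mathbb{Z}_+}\frac{1}{N(i,i+1)}=\infty .$$ Conversely, for every $s\in\mathbb{Z}_+$ there exist a transient birth and death chain on $\mathbb{Z}_+$ and a constant $c(s)>0$ such that, with positive probability, $N(i,i+1)\ge c(s)\,g_s(i)$ for all $i\in\mathbb{Z}_+$.
   Context: $\mathbb{Z}_+=\{0,1,2,\dots\}$. A birth and death chain on $\mathbb{Z}_+$ is a Markov chain $(X_n)_{n\ge0}$ with state space $\mathbb{Z}_+$ and transition kernel $P$ such that $P(x,y)=0$ if $|x-y|>1$ and $P(x,y)>0$ whenever $|x-y|=1$. The chain is started from an arbitrary fixed initial state; it is recurrent if that state is visited infinitely often a.s., and transient otherwise. $N(i,i+1):=|\{n\ge 0:\{X_n,X_{n+1}\}=\{i,i+1\}\}|$ is the number of crossings of the edge $\{i,i+1\}$ in either direction (with $1/0:=\infty$). For $s\in\mathbb{Z}_+$, $g_s(i):=i\prod_{j=1}^{s}\log_*^{(j)} i$, where $\log_*^{(j)} i:=\log^{(j)} i$ if $\log^{(j-1)} i\ge e$, and $\log_*^{(j)} i:=1$ otherwise (including when $\log^{(j-1)} i$ is not defined). Here $\log^{(j)}=\log\circ\log^{(j-1)}$ is the $j$-th iterated logarithm and $\log^{(0)}$ is the identity; the empty product is $1$, so $g_0(i)=i$. *)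

theory Defs
  imports "HOL-Probability.Probability"
begin

text \<open>
  A time-homogeneous Markov chain on \<open>nat\<close> with transition kernel \<open>K\<close> and deterministic
  initial state \<open>x0\<close>, realised on a probability space \<open>M\<close>.  The Markov property is required
  only for histories of positive probability, since \<^const>\<open>cond_prob\<close> is \<open>0\<close> otherwise.
\<close>

locale markov_chain = prob_space M
  for M :: "'a measure" and K :: "nat \<Rightarrow> nat pmf" and x0 :: nat and X :: "nat \<Rightarrow> 'a \<Rightarrow> nat" +
  assumes measurable_X: "\<And>n. X n \<in> measurable M (count_space UNIV)"
    and initial: "AE \<omega> in M. X 0 \<omega> = x0"
    and markov: "\<And>n w y. \<P>(\<omega> in M. \<forall>k\<le>n. X k \<omega> = w k) > 0 \<Longrightarrow>
      \<P>(\<omega> in M. X (Suc n) \<omega> = y \<bar> \<forall>k\<le>n. X k \<omega> = w k) = pmf (K (w n)) y"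

definition birth_death_kernel :: "(nat \<Rightarrow> nat pmf) \<Rightarrow> bool" where
  "birth_death_kernel K \<longleftrightarrow>
    (\<forall>x y. \<bar>int x - int y\<bar> > 1 \<longrightarrow> pmf (K x) y = 0) \<and>
    (\<forall>x y. \<bar>int x - int y\<bar> = 1 \<longrightarrow> pmf (K x) y > 0)"

locale birth_death_chain = markov_chain +
  assumes birth_death: "birth_death_kernel K"

definition recurrent :: "'a measure \<Rightarrow> nat \<Rightarrow> (nat \<Rightarrow> 'a \<Rightarrow> nat) \<Rightarrow> bool" where
  "recurrent M x0 X \<longleftrightarrow> (AE \<omega> in M. infinite {n. X n \<omega> = x0})"

definition transient :: "'a measure \<Rightarrow> nat \<Rightarrow> (nat \<Rightarrow> 'a \<Rightarrow> nat) \<Rightarrow> bool" where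
  "transient M x0 X \<longleftrightarrow> \<not> recurrent M x0 X"

definition crossing_times :: "(nat \<Rightarrow> nat) \<Rightarrow> nat \<Rightarrow> nat set" where
  "crossing_times x i = {n. {x n, x (Suc n)} = {i, i + 1}}"

definition num_crossings :: "(nat \<Rightarrow> nat) \<Rightarrow> nat \<Rightarrow> enat" where
  "num_crossings x i =
    (if finite (crossing_times x i) then enat (card (crossing_times x i)) else \<infinity>)"

text \<open>
  The option type tracks where the iterated logarithm is defined: \<^const>\<open>ln\<close> is total,
  and iterating it past a nonpositive value could produce spurious values \<open>\<ge> exp 1\<close>.
\<close>

fun iter_log :: "nat \<Rightarrow> real \<Rightarrow> real option" where
  "iter_log 0 x = Some x"
| "iter_log (Suc j) x =
    (case iter_log j x of
      Some y \<Rightarrow> if y > 0 then Some (ln y) else None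
    | None \<Rightarrow> None)"

text \<open>Only used for \<open>j \<ge> 1\<close>.\<close>

definition log_star :: "nat \<Rightarrow> real \<Rightarrow> real" where
  "log_star j x =
    (case iter_log (j - 1) x of
      Some y \<Rightarrow> if y \<ge> exp 1 then the (iter_log j x) else 1
    | None \<Rightarrow> 1)"

definition g :: "nat \<Rightarrow> nat \<Rightarrow> real" where
  "g s i = real i * (\<Prod>j=1..s. log_star j (real i))"

end

theory Submission
  imports Defs
begin

text \<open>
  A birth and death chain is a nearest-neighbour walk on a line of resistors: with edge
  resistances \<open>r i\<close> satisfying \<open>r x * P(x, x+1) = r (x-1) * P(x, x-1)\<close>, the function
  \<open>\<Sum>j<x. r j\<close> is harmonic away from \<open>0\<close>, and everything is governed by the tails
  \<open>v i = (\<Sum>j\<ge>i. r j)\<close>.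

  \<^bold>\<open>Divergence.\<close>  If \<open>\<Sum>r = \<infinity>\<close>, the unbounded harmonic function prevents an escape to infinity, so
  a transient chain has \<open>\<Sum>r < \<infinity>\<close>.  Then \<open>min (v x) (v i)\<close> is superharmonic, and its defect
  sits at \<open>i\<close> only; summing the defect over time bounds the expected number of visits to \<open>i\<close>
  and gives \<open>E N(i,i+1) \<le> 2 * v i / r i = 2 / w i\<close> with \<open>w i = r i / v i\<close>.  The numbers \<open>w i\<close>
  are relative decrements of a sequence tending to \<open>0\<close>, so \<open>S n = (\<Sum>i<n. w i)\<close> is unbounded
  (\<open>not_summable_ratio_tail\<close>).  By \<open>1/N + t\<^sup>2 N \<ge> 2 t\<close> with \<open>t\<close> proportional to \<open>w i\<close>, a bounded
  value of \<open>\<Sum>1/N\<close> forces \<open>\<Sum>i<n. w i\<^sup>2 * N(i,i+1)\<close> to be of order \<open>(S n)\<^sup>2\<close>, whereas its mean is at most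
  \<open>2 * S n\<close>; hence \<open>\<Sum>1/N\<close> is bounded by a given constant with probability \<open>0\<close>.

  \<^bold>\<open>Sharpness.\<close>  For every positive \<open>h\<close> with \<open>\<Sum>1/h = \<infinity>\<close> there is a transient chain with
  \<open>N(i,i+1) \<ge> h i\<close> for all \<open>i\<close> with positive probability
  (\<open>chain_with_many_crossings\<close>); the functions \<open>g s\<close> qualify by Cauchy condensation.  The line is cut
  into blocks on which \<open>\<Sum>1/h\<close> is enormous; in block \<open>k\<close> the resistances are proportional to \<open>1/h\<close>
  and add up to \<open>2^-(k+1)\<close>.  Run the walk until it hits the right end \<open>b\<close> of block \<open>k+1\<close>.  By a
  discrete Ray--Knight description, the upcrossing counts \<open>U i\<close> of the edges, read from right to
  left, form a Markov chain: given \<open>U i = u\<close>, the count of the next edge is \<open>1\<close> plus a negative binomial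
  variable with parameter \<open>u\<close>.  To see this, the walk is driven by independent stacks of
  instructions, one stack per site, so that \<open>U (i-1) - 1\<close> is the number of down instructions at
  \<open>i\<close> that precede the \<open>U i\<close>-th up instruction.

  The process \<open>r i * U i\<close> resembles a two-dimensional squared Bessel process, for which the logarithm is
  harmonic.  The exact discrete counterpart of this logarithm is \<open>harm (U i - 1) + ln (r i)\<close>, a submartingale.
  Subtracting it from the martingale \<open>r i * U i + (\<Sum>j<i. r j)\<close>, suitably normalised, gives a
  nonnegative supermartingale \<open>Psi\<close>, which is of order \<open>ln (\<Sum>1/h)\<close> as soon as \<open>U i < h i\<close> and has bounded
  mean at the right end of block \<open>k\<close>, where \<open>U\<close> has a geometric law.  The maximal inequality therefore
  makes the failure probabilities of the blocks summable.  Finitely many edges remain; they are crossed often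
  enough if the first instructions at finitely many sites all point down, an event of positive probability that
  is independent of the stacks further to the right.
\<close>

section \<open>One step of a Markov chain and killed potentials\<close>

lemma suminf_single_ennreal: "(\<Sum>n. if n = a then h n else (0::ennreal)) = h a"
  by (metis sums_single sums_unique)

text \<open>
  The kernel form of the Markov property from \<open>Y\<close> to \<open>Z\<close> on an event \<open>A\<close> of the past.  It serves
  both for the walk in time and, later, for the crossing counts in space.
\<close>

lemma nn_integral_one_step:
  fixes Y Z :: "'a \<Rightarrow> nat" and f :: "nat \<Rightarrow> ennreal" and K :: "nat \<Rightarrow> nat pmf"
  assumes A: "A \<in> sets M" and Y: "Y \<in> measurable M (count_space UNIV)"
    and Z: "Z \<in> measurable M (count_space UNIV)"
    and step: "\<And>x y. emeasure M {\<omega>\<in>A. Y \<omega> = x \<and> Z \<omega> = y} =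
      emeasure M {\<omega>\<in>A. Y \<omega> = x} * ennreal (pmf (K x) y)"
  shows "(\<integral>\<^sup>+\<omega>. f (Z \<omega>) * indicator A \<omega> \<partial>M) =
    (\<integral>\<^sup>+\<omega>. (\<integral>\<^sup>+y. f y \<partial>measure_pmf (K (Y \<omega>))) * indicator A \<omega> \<partial>M)"
proof -
  note [measurable] = A Y Z
  have ASp: "A \<subseteq> space M" using sets.sets_into_space[OF A] .
  have e1: "{\<omega>\<in>A. Y \<omega> = x \<and> Z \<omega> = y} = {\<omega>\<in>space M. \<omega> \<in> A \<and> Y \<omega> = x \<and> Z \<omega> = y}" for x y
    using ASp by auto
  have e2: "{\<omega>\<in>A. Y \<omega> = x} = {\<omega>\<in>space M. \<omega> \<in> A \<and> Y \<omega> = x}" for x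
    using ASp by auto
  have m1[measurable]: "{\<omega>\<in>A. Y \<omega> = x \<and> Z \<omega> = y} \<in> sets M" for x y
    unfolding e1 by measurable
  have m2[measurable]: "{\<omega>\<in>A. Y \<omega> = x} \<in> sets M" for x
    unfolding e2 by measurable
  have kf: "(\<integral>\<^sup>+y. f y \<partial>measure_pmf (K x)) = (\<Sum>y. ennreal (pmf (K x) y) * f y)" for x
    by (simp add: nn_integral_measure_pmf nn_integral_count_space_nat)
  have l1: "f (Z \<omega>) * indicator A \<omega> =
      (\<Sum>x. \<Sum>y. f y * indicator {\<omega>\<in>A. Y \<omega> = x \<and> Z \<omega> = y} \<omega>)" for \<omega>
  proof -
    have "(\<Sum>y. f y * indicator {\<omega>\<in>A. Y \<omega> = x \<and> Z \<omega> = y} \<omega>) =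
       (if x = Y \<omega> then f (Z \<omega>) * indicator A \<omega> else 0)" for x
    proof -
      have "(\<lambda>y. f y * indicator {\<omega>\<in>A. Y \<omega> = x \<and> Z \<omega> = y} \<omega>) =
        (\<lambda>y. if y = Z \<omega> then (if x = Y \<omega> then f y * indicator A \<omega> else 0) else 0)"
        by (auto simp: fun_eq_iff indicator_def)
      then show ?thesis by (simp only: suminf_single_ennreal)
    qed
    then show ?thesis by (simp only: suminf_single_ennreal)
  qed
  have l2: "(\<integral>\<^sup>+y. f y \<partial>measure_pmf (K (Y \<omega>))) * indicator A \<omega> =
      (\<Sum>x. (\<integral>\<^sup>+y. f y \<partial>measure_pmf (K x)) * indicator {\<omega>\<in>A. Y \<omega> = x} \<omega>)" for \<omega>
  proof -
    have "(\<lambda>x. (\<integral>\<^sup>+y. f y \<partial>measure_pmf (K x)) * indicator {\<omega>\<in>A. Y \<omega> = x} \<omega>) =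
       (\<lambda>x. if x = Y \<omega> then (\<integral>\<^sup>+y. f y \<partial>measure_pmf (K x)) * indicator A \<omega> else 0)"
      by (auto simp: fun_eq_iff indicator_def)
    then show ?thesis by (simp only: suminf_single_ennreal)
  qed
  have "(\<integral>\<^sup>+\<omega>. f (Z \<omega>) * indicator A \<omega> \<partial>M) =
     (\<Sum>x. \<Sum>y. f y * emeasure M {\<omega>\<in>A. Y \<omega> = x \<and> Z \<omega> = y})"
    unfolding l1 by (simp add: nn_integral_suminf nn_integral_cmult)
  also have "\<dots> = (\<Sum>x. (\<integral>\<^sup>+y. f y \<partial>measure_pmf (K x)) * emeasure M {\<omega>\<in>A. Y \<omega> = x})"
    unfolding step kf by (simp add: ennreal_suminf_multc[symmetric] mult_ac)
  also have "\<dots> = (\<integral>\<^sup>+\<omega>. (\<integral>\<^sup>+y. f y \<partial>measure_pmf (K (Y \<omega>))) * indicator A \<omega> \<partial>M)"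
    unfolding l2 by (simp add: nn_integral_suminf nn_integral_cmult)
  finally show ?thesis .
qed

context markov_chain
begin

lemmas [measurable] = measurable_X

definition hist :: "nat \<Rightarrow> 'a \<Rightarrow> nat list" where
  "hist n \<omega> = map (\<lambda>k. X k \<omega>) [0..<Suc n]"

lemma hist_eq_iff: "hist n \<omega> = l \<longleftrightarrow> length l = Suc n \<and> (\<forall>k\<le>n. X k \<omega> = l ! k)"
  unfolding hist_def by (auto simp: list_eq_iff_nth_eq less_Suc_eq_le simp del: upt_Suc)

lemma hist_nth: "k \<le> n \<Longrightarrow> hist n \<omega> ! k = X k \<omega>"
  using hist_eq_iff[of n \<omega> "hist n \<omega>"] by simp

lemma hist_sets[measurable]: "{\<omega>\<in>space M. hist n \<omega> = l} \<in> sets M"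
  unfolding hist_eq_iff by measurable

lemma hist_measurable[measurable]: "hist n \<in> measurable M (count_space UNIV)"
  by (subst measurable_count_space_eq2_countable) (auto simp: vimage_def Int_def conj_commute hist_sets)

lemma single_history_step:
  "emeasure M {\<omega>\<in>space M. hist n \<omega> = l \<and> X (Suc n) \<omega> = y} =
   emeasure M {\<omega>\<in>space M. hist n \<omega> = l} * ennreal (pmf (K (l ! n)) y)"
proof (cases "length l = Suc n")
  case True
  define w where "w k = l ! k" for k
  have h: "hist n \<omega> = l \<longleftrightarrow> (\<forall>k\<le>n. X k \<omega> = w k)" for \<omega>
    using True by (simp add: hist_eq_iff w_def)
  show ?thesis
  proof (cases "\<P>(\<omega> in M. \<forall>k\<le>n. X k \<omega> = w k) > 0")
    case True
    from markov[OF this, of y]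
    have "\<P>(\<omega> in M. X (Suc n) \<omega> = y \<and> (\<forall>k\<le>n. X k \<omega> = w k)) =
        \<P>(\<omega> in M. \<forall>k\<le>n. X k \<omega> = w k) * pmf (K (w n)) y"
      using True by (simp add: cond_prob_def field_simps)
    then show ?thesis
      by (simp add: h emeasure_eq_measure ennreal_mult w_def conj_commute)
  next
    case False
    then have z: "\<P>(\<omega> in M. \<forall>k\<le>n. X k \<omega> = w k) = 0"
      by (simp add: zero_less_measure_iff)
    have "\<P>(\<omega> in M. X (Suc n) \<omega> = y \<and> (\<forall>k\<le>n. X k \<omega> = w k)) \<le>
        \<P>(\<omega> in M. \<forall>k\<le>n. X k \<omega> = w k)"
      by (intro finite_measure_mono) auto
    then have "\<P>(\<omega> in M. X (Suc n) \<omega> = y \<and> (\<forall>k\<le>n. X k \<omega> = w k)) = 0"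
      using z by (simp add: measure_le_0_iff)
    then show ?thesis
      using z by (simp add: h emeasure_eq_measure w_def conj_commute)
  qed
next
  case False
  then show ?thesis by (simp add: hist_eq_iff)
qed

text \<open>
  An event of the past is a countable union of single histories, on each of which the Markov property
  is an identity; histories of probability \<open>0\<close> contribute \<open>0\<close> to both sides.
\<close>

lemma history_step:
  "emeasure M {\<omega>\<in>{\<omega>\<in>space M. hist n \<omega> \<in> S}. X n \<omega> = x \<and> X (Suc n) \<omega> = y} =
   emeasure M {\<omega>\<in>{\<omega>\<in>space M. hist n \<omega> \<in> S}. X n \<omega> = x} * ennreal (pmf (K x) y)"
proof -
  define S' where "S' = {l\<in>S. l ! n = x}"
  have hn: "hist n \<omega> ! n = X n \<omega>" for \<omega>
    using hist_eq_iff[of n \<omega> "hist n \<omega>"] by simp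
  have a: "{\<omega>\<in>{\<omega>\<in>space M. hist n \<omega> \<in> S}. X n \<omega> = x \<and> X (Suc n) \<omega> = y} =
      (\<Union>l\<in>S'. {\<omega>\<in>space M. hist n \<omega> = l \<and> X (Suc n) \<omega> = y})"
    by (auto simp: S'_def hn)
  have b: "{\<omega>\<in>{\<omega>\<in>space M. hist n \<omega> \<in> S}. X n \<omega> = x} =
      (\<Union>l\<in>S'. {\<omega>\<in>space M. hist n \<omega> = l})"
    by (auto simp: S'_def hn)
  have "emeasure M {\<omega>\<in>{\<omega>\<in>space M. hist n \<omega> \<in> S}. X n \<omega> = x \<and> X (Suc n) \<omega> = y} =
    (\<integral>\<^sup>+l. emeasure M {\<omega>\<in>space M. hist n \<omega> = l \<and> X (Suc n) \<omega> = y} \<partial>count_space S')"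
    unfolding a by (rule emeasure_UN_countable) (auto simp: disjoint_family_on_def)
  also have "\<dots> = (\<integral>\<^sup>+l. emeasure M {\<omega>\<in>space M. hist n \<omega> = l} * ennreal (pmf (K x) y) \<partial>count_space S')"
    by (intro nn_integral_cong) (auto simp: single_history_step S'_def)
  also have "\<dots> = (\<integral>\<^sup>+l. emeasure M {\<omega>\<in>space M. hist n \<omega> = l} \<partial>count_space S') * ennreal (pmf (K x) y)"
    by (rule nn_integral_multc) auto
  also have "(\<integral>\<^sup>+l. emeasure M {\<omega>\<in>space M. hist n \<omega> = l} \<partial>count_space S') =
     emeasure M {\<omega>\<in>{\<omega>\<in>space M. hist n \<omega> \<in> S}. X n \<omega> = x}"
    unfolding b by (rule emeasure_UN_countable[symmetric]) (auto simp: disjoint_family_on_def)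
  finally show ?thesis .
qed

lemma state_step:
  "emeasure M {\<omega>\<in>space M. X n \<omega> = x \<and> X (Suc n) \<omega> = y} =
   emeasure M {\<omega>\<in>space M. X n \<omega> = x} * ennreal (pmf (K x) y)"
  using history_step[of n UNIV x y] by simp

definition avoid :: "nat \<Rightarrow> nat set \<Rightarrow> nat \<Rightarrow> 'a set" where
  "avoid n B m = {\<omega>\<in>space M. \<forall>k\<in>{n..m}. X k \<omega> \<notin> B}"

lemma avoid_sets[measurable]: "avoid n B m \<in> sets M"
  unfolding avoid_def by measurable

lemma avoid_step:
  fixes f :: "nat \<Rightarrow> ennreal"
  shows "(\<integral>\<^sup>+\<omega>. f (X (Suc m) \<omega>) * indicator (avoid n B m) \<omega> \<partial>M) =
    (\<integral>\<^sup>+\<omega>. (\<integral>\<^sup>+y. f y \<partial>measure_pmf (K (X m \<omega>))) * indicator (avoid n B m) \<omega> \<partial>M)"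
proof (rule nn_integral_one_step)
  have e: "avoid n B m = {\<omega>\<in>space M. hist m \<omega> \<in> {l. \<forall>k\<in>{n..m}. l ! k \<notin> B}}"
    by (auto simp: avoid_def hist_nth)
  show "emeasure M {\<omega> \<in> avoid n B m. X m \<omega> = x \<and> X (Suc m) \<omega> = y} =
     emeasure M {\<omega> \<in> avoid n B m. X m \<omega> = x} * ennreal (pmf (K x) y)" for x y
    unfolding e by (rule history_step)
qed auto

text \<open>
  One step of the walk killed on entering \<open>B\<close>, seen by a function that is superharmonic off \<open>B\<close> with a
  defect of at least \<open>\<delta>\<close> at \<open>L\<close>.  The mass found at \<open>L\<close> is charged against the decrease of the mean.
\<close>

lemma killed_step:
  fixes f :: "nat \<Rightarrow> ennreal"
  assumes sup: "\<And>x. x \<notin> B \<Longrightarrow> (\<integral>\<^sup>+y. f y \<partial>measure_pmf (K x)) + (if x = L then \<delta> else 0) \<le> f x"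
    and nm: "n \<le> m"
  shows "(\<integral>\<^sup>+\<omega>. f (X (Suc m) \<omega>) * indicator (avoid n B (Suc m)) \<omega> \<partial>M) +
     \<delta> * emeasure M {\<omega>\<in>avoid n B m. X m \<omega> = L} \<le>
    (\<integral>\<^sup>+\<omega>. f (X m \<omega>) * indicator (avoid n B m) \<omega> \<partial>M)"
proof -
  have ms: "{\<omega>\<in>avoid n B m. X m \<omega> = L} \<in> sets M"
  proof -
    have "{\<omega>\<in>avoid n B m. X m \<omega> = L} = {\<omega>\<in>space M. \<omega> \<in> avoid n B m \<and> X m \<omega> = L}"
      by (auto simp: avoid_def)
    then show ?thesis by simp
  qed
  have "(\<integral>\<^sup>+\<omega>. f (X (Suc m) \<omega>) * indicator (avoid n B (Suc m)) \<omega> \<partial>M) \<le>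
     (\<integral>\<^sup>+\<omega>. f (X (Suc m) \<omega>) * indicator (avoid n B m) \<omega> \<partial>M)"
    by (intro nn_integral_mono mult_left_mono) (auto simp: avoid_def indicator_def)
  also have "\<dots> = (\<integral>\<^sup>+\<omega>. (\<integral>\<^sup>+y. f y \<partial>measure_pmf (K (X m \<omega>))) * indicator (avoid n B m) \<omega> \<partial>M)"
    by (rule avoid_step)
  finally have "(\<integral>\<^sup>+\<omega>. f (X (Suc m) \<omega>) * indicator (avoid n B (Suc m)) \<omega> \<partial>M) +
     \<delta> * emeasure M {\<omega>\<in>avoid n B m. X m \<omega> = L} \<le>
     (\<integral>\<^sup>+\<omega>. (\<integral>\<^sup>+y. f y \<partial>measure_pmf (K (X m \<omega>))) * indicator (avoid n B m) \<omega> \<partial>M) +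
     (\<integral>\<^sup>+\<omega>. \<delta> * indicator {\<omega>\<in>avoid n B m. X m \<omega> = L} \<omega> \<partial>M)"
    using ms by (simp add: nn_integral_cmult add_right_mono)
  also have "\<dots> = (\<integral>\<^sup>+\<omega>. (\<integral>\<^sup>+y. f y \<partial>measure_pmf (K (X m \<omega>))) * indicator (avoid n B m) \<omega> +
      \<delta> * indicator {\<omega>\<in>avoid n B m. X m \<omega> = L} \<omega> \<partial>M)"
    using ms by (intro nn_integral_add[symmetric]) auto
  also have "\<dots> \<le> (\<integral>\<^sup>+\<omega>. f (X m \<omega>) * indicator (avoid n B m) \<omega> \<partial>M)"
  proof (intro nn_integral_mono)
    fix \<omega> assume "\<omega> \<in> space M"
    show "(\<integral>\<^sup>+y. f y \<partial>measure_pmf (K (X m \<omega>))) * indicator (avoid n B m) \<omega> +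
      \<delta> * indicator {\<omega>\<in>avoid n B m. X m \<omega> = L} \<omega> \<le> f (X m \<omega>) * indicator (avoid n B m) \<omega>"
      using sup[of "X m \<omega>"] nm by (auto simp: indicator_def avoid_def split: if_splits)
  qed
  finally show ?thesis .
qed

lemma killed_occupation_aux:
  fixes f :: "nat \<Rightarrow> ennreal"
  assumes sup: "\<And>x. x \<notin> B \<Longrightarrow> (\<integral>\<^sup>+y. f y \<partial>measure_pmf (K x)) + (if x = L then \<delta> else 0) \<le> f x"
  shows "(\<integral>\<^sup>+\<omega>. f (X (n + j) \<omega>) * indicator (avoid n B (n + j)) \<omega> \<partial>M) +
     (\<Sum>i<j. \<delta> * emeasure M {\<omega>\<in>avoid n B (n + i). X (n + i) \<omega> = L}) \<le>
    (\<integral>\<^sup>+\<omega>. f (X n \<omega>) \<partial>M)"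
proof (induction j)
  case 0
  then show ?case
    by (auto intro!: nn_integral_mono simp: indicator_def)
next
  case (Suc j)
  show ?case
    using order_trans[OF add_right_mono[OF killed_step[of B f L \<delta> n "n + j", OF sup],
        of "(\<Sum>i<j. \<delta> * emeasure M {\<omega>\<in>avoid n B (n + i). X (n + i) \<omega> = L})"] Suc]
    by (simp add: add_ac )
qed

lemma killed_mass:
  fixes f :: "nat \<Rightarrow> ennreal"
  assumes sup: "\<And>x. x \<notin> B \<Longrightarrow> (\<integral>\<^sup>+y. f y \<partial>measure_pmf (K x)) \<le> f x"
  shows "(\<integral>\<^sup>+\<omega>. f (X (n + j) \<omega>) * indicator (avoid n B (n + j)) \<omega> \<partial>M) \<le> (\<integral>\<^sup>+\<omega>. f (X n \<omega>) \<partial>M)"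
  using killed_occupation_aux[where \<delta>=0 and f = f and B = B and n = n and j = j] sup by simp

text \<open>
  The mean of a nonnegative function can decrease by at most its initial value: this turns
  a potential with a single defect into a bound on a Green function.
\<close>

lemma killed_occupation:
  fixes f :: "nat \<Rightarrow> ennreal"
  assumes sup: "\<And>x. x \<notin> B \<Longrightarrow> (\<integral>\<^sup>+y. f y \<partial>measure_pmf (K x)) + (if x = L then \<delta> else 0) \<le> f x"
  shows "(\<Sum>i. \<delta> * emeasure M {\<omega>\<in>avoid n B (n + i). X (n + i) \<omega> = L}) \<le> (\<integral>\<^sup>+\<omega>. f (X n \<omega>) \<partial>M)"
  unfolding suminf_eq_SUP
proof (rule SUP_least)
  fix j
  show "(\<Sum>i<j. \<delta> * emeasure M {\<omega>\<in>avoid n B (n + i). X (n + i) \<omega> = L}) \<le> (\<integral>\<^sup>+\<omega>. f (X n \<omega>) \<partial>M)"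
    by (rule order_trans[OF _ killed_occupation_aux[of B f L \<delta> n j, OF sup]]) simp_all
qed

end

section \<open>Edge resistances and the recurrence criterion\<close>

text \<open>
  The chain is reversible, and \<open>1 / r x\<close> is the conductance of the edge between \<open>x\<close> and \<open>x + 1\<close>;
  the balance equation determines \<open>r\<close> up to a constant factor.
\<close>

definition resistances :: "(nat \<Rightarrow> nat pmf) \<Rightarrow> (nat \<Rightarrow> real) \<Rightarrow> bool" where
  "resistances K r \<longleftrightarrow> (\<forall>x. 0 < r x) \<and>
     (\<forall>x. r (Suc x) * pmf (K (Suc x)) (Suc (Suc x)) = r x * pmf (K (Suc x)) x)"

lemma resistances_exist:
  assumes "birth_death_kernel K"
  shows "\<exists>r. resistances K r"
proof -
  define r where "r = rec_nat (1::real) (\<lambda>x y. y * pmf (K (Suc x)) x / pmf (K (Suc x)) (Suc (Suc x)))"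
  have p: "pmf (K (Suc x)) x > 0" "pmf (K x) (Suc x) > 0" for x
    using assms by (simp_all add: birth_death_kernel_def)
  have r0: "r 0 = 1" and rS: "r (Suc x) = r x * pmf (K (Suc x)) x / pmf (K (Suc x)) (Suc (Suc x))" for x
    by (simp_all add: r_def)
  have pos: "r x > 0" for x
    by (induction x) (simp_all add: r0 rS p)
  have "resistances K r"
    unfolding resistances_def
  proof (intro conjI allI pos)
    fix x
    show "r (Suc x) * pmf (K (Suc x)) (Suc (Suc x)) = r x * pmf (K (Suc x)) x"
      using p(2)[of "Suc x"] by (simp add: rS)
  qed
  then show ?thesis by blast
qed

lemma birth_death_nn_integral:
  assumes bd: "birth_death_kernel K" and nn: "\<And>y. 0 \<le> \<phi> y"
  defines "D \<equiv> \<lambda>x. \<phi> x + (pmf (K x) (Suc x) * (\<phi> (Suc x) - \<phi> x)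
       - (if x = 0 then 0 else pmf (K x) (x - 1) * (\<phi> x - \<phi> (x - 1))))"
  shows "(\<integral>\<^sup>+y. ennreal (\<phi> y) \<partial>measure_pmf (K x)) = ennreal (D x)" and "0 \<le> D x"
proof -
  define F where "F = {y. y \<le> Suc x \<and> x \<le> Suc y}"
  have fin: "finite F" unfolding F_def by (rule finite_subset[of _ "{..Suc x}"]) auto
  have "set_pmf (K x) \<subseteq> F"
  proof
    fix y assume "y \<in> set_pmf (K x)"
    then have "pmf (K x) y \<noteq> 0" by (simp add: set_pmf_iff)
    then have "\<not> \<bar>int x - int y\<bar> > 1" using bd unfolding birth_death_kernel_def by blast
    then show "y \<in> F" by (auto simp: F_def)
  qed
  then have 1: "(\<integral>\<^sup>+y. ennreal (\<phi> y) \<partial>measure_pmf (K x)) = (\<Sum>y\<in>F. ennreal (\<phi> y) * ennreal (pmf (K x) y))"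
    and 2: "(\<Sum>y\<in>F. pmf (K x) y) = 1"
    using fin by (auto intro!: nn_integral_measure_pmf_support sum_pmf_eq_1 simp: set_pmf_iff)
  have 3: "(\<Sum>y\<in>F. ennreal (\<phi> y) * ennreal (pmf (K x) y)) = ennreal (\<Sum>y\<in>F. \<phi> y * pmf (K x) y)"
    using nn by (simp add: ennreal_mult sum_ennreal[symmetric])
  have "(\<Sum>y\<in>F. \<phi> y * pmf (K x) y) = \<phi> x * (\<Sum>y\<in>F. pmf (K x) y) + (\<Sum>y\<in>F. (\<phi> y - \<phi> x) * pmf (K x) y)"
    by (simp add: sum_distrib_left algebra_simps flip: sum.distrib)
  also have "(\<Sum>y\<in>F. (\<phi> y - \<phi> x) * pmf (K x) y) = pmf (K x) (Suc x) * (\<phi> (Suc x) - \<phi> x)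
       - (if x = 0 then 0 else pmf (K x) (x - 1) * (\<phi> x - \<phi> (x - 1)))"
  proof (cases x)
    case 0
    then have "F = {0, 1}" by (auto simp: F_def)
    then show ?thesis using 0 by simp
  next
    case (Suc z)
    then have "F = {z, Suc z, Suc (Suc z)}" by (auto simp: F_def)
    then show ?thesis using Suc by (simp add: algebra_simps)
  qed
  finally have 4: "(\<Sum>y\<in>F. \<phi> y * pmf (K x) y) = D x"
    by (simp only: D_def 2 mult_1_right)
  show "(\<integral>\<^sup>+y. ennreal (\<phi> y) \<partial>measure_pmf (K x)) = ennreal (D x)" unfolding 1 3 4 ..
  show "0 \<le> D x" unfolding 4[symmetric] by (intro sum_nonneg mult_nonneg_nonneg nn) simp
qed

text \<open>
  If \<open>\<phi>\<close> has slope \<open>e\<close> in the scale of the resistances, its drift at \<open>x\<close> is the jump of the slope at \<open>x\<close>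
  times a positive weight.  Thus potentials with piecewise constant slope are harmonic except at the break points.
\<close>

lemma birth_death_drift:
  assumes bd: "birth_death_kernel K" and r: "resistances K r" and nn: "\<And>y. 0 \<le> \<phi> y"
    and inc: "\<And>y. \<phi> (Suc y) = \<phi> y + e y * r y"
  defines "D \<equiv> \<lambda>x. \<phi> x + pmf (K x) (Suc x) * r x * (e x - (if x = 0 then 0 else e (x - 1)))"
  shows "(\<integral>\<^sup>+y. ennreal (\<phi> y) \<partial>measure_pmf (K x)) = ennreal (D x)" and "0 \<le> D x"
proof -
  have "pmf (K x) (Suc x) * (\<phi> (Suc x) - \<phi> x)
       - (if x = 0 then 0 else pmf (K x) (x - 1) * (\<phi> x - \<phi> (x - 1))) =
       pmf (K x) (Suc x) * r x * (e x - (if x = 0 then 0 else e (x - 1)))"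
  proof (cases x)
    case 0
    then show ?thesis by (simp add: inc)
  next
    case (Suc z)
    have eq: "r z * pmf (K (Suc z)) z = r (Suc z) * pmf (K (Suc z)) (Suc (Suc z))"
      using r by (simp add: resistances_def)
    have "pmf (K (Suc z)) z * (e z * r z) = e z * (r z * pmf (K (Suc z)) z)" by simp
    also have "\<dots> = e z * (r (Suc z) * pmf (K (Suc z)) (Suc (Suc z)))" unfolding eq ..
    finally show ?thesis by (auto simp: Suc inc algebra_simps)
  qed
  then show "(\<integral>\<^sup>+y. ennreal (\<phi> y) \<partial>measure_pmf (K x)) = ennreal (D x)" "0 \<le> D x"
    using birth_death_nn_integral[of K \<phi> x, OF bd nn] by (simp_all only: D_def)
qed

lemma birth_death_superharmonic:
  assumes bd: "birth_death_kernel K" and r: "resistances K r" and nn: "\<And>y. 0 \<le> \<phi> y"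
    and inc: "\<And>y. \<phi> (Suc y) = \<phi> y + e y * r y"
    and \<delta>: "\<delta> \<ge> 0"
    and neg: "pmf (K x) (Suc x) * r x * (e x - (if x = 0 then 0 else e (x - 1))) + (if x = L then \<delta> else 0) \<le> 0"
  shows "(\<integral>\<^sup>+y. ennreal (\<phi> y) \<partial>measure_pmf (K x)) + (if x = L then ennreal \<delta> else 0) \<le> ennreal (\<phi> x)"
proof -
  define t where "t = \<phi> x + pmf (K x) (Suc x) * r x * (e x - (if x = 0 then 0 else e (x - 1)))"
  define d where "d = (if x = L then \<delta> else 0)"
  have td: "t + d \<le> \<phi> x" using neg by (simp add: t_def d_def)
  have d: "0 \<le> d" using \<delta> by (simp add: d_def)
  have t: "0 \<le> t" "(\<integral>\<^sup>+y. ennreal (\<phi> y) \<partial>measure_pmf (K x)) = ennreal t"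
    unfolding t_def using birth_death_drift[of K r \<phi> e x, OF bd r nn inc] by auto
  have "ennreal t + ennreal d \<le> ennreal (\<phi> x)"
    using td d t(1) by (simp add: ennreal_leI flip: ennreal_plus)
  then show ?thesis
    unfolding t(2) d_def by (auto split: if_splits)
qed

context birth_death_chain
begin

lemma up_pos: "pmf (K x) (Suc x) > 0"
  using birth_death by (simp add: birth_death_kernel_def)

text \<open>
  The potential \<open>\<Sum>j \<ge> max x L. r j\<close> has slope \<open>0\<close> up to \<open>L\<close> and \<open>-1\<close> beyond, hence its only defect is at \<open>L\<close>.
\<close>

lemma expected_visits:
  assumes r: "resistances K r" and summ: "summable r"
  shows "(\<Sum>n. ennreal (pmf (K L) (Suc L) * r L) * emeasure M {\<omega>\<in>space M. X n \<omega> = L}) \<le> ennreal (\<Sum>j. r (j + L))"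
proof -
  have rp: "r x > 0" for x using r by (simp add: resistances_def)
  define \<phi> where "\<phi> x = (\<Sum>j. r (j + max x L))" for x
  define e :: "nat \<Rightarrow> real" where "e x = (if x < L then 0 else - 1)" for x
  have summ': "summable (\<lambda>j. r (j + k))" for k using summ by (subst summable_iff_shift)
  have nn: "0 \<le> \<phi> y" for y unfolding \<phi>_def using rp by (intro suminf_nonneg summ') (simp add: less_imp_le)
  have inc: "\<phi> (Suc y) = \<phi> y + e y * r y" for y
  proof (cases "y < L")
    case True then show ?thesis by (simp add: \<phi>_def e_def max_def)
  next
    case False
    then show ?thesis using suminf_split_head[OF summ'[of y]]
      by (simp add: \<phi>_def e_def max_def)
  qed
  have le: "\<phi> x \<le> \<phi> 0" for x
  proof (induction x)
    case (Suc x) then show ?case using inc[of x] rp[of x] by (auto simp: e_def split: if_splits)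
  qed simp
  have "(\<Sum>i. ennreal (pmf (K L) (Suc L) * r L) * emeasure M {\<omega>\<in>avoid 0 {} (0 + i). X (0 + i) \<omega> = L}) \<le>
     (\<integral>\<^sup>+\<omega>. ennreal (\<phi> (X 0 \<omega>)) \<partial>M)"
  proof (rule killed_occupation, rule birth_death_superharmonic[OF birth_death r nn inc])
    show "0 \<le> pmf (K L) (Suc L) * r L" using rp[of L] by simp
    show "pmf (K x) (Suc x) * r x * (e x - (if x = 0 then 0 else e (x - 1))) + (if x = L then pmf (K L) (Suc L) * r L else 0) \<le> 0" for x
      by (cases x) (auto simp: e_def)
  qed
  also have "\<dots> \<le> (\<integral>\<^sup>+\<omega>. ennreal (\<phi> 0) \<partial>M)" using le by (intro nn_integral_mono ennreal_leI)
  also have "\<dots> = ennreal (\<phi> 0)" by (simp add: emeasure_space_1)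
  finally show ?thesis by (simp add: avoid_def \<phi>_def)
qed

text \<open>
  The walk killed at \<open>x0\<close> spends a finite expected time at each single state other than \<open>x0\<close> (bounded
  potential with one break point), and it is far to the right only with small probability (the unbounded
  potential \<open>\<phi>\<close> has bounded mean).  So it cannot survive forever.
\<close>

lemma recurrent_if_not_summable:
  assumes r: "resistances K r" and nsumm: "\<not> summable r"
  shows "recurrent M x0 X"
proof -
  have rp: "r x > 0" for x using r by (simp add: resistances_def)
  define \<phi> where "\<phi> x = (\<Sum>j<x. r j)" for x
  have \<phi>S: "\<phi> (Suc x) = \<phi> x + r x" for x by (simp add: \<phi>_def)
  have \<phi>mono: "x \<le> y \<Longrightarrow> \<phi> x \<le> \<phi> y" for x y unfolding \<phi>_def
    using rp by (intro sum_mono2) (auto simp: less_imp_le)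
  have unb: "\<exists>L. \<phi> L \<ge> c" for c
  proof (rule ccontr)
    assume "\<not> ?thesis"
    then have "\<And>L. \<phi> L \<le> c" by (meson not_le less_imp_le)
    then have "summable r" using rp by (intro summableI_nonneg_bounded[of r c]) (auto simp: \<phi>_def less_imp_le)
    with nsumm show False by simp
  qed
  have never: "emeasure M {\<omega>\<in>space M. \<forall>k\<ge>n. X k \<omega> \<noteq> x0} = 0" for n
  proof -
    define a where "a L i = emeasure M {\<omega>\<in>avoid n {x0} (n + i). X (n + i) \<omega> = L}" for L i
    \<comment> \<open>The potential is constant beyond \<open>L\<close>, seen from \<open>x0\<close>, and vanishes on the other side of \<open>x0\<close>.\<close>
    have occ: "(\<Sum>i. ennreal (pmf (K L) (Suc L) * r L) * a L i) < \<infinity>" if L: "L \<noteq> x0" for L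
    proof -
      define e :: "nat \<Rightarrow> real" where "e x = (if x0 \<le> x \<and> x < L then 1 else if L \<le> x \<and> x < x0 then -1 else 0)" for x
      define f where "f x = (if L > x0 then max 0 (min (\<phi> x) (\<phi> L) - \<phi> x0) else max 0 (\<phi> x0 - max (\<phi> x) (\<phi> L)))" for x
      have nn: "0 \<le> f y" for y by (simp add: f_def)
      have inc: "f (Suc y) = f y + e y * r y" for y
      proof (cases "L > x0")
        case True
        consider "y < x0" | "x0 \<le> y" "y < L" | "L \<le> y" by linarith
        then show ?thesis
        proof cases
          case 1 then show ?thesis using True \<phi>mono[of "Suc y" x0] \<phi>mono[of y x0] by (simp add: f_def e_def)
        next
          case 2 then show ?thesis using True \<phi>mono[of "Suc y" L] \<phi>mono[of y L] \<phi>mono[of x0 y] \<phi>S[of y] rp[of y]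
            by (simp add: f_def e_def)
        next
          case 3 then show ?thesis using True \<phi>mono[of L y] \<phi>mono[of L "Suc y"] by (simp add: f_def e_def)
        qed
      next
        case False
        with L have L': "L < x0" by simp
        consider "y < L" | "L \<le> y" "y < x0" | "x0 \<le> y" by linarith
        then show ?thesis
        proof cases
          case 1 then show ?thesis using L' \<phi>mono[of "Suc y" L] \<phi>mono[of y L] by (simp add: f_def e_def)
        next
          case 2 then show ?thesis using L' \<phi>mono[of "Suc y" x0] \<phi>mono[of y x0] \<phi>mono[of L y] \<phi>S[of y] rp[of y]
            by (simp add: f_def e_def)
        next
          case 3 then show ?thesis using L' \<phi>mono[of x0 y] \<phi>mono[of x0 "Suc y"] by (simp add: f_def e_def)
        qed
      qed
      have le: "f x \<le> \<bar>\<phi> L\<bar> + \<bar>\<phi> x0\<bar>" for x by (auto simp: f_def)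
      have "(\<Sum>i. ennreal (pmf (K L) (Suc L) * r L) * a L i) \<le> (\<integral>\<^sup>+\<omega>. ennreal (f (X n \<omega>)) \<partial>M)"
        unfolding a_def
      proof (rule killed_occupation, rule birth_death_superharmonic[OF birth_death r nn inc])
        show "0 \<le> pmf (K L) (Suc L) * r L" using rp[of L] by simp
        show "pmf (K x) (Suc x) * r x * (e x - (if x = 0 then 0 else e (x - 1))) + (if x = L then pmf (K L) (Suc L) * r L else 0) \<le> 0"
          if "x \<notin> {x0}" for x
          using that L by (cases x) (auto simp: e_def)
      qed
      also have "\<dots> \<le> (\<integral>\<^sup>+\<omega>. ennreal (\<bar>\<phi> L\<bar> + \<bar>\<phi> x0\<bar>) \<partial>M)" using le by (intro nn_integral_mono ennreal_leI)
      also have "\<dots> < \<infinity>" by (simp add: emeasure_space_1)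
      finally show ?thesis .
    qed
    have a0: "a L \<longlonglongrightarrow> 0" for L
    proof (cases "L = x0")
      case True
      have "{\<omega>\<in>avoid n {x0} (n + i). X (n + i) \<omega> = x0} = {}" for i by (auto simp: avoid_def)
      then have "a L = (\<lambda>_. 0)" unfolding a_def True by (simp only: emeasure_empty)
      then show ?thesis by simp
    next
      case False
      define c where "c = pmf (K L) (Suc L) * r L"
      have c: "c > 0" using up_pos[of L] rp[of L] by (simp add: c_def)
      define b where "b i = measure M {\<omega>\<in>avoid n {x0} (n + i). X (n + i) \<omega> = L}" for i
      have ab: "a L i = ennreal (b i)" for i by (simp add: a_def b_def emeasure_eq_measure)
      have "(\<Sum>i. ennreal (c * b i)) \<noteq> \<top>"
        using occ[OF False] c by (simp add: c_def[symmetric] ab ennreal_mult b_def less_top)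
      then have "summable (\<lambda>i. c * b i)"
        using c by (intro summable_suminf_not_top) (auto simp: b_def)
      then have "summable b" using c by (simp add: summable_cmult_iff)
      then have "(\<lambda>i. ennreal (b i)) \<longlonglongrightarrow> ennreal 0" by (intro tendsto_ennrealI summable_LIMSEQ_zero)
      then show ?thesis by (simp add: ab[abs_def])
    qed
    define f where "f x = max 0 (\<phi> x - \<phi> x0)" for x
    define e :: "nat \<Rightarrow> real" where "e x = (if x0 \<le> x then 1 else 0)" for x
    have nn: "0 \<le> f y" for y by (simp add: f_def)
    have inc: "f (Suc y) = f y + e y * r y" for y
      using \<phi>mono[of y x0] \<phi>mono[of "Suc y" x0] \<phi>mono[of x0 y] \<phi>S[of y] rp[of y]
      by (cases "x0 \<le> y") (auto simp: f_def e_def)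
    define C where "C = (\<integral>\<^sup>+\<omega>. ennreal (f (X n \<omega>)) \<partial>M)"
    \<comment> \<open>Without killing, \<open>f\<close> gains at most \<open>r x0\<close> per step, at its only break point \<open>x0\<close>.\<close>
    have Cfin: "C < \<infinity>"
    proof -
      have "(\<integral>\<^sup>+\<omega>. ennreal (f (X n \<omega>)) \<partial>M) \<le> ennreal (f x0 + n * r x0)" for n
      proof (induction n)
        case 0
        have "(\<integral>\<^sup>+\<omega>. ennreal (f (X 0 \<omega>)) \<partial>M) = (\<integral>\<^sup>+\<omega>. ennreal (f x0) \<partial>M)"
          using initial by (intro nn_integral_cong_AE) auto
        then show ?case by (simp add: emeasure_space_1)
      next
        case (Suc n)
        have "(\<integral>\<^sup>+\<omega>. ennreal (f (X (Suc n) \<omega>)) \<partial>M) = (\<integral>\<^sup>+\<omega>. (\<integral>\<^sup>+y. ennreal (f y) \<partial>measure_pmf (K (X n \<omega>))) \<partial>M)"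
          using avoid_step[of "\<lambda>x. ennreal (f x)" n n "{}"] by (simp add: avoid_def cong: nn_integral_cong)
        also have "\<dots> \<le> (\<integral>\<^sup>+\<omega>. ennreal (f (X n \<omega>)) + ennreal (r x0) \<partial>M)"
        proof (intro nn_integral_mono)
          fix \<omega>
          define x where "x = X n \<omega>"
          have "pmf (K x) (Suc x) * r x * (e x - (if x = 0 then 0 else e (x - 1))) \<le> r x0"
          proof (cases "x = x0")
            case True
            have "(e x - (if x = 0 then 0 else e (x - 1))) \<le> 1" by (auto simp: e_def)
            then have "pmf (K x) (Suc x) * r x * (e x - (if x = 0 then 0 else e (x - 1))) \<le> pmf (K x) (Suc x) * r x * 1"
              using rp[of x] by (intro mult_left_mono) auto
            also have "\<dots> \<le> r x0" using True rp[of x] mult_right_mono[OF pmf_le_1[of "K x" "Suc x"], of "r x"] by simp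
            finally show ?thesis .
          next
            case False
            then have "e x - (if x = 0 then 0 else e (x - 1)) = 0" by (cases x) (auto simp: e_def)
            then show ?thesis using rp[of x0] by simp
          qed
          then have "(\<integral>\<^sup>+y. ennreal (f y) \<partial>measure_pmf (K x)) \<le> ennreal (f x + r x0)"
            unfolding birth_death_drift(1)[of K r f e, OF birth_death r nn inc] by (intro ennreal_leI) simp
          also have "\<dots> = ennreal (f x) + ennreal (r x0)" using nn[of x] rp[of x0] by simp
          finally show "(\<integral>\<^sup>+y. ennreal (f y) \<partial>measure_pmf (K (X n \<omega>))) \<le> ennreal (f (X n \<omega>)) + ennreal (r x0)"
            by (simp add: x_def)
        qed
        also have "\<dots> = (\<integral>\<^sup>+\<omega>. ennreal (f (X n \<omega>)) \<partial>M) + ennreal (r x0)"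
          by (subst nn_integral_add) (auto simp: emeasure_space_1)
        also have "\<dots> \<le> ennreal (f x0 + n * r x0) + ennreal (r x0)"
          using Suc by (intro add_right_mono)
        also have "\<dots> = ennreal (f x0 + Suc n * r x0)"
          using nn[of x0] rp[of x0] by (subst ennreal_plus[symmetric]) (auto simp: algebra_simps)
        finally show ?case .
      qed
      from this[of n] show ?thesis unfolding C_def by (rule order.strict_trans1) simp
    qed
    define P where "P = emeasure M {\<omega>\<in>space M. \<forall>k\<ge>n. X k \<omega> \<noteq> x0}"
    have split: "P \<le> (\<Sum>x<L. a x i) + C / ennreal (\<phi> L - \<phi> x0)" if L: "\<phi> L > \<phi> x0" for L i
    proof -
      have "P \<le> emeasure M ((\<Union>x<L. {\<omega>\<in>avoid n {x0} (n + i). X (n + i) \<omega> = x}) \<union>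
          {\<omega>\<in>space M. ennreal (\<phi> L - \<phi> x0) \<le> ennreal (f (X (n + i) \<omega>)) * indicator (avoid n {x0} (n + i)) \<omega>})"
        unfolding P_def
      proof (intro emeasure_mono subsetI)
        fix \<omega> assume w: "\<omega> \<in> {\<omega>\<in>space M. \<forall>k\<ge>n. X k \<omega> \<noteq> x0}"
        then have av: "\<omega> \<in> avoid n {x0} (n + i)" by (auto simp: avoid_def)
        show "\<omega> \<in> (\<Union>x<L. {\<omega>\<in>avoid n {x0} (n + i). X (n + i) \<omega> = x}) \<union>
          {\<omega>\<in>space M. ennreal (\<phi> L - \<phi> x0) \<le> ennreal (f (X (n + i) \<omega>)) * indicator (avoid n {x0} (n + i)) \<omega>}"
        proof (cases "X (n + i) \<omega> < L")
          case True then show ?thesis using av by auto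
        next
          case False
          then have "\<phi> L \<le> \<phi> (X (n + i) \<omega>)" by (intro \<phi>mono) simp
          then have "ennreal (\<phi> L - \<phi> x0) \<le> ennreal (f (X (n + i) \<omega>))" by (intro ennreal_leI) (simp add: f_def)
          then show ?thesis using av w by simp
        qed
      qed (auto simp: avoid_def)
      also have "\<dots> \<le> emeasure M (\<Union>x<L. {\<omega>\<in>avoid n {x0} (n + i). X (n + i) \<omega> = x}) +
         emeasure M {\<omega>\<in>space M. ennreal (\<phi> L - \<phi> x0) \<le> ennreal (f (X (n + i) \<omega>)) * indicator (avoid n {x0} (n + i)) \<omega>}"
        by (intro emeasure_subadditive) (auto simp: avoid_def)
      also have "emeasure M (\<Union>x<L. {\<omega>\<in>avoid n {x0} (n + i). X (n + i) \<omega> = x}) \<le> (\<Sum>x<L. a x i)"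
        unfolding a_def by (intro emeasure_subadditive_finite) (auto simp: avoid_def)
      also have "emeasure M {\<omega>\<in>space M. ennreal (\<phi> L - \<phi> x0) \<le> ennreal (f (X (n + i) \<omega>)) * indicator (avoid n {x0} (n + i)) \<omega>} \<le> C / ennreal (\<phi> L - \<phi> x0)"
      proof -
        have "ennreal (\<phi> L - \<phi> x0) * emeasure M {\<omega>\<in>space M. ennreal (\<phi> L - \<phi> x0) \<le> ennreal (f (X (n + i) \<omega>)) * indicator (avoid n {x0} (n + i)) \<omega>}
          \<le> (\<integral>\<^sup>+\<omega>. ennreal (f (X (n + i) \<omega>)) * indicator (avoid n {x0} (n + i)) \<omega> \<partial>M)"
          by (subst nn_integral_cmult_indicator[symmetric]) (auto intro!: nn_integral_mono simp: indicator_def split: if_splits)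
        also have "\<dots> \<le> C" unfolding C_def
        proof (rule killed_mass)
          fix x assume x: "x \<notin> {x0}"
          have "pmf (K x) (Suc x) * r x * (e x - (if x = 0 then 0 else e (x - 1))) \<le> 0"
            using x by (cases x) (auto simp: e_def)
          then show "(\<integral>\<^sup>+y. ennreal (f y) \<partial>measure_pmf (K x)) \<le> ennreal (f x)"
            unfolding birth_death_drift(1)[of K r f e, OF birth_death r nn inc] by (intro ennreal_leI) simp
        qed
        finally have "ennreal (\<phi> L - \<phi> x0) * emeasure M {\<omega>\<in>space M. ennreal (\<phi> L - \<phi> x0) \<le> ennreal (f (X (n + i) \<omega>)) * indicator (avoid n {x0} (n + i)) \<omega>} / ennreal (\<phi> L - \<phi> x0) \<le> C / ennreal (\<phi> L - \<phi> x0)"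
          by (rule divide_right_mono_ennreal)
        then show ?thesis using L
          by (subst (asm) mult.commute, subst (asm) ennreal_mult_divide_eq) (auto simp: ennreal_eq_0_iff)
      qed
      finally show ?thesis by (simp add: add_mono)
    qed
    have lim: "P \<le> C / ennreal (\<phi> L - \<phi> x0)" if L: "\<phi> L > \<phi> x0" for L
    proof (rule tendsto_lowerbound)
      have "(\<lambda>i. (\<Sum>x<L. a x i) + C / ennreal (\<phi> L - \<phi> x0)) \<longlonglongrightarrow> (\<Sum>x<L. 0) + C / ennreal (\<phi> L - \<phi> x0)"
        by (intro tendsto_add tendsto_sum a0 tendsto_const)
      then show "(\<lambda>i. (\<Sum>x<L. a x i) + C / ennreal (\<phi> L - \<phi> x0)) \<longlonglongrightarrow> C / ennreal (\<phi> L - \<phi> x0)" by simp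
      show "\<forall>\<^sub>F i in sequentially. P \<le> (\<Sum>x<L. a x i) + C / ennreal (\<phi> L - \<phi> x0)"
        using split[OF L] by simp
    qed simp
    have "P = 0"
    proof (rule ccontr)
      assume "P \<noteq> 0"
      moreover have "P \<noteq> \<top>" unfolding P_def by simp
      ultimately obtain p where p: "P = ennreal p" "p > 0" by (cases P) auto
      obtain c where c: "C = ennreal c" "c \<ge> 0" using Cfin by (cases C) auto
      obtain L where L: "\<phi> L \<ge> \<phi> x0 + (c + 1) / p + 1" using unb by blast
      have gt: "\<phi> L > \<phi> x0" using L c p by (smt (verit) divide_nonneg_pos)
      have "ennreal p \<le> ennreal (c / (\<phi> L - \<phi> x0))"
        using lim[OF gt] gt p c by (simp add: divide_ennreal)
      then have "p \<le> c / (\<phi> L - \<phi> x0)" using c gt by (subst (asm) ennreal_le_iff) auto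
      then have "p * (\<phi> L - \<phi> x0) \<le> c" using gt by (simp add: field_simps)
      moreover have "p * ((c + 1) / p + 1) \<le> p * (\<phi> L - \<phi> x0)" using L p by (intro mult_left_mono) auto
      moreover have "p * ((c + 1) / p + 1) = c + 1 + p" using p by (simp add: field_simps)
      ultimately show False using p by simp
    qed
    then show ?thesis by (simp add: P_def)
  qed
  have "AE \<omega> in M. \<forall>n. \<not> (\<forall>k\<ge>n. X k \<omega> \<noteq> x0)"
    unfolding AE_all_countable
  proof
    fix n
    show "AE \<omega> in M. \<not> (\<forall>k\<ge>n. X k \<omega> \<noteq> x0)"
      by (rule AE_I[OF _ never[of n]]) auto
  qed
  then show ?thesis unfolding recurrent_def
    by eventually_elim (auto simp: infinite_nat_iff_unbounded_le)
qed

end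

section \<open>Crossing counts and an Abel--Dini estimate\<close>

lemma ennreal_num_crossings:
  "ennreal_of_enat (num_crossings x i) =
   (\<Sum>n. if {x n, x (Suc n)} = {i, i + 1} then 1 else 0)"
proof -
  have "(\<Sum>n. if {x n, x (Suc n)} = {i, i + 1} then 1 else (0::ennreal)) =
     (\<Sum>n. indicator (crossing_times x i) n)"
    by (intro suminf_cong) (simp add: crossing_times_def indicator_def)
  also have "\<dots> = (\<integral>\<^sup>+n. indicator (crossing_times x i) n \<partial>count_space UNIV)"
    by (simp add: nn_integral_count_space_nat)
  also have "\<dots> = emeasure (count_space UNIV) (crossing_times x i)"
    by simp
  finally show ?thesis
    by (simp add: emeasure_count_space num_crossings_def ennreal_of_nat_eq_real_of_nat)
qed

text \<open>
  The linearisation of \<open>1 / N\<close> at \<open>N = 1 / t\<close>.  It replaces the Cauchy--Schwarz inequality and stays meaningful for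
  \<open>N = 0\<close> and \<open>N = \<infinity>\<close>.
\<close>

lemma am_gm_enat:
  assumes "0 \<le> t"
  shows "ennreal (2 * t) \<le> 1 / ennreal_of_enat N + ennreal (t^2) * ennreal_of_enat N"
proof (cases N)
  case (enat n)
  show ?thesis
  proof (cases "n = 0")
    case True then show ?thesis using enat by simp
  next
    case False
    then have n: "real n > 0" by simp
    have "0 \<le> (1 - t * n)^2 / n" using n by simp
    also have "\<dots> = 1 / n + t^2 * n - 2 * t"
      using n by (simp add: power2_eq_square field_simps)
    finally have "2 * t \<le> 1 / n + t^2 * n" by simp
    then have "ennreal (2 * t) \<le> ennreal (1 / n + t^2 * n)" by (rule ennreal_leI)
    also have "\<dots> = 1 / ennreal (real n) + ennreal (t^2) * ennreal (real n)"
      using n by (simp add: ennreal_mult divide_ennreal[symmetric] ennreal_1[symmetric] del: ennreal_1)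
    finally show ?thesis using enat by (simp add: ennreal_of_nat_eq_real_of_nat)
  qed
next
  case infinity
  then show ?thesis using assms by (cases "t = 0") (auto simp: ennreal_mult_top)
qed

text \<open>
  With \<open>v i\<close> the tail sum, \<open>r i / v i \<ge> (v i - v (i + 1)) / v N\<close> for \<open>i \<ge> N\<close>; the right-hand sides add up
  to \<open>1\<close> from every starting point \<open>N\<close>, against the Cauchy criterion.
\<close>

lemma not_summable_ratio_tail:
  fixes r :: "nat \<Rightarrow> real"
  assumes pos: "\<And>x. 0 < r x" and summ: "summable r"
  shows "\<not> summable (\<lambda>i. r i / (\<Sum>j. r (j + i)))"
proof
  define v where "v i = (\<Sum>j. r (j + i))" for i
  have summ': "summable (\<lambda>j. r (j + k))" for k using summ by (subst summable_iff_shift)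
  have vpos: "v i > 0" for i unfolding v_def using pos by (intro suminf_pos summ') auto
  have vS: "v (Suc i) = v i - r i" for i
    using suminf_split_head[OF summ'[of i]] by (simp add: v_def)
  have v0: "v \<longlonglongrightarrow> 0"
  proof -
    have "v i = suminf r - sum r {..<i}" for i
      using suminf_minus_initial_segment[OF summ, of i] by (simp add: v_def)
    then have "v = (\<lambda>i. suminf r - sum r {..<i})" by auto
    moreover have "(\<lambda>i. suminf r - sum r {..<i}) \<longlonglongrightarrow> suminf r - suminf r"
      by (intro tendsto_diff tendsto_const summable_LIMSEQ summ)
    ultimately show ?thesis by simp
  qed
  assume "summable (\<lambda>i. r i / (\<Sum>j. r (j + i)))"
  then have s: "summable (\<lambda>i. r i / v i)" by (simp add: v_def)
  have vdec: "v (m + k) \<le> v m" for m k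
    by (induction k) (simp, smt (verit) vS pos add_Suc_right)
  from s obtain N where N: "\<And>n. norm (\<Sum>i=N..<n. r i / v i) < 1/2"
    unfolding summable_Cauchy by (metis half_gt_zero_iff order_refl zero_less_one)
  have "(\<Sum>i=N..<N + k. r i / v i) \<ge> (v N - v (N + k)) / v N" for k
  proof (induction k)
    case (Suc k)
    have "r (N + k) / v N \<le> r (N + k) / v (N + k)"
      using vdec[of N k] vpos pos by (intro divide_left_mono mult_pos_pos) (auto simp: less_imp_le)
    then show ?case using Suc by (simp add: vS diff_divide_distrib)
  qed simp
  moreover have "(\<lambda>k. (v N - v (N + k)) / v N) \<longlonglongrightarrow> (v N - 0) / v N"
    using vpos[of N] LIMSEQ_ignore_initial_segment[OF v0, of N]
    by (intro tendsto_intros) (auto simp: add.commute)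
  then have "(\<lambda>k. (v N - v (N + k)) / v N) \<longlonglongrightarrow> 1" using vpos[of N] by simp
  then have "eventually (\<lambda>k. (v N - v (N + k)) / v N > 1/2) sequentially"
    by (rule order_tendstoD) simp
  then obtain k where "(v N - v (N + k)) / v N > 1/2" by (auto simp: eventually_sequentially)
  ultimately show False using N[of "N + k"] by (smt (verit) real_norm_def)
qed

section \<open>Divergence for transient chains\<close>

context birth_death_chain
begin

text \<open>
  Upward crossings start at \<open>i\<close> and downward ones at \<open>i + 1\<close>.  By the balance equation, \<open>r i\<close> times
  either expectation is the quantity bounded in \<open>expected_visits\<close>.
\<close>

lemma expected_crossings:
  assumes r: "resistances K r" and summ: "summable r"
  shows "ennreal (r i) * (\<integral>\<^sup>+\<omega>. ennreal_of_enat (num_crossings (\<lambda>n. X n \<omega>) i) \<partial>M) \<le>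
     ennreal (2 * (\<Sum>j. r (j + i)))"
proof -
  have rp: "r x > 0" for x using r by (simp add: resistances_def)
  have summ': "summable (\<lambda>j. r (j + k))" for k using summ by (subst summable_iff_shift)
  have eq: "r i * pmf (K (Suc i)) i = pmf (K (Suc i)) (Suc (Suc i)) * r (Suc i)"
    using r by (simp add: resistances_def mult.commute)
  define P where "P n x = emeasure M {\<omega>\<in>space M. X n \<omega> = x}" for n x
  have d: "ennreal (r i) * (\<Sum>n. ennreal a * Q n) = (\<Sum>n. ennreal (r i * a) * Q n)"
    if "0 \<le> a" for a Q
    using that rp[of i] by (simp add: ennreal_mult mult.assoc)
  have "(\<integral>\<^sup>+\<omega>. ennreal_of_enat (num_crossings (\<lambda>n. X n \<omega>) i) \<partial>M) =
    (\<integral>\<^sup>+\<omega>. (\<Sum>n. indicator {\<omega>\<in>space M. X n \<omega> = i \<and> X (Suc n) \<omega> = Suc i} \<omega> +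
        indicator {\<omega>\<in>space M. X n \<omega> = Suc i \<and> X (Suc n) \<omega> = i} \<omega>) \<partial>M)"
    unfolding ennreal_num_crossings
    by (intro nn_integral_cong suminf_cong) (auto simp: indicator_def doubleton_eq_iff)
  also have "\<dots> = (\<Sum>n. P n i * ennreal (pmf (K i) (Suc i)) + P n (Suc i) * ennreal (pmf (K (Suc i)) i))"
    by (simp add: nn_integral_suminf nn_integral_add state_step P_def)
  also have "\<dots> = (\<Sum>n. ennreal (pmf (K i) (Suc i)) * P n i) + (\<Sum>n. ennreal (pmf (K (Suc i)) i) * P n (Suc i))"
    by (subst suminf_add[symmetric]) (simp_all add: mult.commute)
  finally have "ennreal (r i) * (\<integral>\<^sup>+\<omega>. ennreal_of_enat (num_crossings (\<lambda>n. X n \<omega>) i) \<partial>M) =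
     (\<Sum>n. ennreal (pmf (K i) (Suc i) * r i) * P n i) + (\<Sum>n. ennreal (r i * pmf (K (Suc i)) i) * P n (Suc i))"
    using d[of "pmf (K i) (Suc i)" "\<lambda>n. P n i"] d[of "pmf (K (Suc i)) i" "\<lambda>n. P n (Suc i)"]
    by (simp only: distrib_left mult.commute[of "pmf (K i) (Suc i)"] pmf_nonneg)
  also have "\<dots> \<le> ennreal (\<Sum>j. r (j + i)) + ennreal (\<Sum>j. r (j + Suc i))"
    unfolding eq P_def by (intro add_mono expected_visits[OF r summ])
  also have "\<dots> \<le> ennreal (\<Sum>j. r (j + i)) + ennreal (\<Sum>j. r (j + i))"
    using suminf_split_head[OF summ'[of i]] rp[of i] by (intro add_mono ennreal_leI) auto
  also have "\<dots> = ennreal (2 * (\<Sum>j. r (j + i)))"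
    using rp by (subst ennreal_plus[symmetric]) (auto intro!: suminf_nonneg summ' simp: less_imp_le)
  finally show ?thesis .
qed

lemma num_crossings_measurable[measurable]:
  "(\<lambda>\<omega>. ennreal_of_enat (num_crossings (\<lambda>n. X n \<omega>) i)) \<in> borel_measurable M"
  unfolding ennreal_num_crossings by measurable

text \<open>
  The weights \<open>w i\<close> are chosen so that \<open>w i * E N(i,i+1) \<le> 2\<close>; their divergence does the rest.
\<close>

lemma sum_inverse_crossings_infinite:
  assumes r: "resistances K r" and summ: "summable r"
  shows "AE \<omega> in M. (\<Sum>i. 1 / ennreal_of_enat (num_crossings (\<lambda>n. X n \<omega>) i)) = \<infinity>"
proof -
  have rp: "r x > 0" for x using r by (simp add: resistances_def)
  have summ': "summable (\<lambda>j. r (j + k))" for k using summ by (subst summable_iff_shift)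
  define N where "N i \<omega> = ennreal_of_enat (num_crossings (\<lambda>n. X n \<omega>) i)" for i \<omega>
  have [measurable]: "N i \<in> borel_measurable M" for i unfolding N_def by measurable
  define w where "w i = r i / (\<Sum>j. r (j + i))" for i
  define S where "S n = (\<Sum>i<n. w i)" for n
  have vpos: "(\<Sum>j. r (j + i)) > 0" for i using rp by (intro suminf_pos summ') auto
  have wpos: "w i > 0" for i using vpos[of i] rp by (simp add: w_def)
  have EN: "ennreal (w i) * (\<integral>\<^sup>+\<omega>. N i \<omega> \<partial>M) \<le> 2" for i
  proof -
    define v where "v = (\<Sum>j. r (j + i))"
    have v: "v > 0" using vpos[of i] by (simp add: v_def)
    have "ennreal (w i) * (\<integral>\<^sup>+\<omega>. N i \<omega> \<partial>M) = ennreal (1 / v) * (ennreal (r i) * (\<integral>\<^sup>+\<omega>. N i \<omega> \<partial>M))"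
      using v rp[of i] by (simp add: w_def v_def[symmetric] mult.assoc[symmetric] ennreal_mult[symmetric])
    also have "\<dots> \<le> ennreal (1 / v) * ennreal (2 * v)"
      unfolding N_def v_def by (intro mult_left_mono expected_crossings[OF r summ]) simp
    also have "\<dots> = 2" using v by (simp add: ennreal_mult[symmetric])
    finally show ?thesis .
  qed
  have unb: "\<exists>n. S n \<ge> c" for c
  proof (rule ccontr)
    assume "\<not> ?thesis"
    then have "\<And>n. S n \<le> c" by (meson not_le less_imp_le)
    then have "summable w" using wpos by (intro summableI_nonneg_bounded[of w c]) (auto simp: S_def less_imp_le)
    with not_summable_ratio_tail[OF rp summ] show False by (simp add: w_def[abs_def])
  qed
  define T where "T \<omega> = (\<Sum>i. 1 / N i \<omega>)" for \<omega>
  have [measurable]: "T \<in> borel_measurable M" unfolding T_def by measurable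
  have bound: "P * ennreal (S n) \<le> ennreal (2 * C)"
    if C: "C > 0" and Sn: "S n > 0" and P: "P = emeasure M {\<omega>\<in>space M. T \<omega> \<le> ennreal C}" for C n P
  proof -
    \<comment> \<open>With this slope the linear terms of the inequality add up to \<open>2 * C\<close>, twice the assumed bound on \<open>T\<close>.\<close>
    define \<epsilon> where "\<epsilon> = C / S n"
    have \<epsilon>: "\<epsilon> > 0" using C Sn by (simp add: \<epsilon>_def)
    define Z where "Z \<omega> = (\<Sum>i<n. ennreal ((\<epsilon> * w i)^2) * N i \<omega>)" for \<omega>
    have [measurable]: "Z \<in> borel_measurable M" unfolding Z_def by measurable
    have ptw: "ennreal (2 * C) \<le> T \<omega> + Z \<omega>" for \<omega>
    proof -
      have "2 * C = (\<Sum>i<n. 2 * (\<epsilon> * w i))"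
      proof -
        have "(\<Sum>i<n. 2 * (\<epsilon> * w i)) = 2 * \<epsilon> * S n" by (simp add: S_def sum_distrib_left mult.assoc)
        then show ?thesis using Sn by (simp add: \<epsilon>_def)
      qed
      then have "ennreal (2 * C) = (\<Sum>i<n. ennreal (2 * (\<epsilon> * w i)))"
        using \<epsilon> wpos by (subst sum_ennreal) (auto simp: less_imp_le)
      also have "\<dots> \<le> (\<Sum>i<n. 1 / N i \<omega> + ennreal ((\<epsilon> * w i)^2) * N i \<omega>)"
        unfolding N_def using \<epsilon> wpos by (intro sum_mono am_gm_enat) (auto simp: less_imp_le)
      also have "\<dots> = (\<Sum>i<n. 1 / N i \<omega>) + Z \<omega>" by (simp add: sum.distrib Z_def)
      also have "(\<Sum>i<n. 1 / N i \<omega>) \<le> T \<omega>" unfolding T_def by (intro sum_le_suminf) auto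
      finally show ?thesis by (simp add: add_right_mono)
    qed
    have "ennreal C * P \<le> (\<integral>\<^sup>+\<omega>. Z \<omega> \<partial>M)"
    proof -
      have "ennreal C * P = (\<integral>\<^sup>+\<omega>. ennreal C * indicator {\<omega>\<in>space M. T \<omega> \<le> ennreal C} \<omega> \<partial>M)"
        unfolding P by (subst nn_integral_cmult_indicator) auto
      also have "\<dots> \<le> (\<integral>\<^sup>+\<omega>. Z \<omega> \<partial>M)"
      proof (intro nn_integral_mono)
        fix \<omega>
        show "ennreal C * indicator {\<omega>\<in>space M. T \<omega> \<le> ennreal C} \<omega> \<le> Z \<omega>"
        proof (cases "T \<omega> \<le> ennreal C")
          case True
          have "ennreal C + ennreal C = ennreal (2 * C)" using C by (simp flip: ennreal_plus)
          also have "\<dots> \<le> ennreal C + Z \<omega>" using ptw[of \<omega>] True by (meson add_right_mono order_trans)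
          finally have "ennreal C \<le> Z \<omega>" by simp
          then show ?thesis by (simp add: indicator_def)
        qed simp
      qed
      finally show ?thesis .
    qed
    also have "\<dots> = (\<Sum>i<n. ennreal ((\<epsilon> * w i)^2) * (\<integral>\<^sup>+\<omega>. N i \<omega> \<partial>M))"
      unfolding Z_def by (simp add: nn_integral_sum nn_integral_cmult)
    also have "\<dots> = (\<Sum>i<n. ennreal (\<epsilon>^2 * w i) * (ennreal (w i) * (\<integral>\<^sup>+\<omega>. N i \<omega> \<partial>M)))"
    proof (intro sum.cong refl)
      fix i
      have "ennreal ((\<epsilon> * w i)^2) = ennreal (\<epsilon>^2 * w i) * ennreal (w i)"
        using wpos[of i] \<epsilon> by (subst ennreal_mult[symmetric]) (auto simp: power2_eq_square mult_ac)
      then show "ennreal ((\<epsilon> * w i)^2) * (\<integral>\<^sup>+\<omega>. N i \<omega> \<partial>M) = ennreal (\<epsilon>^2 * w i) * (ennreal (w i) * (\<integral>\<^sup>+\<omega>. N i \<omega> \<partial>M))"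
        by (simp add: mult.assoc)
    qed
    also have "\<dots> \<le> (\<Sum>i<n. ennreal (\<epsilon>^2 * w i) * 2)"
      by (intro sum_mono mult_left_mono EN) simp
    also have "\<dots> = ennreal (\<epsilon>^2 * S n * 2)"
    proof -
      have "(\<Sum>i<n. ennreal (\<epsilon>^2 * w i) * 2) = (\<Sum>i<n. ennreal (\<epsilon>^2 * w i * 2))"
        using wpos by (intro sum.cong refl) (simp add: ennreal_mult less_imp_le)
      also have "\<dots> = ennreal (\<Sum>i<n. \<epsilon>^2 * w i * 2)"
        using wpos by (intro sum_ennreal) (simp add: less_imp_le)
      finally show ?thesis by (simp add: S_def sum_distrib_left sum_distrib_right)
    qed
    also have "\<epsilon>^2 * S n * 2 = C * (2 * C / S n)" using Sn by (simp add: \<epsilon>_def power2_eq_square)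
    finally have 1: "ennreal C * P \<le> ennreal (C * (2 * C / S n))" .
    have "P \<le> 1" unfolding P by (rule emeasure_le_1)
    then obtain p where p: "P = ennreal p" "p \<ge> 0" by (cases P) (auto simp: top_unique)
    from 1 have "ennreal (C * p) \<le> ennreal (C * (2 * C / S n))" using C p by (simp add: ennreal_mult)
    then have "C * p \<le> C * (2 * C / S n)" using C Sn by (subst (asm) ennreal_le_iff) auto
    then have "p \<le> 2 * C / S n" using C by (rule mult_left_le_imp_le)
    then have "p * S n \<le> 2 * C" using Sn by (simp add: field_simps)
    then show ?thesis using p Sn by (simp add: ennreal_mult[symmetric] ennreal_leI)
  qed
  have zero: "emeasure M {\<omega>\<in>space M. T \<omega> \<le> ennreal C} = 0" if C: "C > 0" for C
  proof (rule ccontr)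
    define P where "P = emeasure M {\<omega>\<in>space M. T \<omega> \<le> ennreal C}"
    assume "emeasure M {\<omega>\<in>space M. T \<omega> \<le> ennreal C} \<noteq> 0"
    then have "P \<noteq> 0" "P \<noteq> \<top>" by (auto simp: P_def)
    then obtain p where p: "P = ennreal p" "p > 0" by (cases P) auto
    obtain n where n: "S n \<ge> 2 * C / p + 1" using unb by blast
    then have Sn: "S n > 0" using C p by (smt (verit) divide_pos_pos)
    have "ennreal (p * S n) \<le> ennreal (2 * C)"
      using bound[OF C Sn P_def] p Sn by (simp add: ennreal_mult)
    then have "p * S n \<le> 2 * C" using C by (subst (asm) ennreal_le_iff) auto
    moreover have "p * (2 * C / p + 1) \<le> p * S n" using n p by (intro mult_left_mono) auto
    ultimately show False using p by (simp add: distrib_left)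
  qed
  have "AE \<omega> in M. \<forall>k::nat. \<not> T \<omega> \<le> ennreal (real (Suc k))"
    unfolding AE_all_countable
  proof
    fix k :: nat
    show "AE \<omega> in M. \<not> T \<omega> \<le> ennreal (real (Suc k))"
      by (rule AE_I[OF _ zero[of "real (Suc k)"]]) auto
  qed
  then show ?thesis
  proof eventually_elim
    case (elim \<omega>)
    have "T \<omega> = \<top>"
    proof (rule ccontr)
      assume "T \<omega> \<noteq> \<top>"
      then obtain t where t: "T \<omega> = ennreal t" "t \<ge> 0" by (cases "T \<omega>") auto
      obtain k where "t \<le> real k" using real_arch_simple by blast
      then have "T \<omega> \<le> ennreal (real (Suc k))" unfolding t by (intro ennreal_leI) simp
      with elim show False by blast
    qed
    then show ?case by (simp add: T_def N_def)
  qed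
qed

lemma transient_sum_inverse_crossings:
  assumes "transient M x0 X"
  shows "AE \<omega> in M. (\<Sum>i. 1 / ennreal_of_enat (num_crossings (\<lambda>n. X n \<omega>) i)) = \<infinity>"
proof -
  obtain r where r: "resistances K r" using resistances_exist[OF birth_death] by blast
  have "summable r" using recurrent_if_not_summable[OF r] assms by (auto simp: transient_def)
  with r show ?thesis by (rule sum_inverse_crossings_infinite)
qed

end

section \<open>Negative binomial laws and a logarithmic supermartingale\<close>

lemma sums_minus_ln_one_minus:
  fixes x :: real
  assumes "0 < x" "x < 1"
  shows "(\<lambda>n. x ^ Suc n / real (Suc n)) sums (- ln (1 - x))"
proof -
  have "summable (\<lambda>n. x ^ Suc n / real (Suc n))"
  proof (rule summable_comparison_test'[of "\<lambda>n. x ^ n"])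
    show "summable (\<lambda>n. x ^ n)" using assms by (intro summable_geometric) simp
    show "norm (x ^ Suc n / real (Suc n)) \<le> x ^ n" for n
    proof -
      have "x ^ Suc n / real (Suc n) \<le> x ^ Suc n / 1" using assms by (intro divide_left_mono) auto
      also have "\<dots> \<le> x ^ n" using assms by (simp add: mult_left_le_one_le)
      finally show ?thesis using assms by simp
    qed
  qed
  moreover have "ln (1 - x) = (\<Sum>n. - (x ^ Suc n / real (Suc n)))"
  proof -
    have eq: "(-1) ^ n * (1 / real (n + 1)) * (1 - x - 1) ^ Suc n = - (x ^ Suc n / real (Suc n))" for n
      by (cases "even n") simp_all
    have "ln (1 - x) = (\<Sum>n. (-1) ^ n * (1 / real (n + 1)) * (1 - x - 1) ^ Suc n)"
      by (rule ln_series) (use assms in auto)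
    then show ?thesis unfolding eq .
  qed
  ultimately have "(\<lambda>n. - (x ^ Suc n / real (Suc n))) sums ln (1 - x)"
    by (simp only: summable_minus summable_sums)
  from sums_minus[OF this] show ?thesis by (simp only: minus_minus)
qed

lemma harm_le_ln: "harm n \<le> 1 + ln (real (Suc n))"
proof -
  have "harm (Suc n) \<le> ln (real (Suc n)) + (1::real)"
    using euler_mascheroni_sequence_decreasing[of 1 "Suc n"] by (simp add: harm_expand)
  moreover have "harm n \<le> (harm (Suc n) :: real)" by (intro harm_mono) simp
  ultimately show ?thesis by simp
qed

lemma harm_le_self: "harm n \<le> real n"
proof (induction n)
  case (Suc n)
  have "inverse (real (Suc n)) \<le> 1" by (simp add: field_simps)
  then show ?case using Suc by (simp add: harm_Suc)
qed (simp add: harm_expand)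

lemma suminf_pmf: "(\<Sum>d. ennreal (pmf (P :: nat pmf) d)) = 1"
proof -
  have "(\<integral>\<^sup>+d. 1 \<partial>measure_pmf P) = 1" by (simp add: measure_pmf.emeasure_space_1)
  then show ?thesis
    by (simp only: nn_integral_measure_pmf nn_integral_count_space_nat mult_1_right)
qed

lemma sum_pmf_Suc:
  "(\<Sum>d. ennreal (pmf (P :: nat pmf) (Suc d))) = ennreal (1 - pmf P 0)"
proof -
  have one: "(\<Sum>d. ennreal (pmf P d)) = 1" by (rule suminf_pmf)
  then have s: "summable (\<lambda>d. pmf P d)" by (intro summable_suminf_not_top) auto
  have "ennreal (\<Sum>d. pmf P d) = ennreal 1" using one s by (subst suminf_ennreal2[symmetric]) auto
  then have "(\<Sum>d. pmf P d) = 1" by (subst (asm) ennreal_inj) (auto intro: suminf_nonneg s)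
  then have "(\<Sum>d. pmf P (Suc d)) = 1 - pmf P 0" using suminf_split_head[OF s] by simp
  moreover have "summable (\<lambda>d. pmf P (Suc d))" using s by (subst summable_Suc_iff)
  ultimately show ?thesis by (subst suminf_ennreal2) auto
qed

context
  fixes p :: real assumes p: "0 < p" "p < 1"
begin

lemma p_in: "p \<in> {0<..1}" using p by simp

text \<open>
  Conditioning on the first trial.  Together with \<open>harm (Suc d) - harm d = 1 / Suc d\<close> this computes the mean of
  \<open>harm\<close> recursively.
\<close>

lemma neg_binomial_first_step:
  fixes f :: "nat \<Rightarrow> ennreal"
  shows "(\<integral>\<^sup>+d. f d \<partial>measure_pmf (neg_binomial_pmf (Suc n) p)) =
    ennreal p * (\<integral>\<^sup>+d. f d \<partial>measure_pmf (neg_binomial_pmf n p)) +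
    ennreal (1 - p) * (\<integral>\<^sup>+d. f (Suc d) \<partial>measure_pmf (neg_binomial_pmf (Suc n) p))"
  by (subst neg_binomial_pmf_unfold[OF p_in]) (use p in \<open>simp add: mult.commute\<close>)

text \<open>
  The factor \<open>1 / (d + 1)\<close> turns the weights with parameter \<open>n + 1\<close> into the shifted weights with parameter
  \<open>n\<close>, by the absorption identity of binomial coefficients; only the mass at \<open>0\<close> is lost by the shift.
\<close>

lemma neg_binomial_inverse_Suc:
  assumes n: "n > 0"
  shows "(\<integral>\<^sup>+d. ennreal (inverse (real (Suc d))) \<partial>measure_pmf (neg_binomial_pmf (Suc n) p)) =
    ennreal (p / ((1 - p) * n) * (1 - p ^ n))"
proof -
  have eq: "pmf (neg_binomial_pmf (Suc n) p) d * inverse (real (Suc d)) =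
     p / ((1 - p) * n) * pmf (neg_binomial_pmf n p) (Suc d)" for d
  proof -
    have "real (Suc d) * real ((d + n) choose (Suc d)) = real n * real ((d + n) choose d)"
      using binomial_absorb_comp[of "d + n" d] binomial_absorption[of d "d + n"]
      by (metis (no_types, lifting) Suc_times_binomial_add add.commute add_diff_cancel_left' binomial_absorb_comp of_nat_mult)
    then have "real ((d + n) choose d) * inverse (real (Suc d)) = real ((d + n) choose (Suc d)) / n"
      using n by (simp add: field_simps)
    then show ?thesis
      using n p by (simp add: pmf_neg_binomial[OF p_in] field_simps)
  qed
  have c: "0 \<le> p / ((1 - p) * n)" using p by simp
  have "(\<integral>\<^sup>+d. ennreal (inverse (real (Suc d))) \<partial>measure_pmf (neg_binomial_pmf (Suc n) p)) =
    (\<Sum>d. ennreal (pmf (neg_binomial_pmf (Suc n) p) d * inverse (real (Suc d))))"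
    by (simp add: nn_integral_measure_pmf nn_integral_count_space_nat ennreal_mult)
  also have "\<dots> = (\<Sum>d. ennreal (p / ((1 - p) * n)) * ennreal (pmf (neg_binomial_pmf n p) (Suc d)))"
    unfolding eq using c by (simp only: ennreal_mult pmf_nonneg)
  also have "\<dots> = ennreal (p / ((1 - p) * n)) * ennreal (1 - pmf (neg_binomial_pmf n p) 0)"
    by (simp only: ennreal_suminf_cmult sum_pmf_Suc)
  also have "\<dots> = ennreal (p / ((1 - p) * n) * (1 - pmf (neg_binomial_pmf n p) 0))"
    using c by (subst ennreal_mult) (auto simp: pmf_le_1)
  finally show ?thesis by (simp add: pmf_neg_binomial[OF p_in])
qed

lemma geometric_inverse_Suc:
  "(\<integral>\<^sup>+d. ennreal (inverse (real (Suc d))) \<partial>measure_pmf (geometric_pmf p)) =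
    ennreal (p / (1 - p) * - ln p)"
proof -
  have c: "0 \<le> p / (1 - p)" using p by simp
  have eq: "pmf (geometric_pmf p) d * inverse (real (Suc d)) =
     p / (1 - p) * ((1 - p) ^ Suc d / real (Suc d))" for d
    using p p_in by (simp add: inverse_eq_divide mult_ac)
  have s: "(\<lambda>n. (1 - p) ^ Suc n / real (Suc n)) sums (- ln p)"
    using sums_minus_ln_one_minus[of "1 - p"] p by simp
  have "(\<integral>\<^sup>+d. ennreal (inverse (real (Suc d))) \<partial>measure_pmf (geometric_pmf p)) =
    (\<Sum>d. ennreal (pmf (geometric_pmf p) d * inverse (real (Suc d))))"
    by (simp only: nn_integral_measure_pmf nn_integral_count_space_nat ennreal_mult pmf_nonneg inverse_nonnegative_iff_nonnegative of_nat_0_le_iff)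
  also have "\<dots> = ennreal (p / (1 - p) * - ln p)"
    unfolding eq using sums_mult[OF s, of "p / (1 - p)"] p
    by (subst suminf_ennreal2) (auto simp: sums_iff)
  finally show ?thesis .
qed

lemma integrable_neg_binomial_harm: "integrable (measure_pmf (neg_binomial_pmf n p)) (harm :: nat \<Rightarrow> real)"
  by (rule Bochner_Integration.integrable_bound[OF integrable_neg_binomial_pmf_real[OF p_in, of n]])
     (auto simp: harm_le_self)

definition mean_harm :: "nat \<Rightarrow> real" where
  "mean_harm n = measure_pmf.expectation (neg_binomial_pmf n p) harm"

lemma mean_harm_nonneg: "0 \<le> mean_harm n" unfolding mean_harm_def by (intro Bochner_Integration.integral_nonneg) (simp add: harm_nonneg)

lemma nn_mean_harm: "(\<integral>\<^sup>+d. ennreal (harm d) \<partial>measure_pmf (neg_binomial_pmf n p)) = ennreal (mean_harm n)"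
  unfolding mean_harm_def by (intro nn_integral_eq_integral integrable_neg_binomial_harm) (simp add: harm_nonneg)

lemma mean_harm_step:
  assumes e: "(\<integral>\<^sup>+d. ennreal (inverse (real (Suc d))) \<partial>measure_pmf (neg_binomial_pmf (Suc n) p)) =
    ennreal (p / (1 - p) * e)" "0 \<le> e"
  shows "mean_harm (Suc n) = mean_harm n + e"
proof -
  have "(\<integral>\<^sup>+d. ennreal (harm (Suc d)) \<partial>measure_pmf (neg_binomial_pmf (Suc n) p)) =
     (\<integral>\<^sup>+d. ennreal (harm d) + ennreal (inverse (real (Suc d))) \<partial>measure_pmf (neg_binomial_pmf (Suc n) p))"
    by (intro nn_integral_cong) (simp add: harm_Suc harm_nonneg)
  also have "\<dots> = ennreal (mean_harm (Suc n)) + ennreal (p / (1 - p) * e)"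
  proof -
    have "(\<integral>\<^sup>+d. ennreal (harm d) + ennreal (inverse (real (Suc d))) \<partial>measure_pmf (neg_binomial_pmf (Suc n) p)) =
      (\<integral>\<^sup>+d. ennreal (harm d) \<partial>measure_pmf (neg_binomial_pmf (Suc n) p)) +
      (\<integral>\<^sup>+d. ennreal (inverse (real (Suc d))) \<partial>measure_pmf (neg_binomial_pmf (Suc n) p))"
      by (rule nn_integral_add) auto
    then show ?thesis unfolding nn_mean_harm e .
  qed
  finally have "ennreal (mean_harm (Suc n)) = ennreal p * ennreal (mean_harm n) +
     ennreal (1 - p) * (ennreal (mean_harm (Suc n)) + ennreal (p / (1 - p) * e))"
    using neg_binomial_first_step[where f="\<lambda>d. ennreal (harm d)" and n=n] by (simp add: nn_mean_harm)
  also have "\<dots> = ennreal (p * mean_harm n + (1 - p) * (mean_harm (Suc n) + p / (1 - p) * e))"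
    using p e mean_harm_nonneg by (simp add: ennreal_mult[symmetric] ennreal_plus[symmetric] del: ennreal_plus)
  finally have "mean_harm (Suc n) = p * mean_harm n + (1 - p) * (mean_harm (Suc n) + p / (1 - p) * e)"
    using p e mean_harm_nonneg by (subst (asm) ennreal_inj) auto
  also have "\<dots> = p * mean_harm n + (1 - p) * mean_harm (Suc n) + p * e" using p by (simp add: field_simps)
  finally have "p * mean_harm (Suc n) = p * (mean_harm n + e)" by (simp add: algebra_simps)
  then show ?thesis using p by simp
qed

lemma mean_harm_1: "mean_harm (Suc 0) = - ln p"
proof -
  have "mean_harm 0 = 0" by (simp add: mean_harm_def harm_expand)
  then show ?thesis using mean_harm_step[of 0 "- ln p"] geometric_inverse_Suc p by simp
qed

lemma mean_harm_exact: "mean_harm (Suc n) = - ln p + harm n - (\<Sum>k<n. p ^ Suc k / real (Suc k))"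
proof (induction n)
  case 0 then show ?case by (simp add: mean_harm_1 harm_expand)
next
  case (Suc n)
  have "mean_harm (Suc (Suc n)) = mean_harm (Suc n) + (1 - p ^ Suc n) / Suc n"
  proof (rule mean_harm_step)
    show "(\<integral>\<^sup>+d. ennreal (inverse (real (Suc d))) \<partial>measure_pmf (neg_binomial_pmf (Suc (Suc n)) p)) =
      ennreal (p / (1 - p) * ((1 - p ^ Suc n) / Suc n))"
      unfolding neg_binomial_inverse_Suc[OF zero_less_Suc]
      by (simp only: times_divide_eq_right times_divide_eq_left divide_divide_eq_left mult_ac)
    show "0 \<le> (1 - p ^ Suc n) / Suc n"
      using p by (intro divide_nonneg_nonneg) (auto intro: power_le_one simp del: power_Suc)
  qed
  then show ?case using Suc by (simp add: harm_Suc diff_divide_distrib inverse_eq_divide)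
qed

text \<open>
  In the exact formula, the finite sum is a partial sum of the series of \<open>- ln (1 - p)\<close>.
  Since \<open>harm n\<close> plays the role of \<open>ln (n + 1)\<close> and \<open>(1 - p) / p\<close> is the mean of one geometric variable, this is
  the submartingale property of the logarithm, without error term.
\<close>

lemma mean_harm_lower: "harm n + ln ((1 - p) / p) \<le> mean_harm (Suc n)"
proof -
  have s: "(\<lambda>n. p ^ Suc n / real (Suc n)) sums (- ln (1 - p))"
    by (rule sums_minus_ln_one_minus[OF p])
  have "(\<Sum>k<n. p ^ Suc k / real (Suc k)) \<le> - ln (1 - p)"
    unfolding sums_unique[OF s] using p s by (intro sum_le_suminf) (auto simp: sums_iff)
  then show ?thesis using p by (simp add: mean_harm_exact ln_div)
qed

text \<open>
  Geometric laws are stable under the transition of the crossing counts.  The first trial shows that the mixture \<open>T\<close>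
  loses the same factor from each value to the next.
\<close>

lemma bind_geometric_neg_binomial:
  assumes \<alpha>: "0 < \<alpha>" "\<alpha> \<le> 1"
  shows "bind_pmf (geometric_pmf \<alpha>) (\<lambda>k. neg_binomial_pmf (Suc k) p) = geometric_pmf (p * \<alpha> / (1 - p + p * \<alpha>))"
proof -
  define T where "T = bind_pmf (geometric_pmf \<alpha>) (\<lambda>k. neg_binomial_pmf (Suc k) p)"
  define \<beta> where "\<beta> = p * \<alpha> / (1 - p + p * \<alpha>)"
  have den: "1 - p + p * \<alpha> > 0" using p \<alpha> by (intro add_pos_pos) auto
  have \<beta>: "0 < \<beta>" "\<beta> \<le> 1"
    unfolding \<beta>_def using p \<alpha> den by (simp, simp add: pos_divide_le_eq)
  have 1: "bind_pmf (geometric_pmf \<alpha>) (\<lambda>k. neg_binomial_pmf k p) =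
     bind_pmf (bernoulli_pmf \<alpha>) (\<lambda>b. if b then return_pmf 0 else T)"
  proof -
    have "bind_pmf (geometric_pmf \<alpha>) (\<lambda>k. neg_binomial_pmf k p) =
      bind_pmf (bind_pmf (bernoulli_pmf \<alpha>) (\<lambda>b. if b then return_pmf 0 else map_pmf Suc (geometric_pmf \<alpha>))) (\<lambda>k. neg_binomial_pmf k p)"
      by (rule arg_cong[where f = "\<lambda>G. bind_pmf G (\<lambda>k. neg_binomial_pmf k p)"], rule geometric_bind_pmf_unfold) (use \<alpha> in simp)
    also have "\<dots> = bind_pmf (bernoulli_pmf \<alpha>) (\<lambda>b. bind_pmf (if b then return_pmf 0 else map_pmf Suc (geometric_pmf \<alpha>)) (\<lambda>k. neg_binomial_pmf k p))"
      by (rule bind_assoc_pmf)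
    also have "\<dots> = bind_pmf (bernoulli_pmf \<alpha>) (\<lambda>b. if b then return_pmf 0 else T)"
      by (intro bind_pmf_cong refl) (simp add: bind_return_pmf bind_map_pmf T_def)
    finally show ?thesis .
  qed
  have 2: "T = bind_pmf (bernoulli_pmf p) (\<lambda>b. if b then bind_pmf (bernoulli_pmf \<alpha>) (\<lambda>b. if b then return_pmf 0 else T) else map_pmf Suc T)"
  proof -
    have "T = bind_pmf (geometric_pmf \<alpha>) (\<lambda>k. bind_pmf (bernoulli_pmf p) (\<lambda>b. if b then neg_binomial_pmf k p else map_pmf Suc (neg_binomial_pmf (Suc k) p)))"
      unfolding T_def by (subst neg_binomial_pmf_unfold[OF p_in]) simp
    also have "\<dots> = bind_pmf (bernoulli_pmf p) (\<lambda>b. bind_pmf (geometric_pmf \<alpha>) (\<lambda>k. if b then neg_binomial_pmf k p else map_pmf Suc (neg_binomial_pmf (Suc k) p)))"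
      by (rule bind_commute_pmf)
    also have "\<dots> = bind_pmf (bernoulli_pmf p) (\<lambda>b. if b then bind_pmf (bernoulli_pmf \<alpha>) (\<lambda>b. if b then return_pmf 0 else T) else map_pmf Suc T)"
    proof (intro bind_pmf_cong refl)
      fix b
      show "bind_pmf (geometric_pmf \<alpha>) (\<lambda>k. if b then neg_binomial_pmf k p else map_pmf Suc (neg_binomial_pmf (Suc k) p)) =
        (if b then bind_pmf (bernoulli_pmf \<alpha>) (\<lambda>b. if b then return_pmf 0 else T) else map_pmf Suc T)"
        unfolding 1[symmetric] by (cases b) (simp_all add: T_def map_bind_pmf)
    qed
    finally show ?thesis .
  qed
  have rec: "pmf T d = p * (\<alpha> * indicator {0} d + (1 - \<alpha>) * pmf T d) + (1 - p) * pmf (map_pmf Suc T) d" for d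
  proof -
    have pb: "pmf (bind_pmf (bernoulli_pmf q) F) d = q * pmf (F True) d + (1 - q) * pmf (F False) d"
      if "0 \<le> q" "q \<le> 1" for q and F :: "bool \<Rightarrow> nat pmf"
      using that by (simp add: pmf_bind)
    have "pmf T d = pmf (bind_pmf (bernoulli_pmf p) (\<lambda>b. if b then bind_pmf (bernoulli_pmf \<alpha>) (\<lambda>b. if b then return_pmf 0 else T) else map_pmf Suc T)) d"
      using 2 by (rule arg_cong)
    also have "\<dots> = p * (\<alpha> * indicator {0} d + (1 - \<alpha>) * pmf T d) + (1 - p) * pmf (map_pmf Suc T) d"
      using p \<alpha> by (simp add: pb less_imp_le indicator_def)
    finally show ?thesis .
  qed
  have pS: "pmf (map_pmf Suc T) (Suc d) = pmf T d" for d
    by (rule pmf_map_inj') simp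
  have p0: "pmf (map_pmf Suc T) 0 = 0" by (simp add: pmf_eq_0_set_pmf)
  have ob: "(1 - p + p * \<alpha>) * (1 - \<beta>) = 1 - p" using den by (simp add: \<beta>_def field_simps)
  have z: "pmf T 0 = \<beta>" using rec[of 0] den by (simp add: p0 \<beta>_def field_simps)
  have s: "pmf T (Suc d) = (1 - \<beta>) * pmf T d" for d
  proof -
    have "(1 - p + p * \<alpha>) * pmf T (Suc d) = (1 - p) * pmf T d"
      using rec[of "Suc d"] by (simp add: pS algebra_simps)
    also have "\<dots> = (1 - p + p * \<alpha>) * ((1 - \<beta>) * pmf T d)" by (simp only: mult.assoc[symmetric] ob)
    finally show ?thesis using den by simp
  qed
  have "pmf T d = (1 - \<beta>) ^ d * \<beta>" for d
    by (induction d) (simp_all add: z s)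
  then have "T = geometric_pmf \<beta>" using \<beta> by (intro pmf_eqI) simp
  then show ?thesis by (simp add: T_def \<beta>_def)
qed

end

text \<open>
  For the count \<open>u\<close> at an edge of resistance \<open>r\<close>, with total resistance \<open>c\<close> of the edges of the block to its left
  and \<open>W\<close> the scale of the block: a martingale part minus the discrete logarithm of \<open>r * u / W\<close>.
\<close>

definition Psi :: "real \<Rightarrow> real \<Rightarrow> real \<Rightarrow> nat \<Rightarrow> real" where
  "Psi W c r u = (r * u + c) / W + ln W - harm (u - 1) - ln r"

text \<open>
  The linear part is what makes this true: \<open>ln y \<le> y - 1\<close> for \<open>y = r * u / W\<close>, and \<open>harm\<close> exceeds the
  logarithm by at most \<open>1\<close>.
\<close>

lemma Psi_nonneg:
  assumes "W > 0" "c \<ge> 0" "r > 0" "u > 0"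
  shows "0 \<le> Psi W c r u"
proof -
  have "harm (u - 1) \<le> 1 + ln (real u)" using harm_le_ln[of "u - 1"] assms by simp
  moreover have "ln (r * u / W) \<le> r * u / W - 1" using assms by (intro ln_le_minus_one) simp
  moreover have "ln (r * u / W) = ln r + ln u - ln W" using assms by (simp add: ln_mult ln_div)
  moreover have "(r * u + c) / W \<ge> r * u / W" using assms by (intro divide_right_mono) auto
  ultimately show ?thesis by (simp add: Psi_def)
qed

lemma Psi_neg_binomial:
  assumes W: "W > 0" and c: "c \<ge> 0" and r: "r' > 0" and p: "0 < p" "p < 1"
  shows "(\<integral>\<^sup>+d. ennreal (Psi W c r' (Suc d)) \<partial>measure_pmf (neg_binomial_pmf n p)) =
    ennreal ((r' * (1 + n * (1 - p) / p) + c) / W + ln W - mean_harm p n - ln r')"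
proof -
  let ?P = "measure_pmf (neg_binomial_pmf n p)"
  have i1: "integrable ?P real" and e1: "integral\<^sup>L ?P real = n * (1 - p) / p"
    using p by (auto intro!: integrable_neg_binomial_pmf_real expectation_neg_binomial_pmf)
  have i2: "integrable ?P (harm :: nat \<Rightarrow> real)" by (rule integrable_neg_binomial_harm[OF p])
  have e: "(\<lambda>d. Psi W c r' (Suc d)) = (\<lambda>d. (r' / W) * real d + ((r' + c) / W + ln W - ln r') - harm d)"
    by (auto simp: Psi_def fun_eq_iff add_divide_distrib algebra_simps)
  have i3: "integrable ?P (\<lambda>d. (r' / W) * real d + ((r' + c) / W + ln W - ln r'))"
    using i1 by (intro Bochner_Integration.integrable_add integrable_mult_right integrable_const) auto
  have i: "integrable ?P (\<lambda>d. Psi W c r' (Suc d))"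
    unfolding e by (rule Bochner_Integration.integrable_diff[OF i3 i2])
  have "(\<integral>\<^sup>+d. ennreal (Psi W c r' (Suc d)) \<partial>?P) = ennreal (\<integral>d. Psi W c r' (Suc d) \<partial>?P)"
    using i W c r by (intro nn_integral_eq_integral) (auto intro!: Psi_nonneg)
  also have "(\<integral>d. Psi W c r' (Suc d) \<partial>?P) =
      (\<integral>d. (r' / W) * real d + ((r' + c) / W + ln W - ln r') \<partial>?P) - mean_harm p n"
    unfolding e mean_harm_def[OF p] by (rule Bochner_Integration.integral_diff[OF i3 i2])
  also have "(\<integral>d. (r' / W) * real d + ((r' + c) / W + ln W - ln r') \<partial>?P) =
      (r' / W) * (n * (1 - p) / p) + ((r' + c) / W + ln W - ln r')"
    using i1 e1 by (subst Bochner_Integration.integral_add) auto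
  also have "(r' / W) * (n * (1 - p) / p) + ((r' + c) / W + ln W - ln r') - mean_harm p n =
      (r' * (1 + n * (1 - p) / p) + c) / W + ln W - mean_harm p n - ln r'"
    by (simp add: add_divide_distrib distrib_left)
  finally show ?thesis .
qed

text \<open>
  The transition from an edge of resistance \<open>r\<close> to its left neighbour of resistance \<open>r'\<close>: the up probability at
  the common vertex is \<open>p\<close>, so the mean \<open>(1 - p) / p\<close> of a geometric variable is \<open>r / r'\<close>.  The linear part is preserved
  and the logarithmic part decreases by \<open>mean_harm_lower\<close>.
\<close>

lemma Psi_supermartingale:
  assumes W: "W > 0" and c: "r' \<le> c" and r: "r > 0" "r' > 0" and u: "u > 0"
  defines "p \<equiv> r' / (r + r')"
  shows "(\<integral>\<^sup>+d. ennreal (Psi W (c - r') r' (Suc d)) \<partial>measure_pmf (neg_binomial_pmf u p)) \<le> ennreal (Psi W c r u)"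
proof -
  have p: "0 < p" "p < 1" using r by (auto simp: p_def field_simps)
  have "1 - p = r / (r + r')" using r by (simp add: p_def field_simps)
  then have q: "(1 - p) / p = r / r'" using r by (simp only: p_def) simp
  have "harm (u - 1) + ln (r / r') \<le> mean_harm p u" using mean_harm_lower[OF p, of "u - 1"] u q by simp
  moreover have "ln (r / r') = ln r - ln r'" using r by (simp add: ln_div)
  moreover have "r' * (1 + u * (1 - p) / p) + (c - r') = r * u + c"
  proof -
    have "r' * (1 + u * (1 - p) / p) = r' + u * (r' * ((1 - p) / p))" by (simp add: distrib_left)
    also have "r' * ((1 - p) / p) = r" unfolding q using r by simp
    finally show ?thesis by (simp add: mult.commute)
  qed
  ultimately have "(r' * (1 + u * (1 - p) / p) + (c - r')) / W + ln W - mean_harm p u - ln r' \<le> Psi W c r u"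
    by (simp only: Psi_def)
  then show ?thesis
    using W c r p by (subst Psi_neg_binomial) (auto intro!: ennreal_leI)
qed

lemma Psi_geometric:
  assumes W: "W > 0" and c: "0 \<le> c" and r: "r > 0" and \<alpha>: "0 < \<alpha>" "\<alpha> \<le> 1"
  shows "(\<integral>\<^sup>+d. ennreal (Psi W c r (Suc d)) \<partial>measure_pmf (geometric_pmf \<alpha>)) = ennreal ((r / \<alpha> + c) / W + ln W - ln (r / \<alpha>))"
proof (cases "\<alpha> = 1")
  case True
  then show ?thesis by (simp add: Psi_def harm_expand)
next
  case False
  then have a: "0 < \<alpha>" "\<alpha> < 1" using \<alpha> by auto
  have "r * (1 + real (Suc 0) * (1 - \<alpha>) / \<alpha>) = r / \<alpha>" using a by (simp add: field_simps)
  then show ?thesis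
    using Psi_neg_binomial[OF W c r a, of "Suc 0"] mean_harm_1[OF a] a r by (simp add: ln_div algebra_simps)
qed

section \<open>The walk driven by independent instruction stacks\<close>

text \<open>
  The coordinate \<open>prod_encode (x, c)\<close> is the target of the jump made at the visit number \<open>c\<close> (counted from \<open>0\<close>) to \<open>x\<close>.
\<close>

definition stack_measure :: "(nat \<Rightarrow> nat pmf) \<Rightarrow> (nat \<Rightarrow> nat) measure" where
  "stack_measure K = (\<Pi>\<^sub>M n\<in>UNIV. measure_pmf (K (fst (prod_decode n))))"

definition instr :: "(nat \<Rightarrow> nat) \<Rightarrow> nat \<Rightarrow> nat \<Rightarrow> nat" where
  "instr \<omega> x c = \<omega> (prod_encode (x, c))"

text \<open>
  One implication suffices because agreement on \<open>A\<close> is symmetric.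
\<close>

definition determined_by :: "nat set \<Rightarrow> (nat \<Rightarrow> nat) set \<Rightarrow> bool" where
  "determined_by A E \<longleftrightarrow> (\<forall>\<omega> \<omega>'. (\<forall>n\<in>A. \<omega> n = \<omega>' n) \<longrightarrow> \<omega> \<in> E \<longrightarrow> \<omega>' \<in> E)"

lemma determined_byD:
  "determined_by A E \<Longrightarrow> (\<And>n. n \<in> A \<Longrightarrow> \<omega> n = \<omega>' n) \<Longrightarrow> \<omega> \<in> E \<longleftrightarrow> \<omega>' \<in> E"
  unfolding determined_by_def by metis

interpretation stack: product_prob_space "\<lambda>n. measure_pmf (K (fst (prod_decode n)))" UNIV for K
  by unfold_locales

lemma prob_space_stack: "prob_space (stack_measure K)"
  unfolding stack_measure_def by (rule stack.P.prob_space_axioms)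

lemma space_stack [simp]: "space (stack_measure K) = UNIV"
  by (simp add: stack_measure_def space_PiM PiE_UNIV_domain)

lemma coordinate_measurable [measurable]: "(\<lambda>\<omega>. \<omega> n) \<in> measurable (stack_measure K) (count_space UNIV)"
proof -
  have "(\<lambda>\<omega>. \<omega> n) \<in> measurable (stack_measure K) (measure_pmf (K (fst (prod_decode n))))"
    unfolding stack_measure_def by (rule measurable_component_singleton) simp
  then show ?thesis by simp
qed

lemma instr_measurable [measurable]: "(\<lambda>\<omega>. instr \<omega> x c) \<in> measurable (stack_measure K) (count_space UNIV)"
  unfolding instr_def by measurable

lemma emeasure_coordinate:
  "emeasure (stack_measure K) {\<omega>. \<omega> n = y} = ennreal (pmf (K (fst (prod_decode n))) y)"
proof -
  have "emeasure (measure_pmf (K (fst (prod_decode n)))) {y} =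
     emeasure (distr (stack_measure K) (measure_pmf (K (fst (prod_decode n)))) (\<lambda>\<omega>. \<omega> n)) {y}"
    unfolding stack_measure_def by (subst stack.PiM_component) auto
  also have "\<dots> = emeasure (stack_measure K) ((\<lambda>\<omega>. \<omega> n) -` {y} \<inter> space (stack_measure K))"
    by (rule emeasure_distr) (auto simp: coordinate_measurable measurable_cong_sets[OF refl sets_measure_pmf_count_space])
  also have "(\<lambda>\<omega>. \<omega> n) -` {y} \<inter> space (stack_measure K) = {\<omega>. \<omega> n = y}" by auto
  finally show ?thesis by (simp add: emeasure_pmf_single)
qed

lemma emeasure_instr:
  "emeasure (stack_measure K) {\<omega>. instr \<omega> x c = y} = ennreal (pmf (K x) y)"
  unfolding instr_def emeasure_coordinate by simp

lemma stack_indep_coordinates: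
  "prob_space.indep_vars (stack_measure K) (\<lambda>n. measure_pmf (K (fst (prod_decode n)))) (\<lambda>n \<omega>. \<omega> n) UNIV"
proof -
  interpret prob_space "stack_measure K" by (rule prob_space_stack)
  show ?thesis
  proof (subst indep_vars_iff_distr_eq_PiM)
    show "random_variable (measure_pmf (K (fst (prod_decode i)))) (\<lambda>\<omega>. \<omega> i)" for i
      unfolding stack_measure_def by (rule measurable_component_singleton) simp
    have "distr (stack_measure K) (measure_pmf (K (fst (prod_decode i)))) (\<lambda>\<omega>. \<omega> i) = measure_pmf (K (fst (prod_decode i)))" for i
      unfolding stack_measure_def by (rule stack.PiM_component) simp
    then show "distr (stack_measure K) (\<Pi>\<^sub>M i\<in>UNIV. measure_pmf (K (fst (prod_decode i)))) (\<lambda>x. \<lambda>i\<in>UNIV. x i) =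
      (\<Pi>\<^sub>M i\<in>UNIV. distr (stack_measure K) (measure_pmf (K (fst (prod_decode i)))) (\<lambda>\<omega>. \<omega> i))"
      by (simp add: stack_measure_def[symmetric] restrict_UNIV distr_id2)
  qed simp
qed

text \<open>
  Events depending on disjoint sets of instructions are independent: extending a partial configuration by \<open>0\<close>
  writes such an event as a preimage under the restriction to its coordinates.
\<close>

lemma stack_indep:
  assumes E: "E \<in> sets (stack_measure K)" "determined_by A E"
    and F: "F \<in> sets (stack_measure K)" "determined_by B F"
    and AB: "A \<inter> B = {}"
  shows "emeasure (stack_measure K) (E \<inter> F) = emeasure (stack_measure K) E * emeasure (stack_measure K) F"
proof -
  interpret prob_space "stack_measure K" by (rule prob_space_stack)
  define N where "N n = measure_pmf (K (fst (prod_decode n)))" for n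
  define ext where "ext C \<eta> = (\<lambda>n. if n \<in> C then \<eta> n else (0::nat))" for C :: "nat set" and \<eta> :: "nat \<Rightarrow> nat"
  have extm: "ext C \<in> measurable (PiM C N) (stack_measure K)" for C
    unfolding stack_measure_def N_def[symmetric]
  proof (rule measurable_PiM_single')
    show "(\<lambda>\<eta>. ext C \<eta> i) \<in> measurable (PiM C N) (N i)" for i
    proof (cases "i \<in> C")
      case True
      then have "(\<lambda>\<eta>. \<eta> i) \<in> measurable (PiM C N) (N i)" by (rule measurable_component_singleton)
      then show ?thesis using True by (simp add: ext_def)
    next
      case False then show ?thesis by (simp add: ext_def N_def)
    qed
  qed (auto simp: N_def PiE_UNIV_domain)
  define R where "R G C = ext C -` G \<inter> space (PiM C N)" for G C
  have Rs: "R G C \<in> sets (PiM C N)" if "G \<in> sets (stack_measure K)" for G C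
    unfolding R_def by (rule measurable_sets[OF extm that])
  have pre: "(\<lambda>\<omega>. restrict (\<lambda>i. \<omega> i) C) -` R G C = G" if "determined_by C G" for G C
  proof (intro set_eqI)
    fix \<omega>
    have "ext C (restrict \<omega> C) \<in> G \<longleftrightarrow> \<omega> \<in> G"
      by (rule determined_byD[OF that]) (simp add: ext_def)
    moreover have "restrict \<omega> C \<in> space (PiM C N)" by (simp add: space_PiM N_def)
    ultimately show "\<omega> \<in> (\<lambda>\<omega>. restrict (\<lambda>i. \<omega> i) C) -` R G C \<longleftrightarrow> \<omega> \<in> G"
      by (simp add: R_def)
  qed
  have ind: "indep_var (PiM A N) (\<lambda>\<omega>. restrict (\<lambda>i. \<omega> i) A) (PiM B N) (\<lambda>\<omega>. restrict (\<lambda>i. \<omega> i) B)"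
    unfolding N_def[abs_def] by (rule indep_var_restrict[OF stack_indep_coordinates AB]) auto
  have "(\<lambda>\<omega>. (restrict (\<lambda>i. \<omega> i) A, restrict (\<lambda>i. \<omega> i) B)) -` (R E A \<times> R F B) \<inter> space (stack_measure K) = E \<inter> F"
    using pre[OF E(2)] pre[OF F(2)] by auto
  then have "prob (E \<inter> F) = prob E * prob F"
    using indep_varD[OF ind Rs[OF E(1)] Rs[OF F(1)]] pre[OF E(2)] pre[OF F(2)] by simp
  then show ?thesis by (simp add: emeasure_eq_measure ennreal_mult)
qed

text \<open>
  The history is kept with the latest state first; the number of earlier visits to the present state selects the
  instruction to be used.  Keeping the whole history in a list makes the state space countable.
\<close>

primrec past :: "nat \<Rightarrow> nat \<Rightarrow> (nat \<Rightarrow> nat) \<Rightarrow> nat list" where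
  "past x0 0 \<omega> = [x0]"
| "past x0 (Suc n) \<omega> = instr \<omega> (hd (past x0 n \<omega>)) (count_list (tl (past x0 n \<omega>)) (hd (past x0 n \<omega>))) # past x0 n \<omega>"

definition walk :: "nat \<Rightarrow> nat \<Rightarrow> (nat \<Rightarrow> nat) \<Rightarrow> nat" where
  "walk x0 n \<omega> = hd (past x0 n \<omega>)"

lemma past_eq: "past x0 n \<omega> = rev (map (\<lambda>k. walk x0 k \<omega>) [0..<Suc n])"
proof (induction n)
  case 0 show ?case by (simp add: walk_def)
next
  case (Suc n)
  have "past x0 (Suc n) \<omega> = walk x0 (Suc n) \<omega> # past x0 n \<omega>" by (simp add: walk_def)
  also have "\<dots> = walk x0 (Suc n) \<omega> # rev (map (\<lambda>k. walk x0 k \<omega>) [0..<Suc n])" by (simp only: Suc)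
  also have "\<dots> = rev (map (\<lambda>k. walk x0 k \<omega>) [0..<Suc (Suc n)])" by simp
  finally show ?case .
qed

lemma past_nonempty: "past x0 n \<omega> \<noteq> []" by (cases n) simp_all

lemma past_measurable [measurable]: "past x0 n \<in> measurable (stack_measure K) (count_space UNIV)"
proof (induction n)
  case 0 show ?case by simp
next
  case (Suc n)
  have "(\<lambda>\<omega>. (\<lambda>l \<omega>. instr \<omega> (hd l) (count_list (tl l) (hd l)) # l) (past x0 n \<omega>) \<omega>) \<in> measurable (stack_measure K) (count_space UNIV)"
  proof (rule measurable_compose_countable[OF _ Suc])
    fix l :: "nat list"
    show "(\<lambda>\<omega>. instr \<omega> (hd l) (count_list (tl l) (hd l)) # l) \<in> measurable (stack_measure K) (count_space UNIV)"
      by (rule measurable_compose[OF instr_measurable[of "hd l" "count_list (tl l) (hd l)"]]) simp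
  qed
  then show ?case by simp
qed

lemma walk_measurable [measurable]: "walk x0 n \<in> measurable (stack_measure K) (count_space UNIV)"
  unfolding walk_def by (rule measurable_compose[OF past_measurable]) simp

text \<open>
  The present state, at the head of the list, has not consumed its instruction yet.
\<close>

definition used :: "nat list \<Rightarrow> nat set" where
  "used l = {prod_encode (x, c) | x c. c < count_list (tl l) x}"

lemma past_determined: "determined_by (used l) {\<omega>. past x0 n \<omega> = l}"
proof (induction n arbitrary: l)
  case 0 then show ?case by (simp add: determined_by_def)
next
  case (Suc n)
  show ?case unfolding determined_by_def
  proof (intro allI impI)
    fix \<omega> \<omega>' assume ag: "\<forall>n\<in>used l. \<omega> n = \<omega>' n" and "\<omega> \<in> {\<omega>. past x0 (Suc n) \<omega> = l}"
    then have w: "past x0 (Suc n) \<omega> = l" by simp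
    define l' where "l' = past x0 n \<omega>"
    have l: "l = instr \<omega> (hd l') (count_list (tl l') (hd l')) # l'" using w by (simp add: l'_def)
    obtain h t where ht: "l' = h # t" using past_nonempty[of x0 n \<omega>] by (cases l') (auto simp: l'_def)
    have "count_list (tl l') x \<le> count_list (tl l) x" for x unfolding l ht by simp
    then have sub: "used l' \<subseteq> used l" unfolding used_def using less_le_trans by blast
    have "past x0 n \<omega>' = l'"
    proof -
      have "\<omega>' \<in> {\<omega>. past x0 n \<omega> = l'}"
        by (subst determined_byD[OF Suc.IH[of l'], of _ \<omega>]) (use ag sub in \<open>auto simp: l'_def\<close>)
      then show ?thesis by simp
    qed
    moreover have "instr \<omega>' h (count_list t h) = instr \<omega> h (count_list t h)"
    proof -
      have "prod_encode (h, count_list t h) \<in> used l" unfolding used_def l ht by auto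
      then show ?thesis using ag by (simp add: instr_def)
    qed
    ultimately show "\<omega>' \<in> {\<omega>. past x0 (Suc n) \<omega> = l}" using l ht by simp
  qed
qed

text \<open>
  The next instruction has not been looked at before, hence it is independent of the history.
\<close>

lemma past_step:
  "emeasure (stack_measure K) {\<omega>. past x0 n \<omega> = l \<and> walk x0 (Suc n) \<omega> = y} =
   emeasure (stack_measure K) {\<omega>. past x0 n \<omega> = l} * ennreal (pmf (K (hd l)) y)"
proof -
  define j where "j = prod_encode (hd l, count_list (tl l) (hd l))"
  have eq: "{\<omega>. past x0 n \<omega> = l \<and> walk x0 (Suc n) \<omega> = y} = {\<omega>. past x0 n \<omega> = l} \<inter> {\<omega>. instr \<omega> (hd l) (count_list (tl l) (hd l)) = y}"
    by (auto simp: walk_def)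
  have "emeasure (stack_measure K) ({\<omega>. past x0 n \<omega> = l} \<inter> {\<omega>. instr \<omega> (hd l) (count_list (tl l) (hd l)) = y}) = emeasure (stack_measure K) {\<omega>. past x0 n \<omega> = l} * emeasure (stack_measure K) {\<omega>. instr \<omega> (hd l) (count_list (tl l) (hd l)) = y}"
  proof (rule stack_indep[OF _ past_determined])
    show "{\<omega>. past x0 n \<omega> = l} \<in> sets (stack_measure K)"
      using measurable_sets[OF past_measurable[of x0 n K], of "{l}"] by (simp add: vimage_def)
    show "{\<omega>. instr \<omega> (hd l) (count_list (tl l) (hd l)) = y} \<in> sets (stack_measure K)"
      using measurable_sets[OF instr_measurable[of "hd l" "count_list (tl l) (hd l)" K], of "{y}"] by (simp add: vimage_def)
    show "determined_by {j} {\<omega>. instr \<omega> (hd l) (count_list (tl l) (hd l)) = y}"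
      by (simp add: determined_by_def j_def instr_def)
    show "used l \<inter> {j} = {}" by (auto simp: used_def j_def)
  qed
  then show ?thesis by (simp only: eq emeasure_instr)
qed

lemma stack_markov_chain: "markov_chain (stack_measure K) K x0 (walk x0)"
proof -
  interpret prob_space "stack_measure K" by (rule prob_space_stack)
  show ?thesis
  proof unfold_locales
    show "AE \<omega> in stack_measure K. walk x0 0 \<omega> = x0" by (simp add: walk_def)
  next
    fix n w y
    assume pos: "0 < \<P>(\<omega> in stack_measure K. \<forall>k\<le>n. walk x0 k \<omega> = w k)"
    define l where "l = rev (map w [0..<Suc n])"
    have iff: "past x0 n \<omega> = l \<longleftrightarrow> (\<forall>k\<le>n. walk x0 k \<omega> = w k)" for \<omega>
    proof -
      have "past x0 n \<omega> = l \<longleftrightarrow> (\<forall>k\<in>set [0..<Suc n]. walk x0 k \<omega> = w k)"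
        by (simp only: past_eq l_def rev_is_rev_conv map_eq_conv)
      also have "set [0..<Suc n] = {..n}" by (simp only: set_upt) auto
      finally show ?thesis by (simp only: Ball_def atMost_iff)
    qed
    have hl: "hd l = w n" by (simp only: l_def upt_Suc) simp
    define P where "P = \<P>(\<omega> in stack_measure K. \<forall>k\<le>n. walk x0 k \<omega> = w k)"
    have "\<P>(\<omega> in stack_measure K. walk x0 (Suc n) \<omega> = y \<and> (\<forall>k\<le>n. walk x0 k \<omega> = w k)) = P * pmf (K (w n)) y"
    proof -
      have "emeasure (stack_measure K) {\<omega>. (\<forall>k\<le>n. walk x0 k \<omega> = w k) \<and> walk x0 (Suc n) \<omega> = y} =
        emeasure (stack_measure K) {\<omega>. \<forall>k\<le>n. walk x0 k \<omega> = w k} * ennreal (pmf (K (w n)) y)"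
        using past_step[of K x0 n l y] by (simp only: iff hl)
      then have "measure (stack_measure K) {\<omega>. (\<forall>k\<le>n. walk x0 k \<omega> = w k) \<and> walk x0 (Suc n) \<omega> = y} =
        measure (stack_measure K) {\<omega>. \<forall>k\<le>n. walk x0 k \<omega> = w k} * pmf (K (w n)) y"
        unfolding measure_def by (simp only: enn2real_mult enn2real_ennreal pmf_nonneg)
      moreover have "{\<omega>. (\<forall>k\<le>n. walk x0 k \<omega> = w k) \<and> walk x0 (Suc n) \<omega> = y} = {\<omega>. walk x0 (Suc n) \<omega> = y \<and> (\<forall>k\<le>n. walk x0 k \<omega> = w k)}" by blast
      ultimately show ?thesis by (simp only: P_def space_stack UNIV_I simp_thms)
    qed
    moreover have "P \<noteq> 0" using pos unfolding P_def[symmetric] by (rule less_imp_neq[symmetric])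
    ultimately show "\<P>(\<omega> in stack_measure K. walk x0 (Suc n) \<omega> = y \<bar> \<forall>k\<le>n. walk x0 k \<omega> = w k) = pmf (K (w n)) y"
      unfolding cond_prob_def P_def[symmetric] by simp
  qed (rule walk_measurable)
qed

section \<open>Down instructions before the \<open>u\<close>-th up instruction\<close>

lemma emeasure_points:
  fixes P :: "(nat \<Rightarrow> nat pmf) \<Rightarrow> nat"
  assumes "finite C"
  shows "emeasure (stack_measure K) {\<omega>. \<forall>n\<in>C. \<omega> n = w n} = (\<Prod>n\<in>C. ennreal (pmf (K (fst (prod_decode n))) (w n)))"
proof -
  have st: "product_prob_space (\<lambda>n. measure_pmf (K (fst (prod_decode n))))" by unfold_locales
  have eq: "{\<omega>. \<forall>n\<in>C. \<omega> n = w n} = prod_emb UNIV (\<lambda>n. measure_pmf (K (fst (prod_decode n)))) C (Pi\<^sub>E C (\<lambda>n. {w n}))"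
    by (auto simp: prod_emb_def PiE_iff extensional_def restrict_def)
  have "emeasure (stack_measure K) (prod_emb UNIV (\<lambda>n. measure_pmf (K (fst (prod_decode n)))) C (Pi\<^sub>E C (\<lambda>n. {w n}))) = (\<Prod>n\<in>C. emeasure (measure_pmf (K (fst (prod_decode n)))) {w n})"
    unfolding stack_measure_def by (rule product_prob_space.emeasure_PiM_emb[OF st]) (use assms in auto)
  then show ?thesis unfolding eq by (simp add: emeasure_pmf_single)
qed

text \<open>
  The coordinates of all stacks at sites in \<open>S\<close>.
\<close>

definition site :: "nat set \<Rightarrow> nat set" where
  "site S = {prod_encode (x, c) | x c. x \<in> S}"

lemma encode_in_site [simp]: "prod_encode (x, c) \<in> site S \<longleftrightarrow> x \<in> S"
  by (auto simp: site_def)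

lemma site_disjoint: "S \<inter> T = {} \<Longrightarrow> site S \<inter> site T = {}"
  by (auto simp: site_def)

lemma site_mono: "S \<subseteq> T \<Longrightarrow> site S \<subseteq> site T" by (auto simp: site_def)

fun ups :: "nat \<Rightarrow> nat \<Rightarrow> (nat \<Rightarrow> nat) \<Rightarrow> nat" where
  "ups i 0 \<omega> = 0"
| "ups i (Suc n) \<omega> = ups i n \<omega> + (if instr \<omega> i n = Suc i then 1 else 0)"

lemma ups_cong: "(\<And>c. c < n \<Longrightarrow> instr \<omega> i c = instr \<omega>' i c) \<Longrightarrow> ups i n \<omega> = ups i n \<omega>'"
  by (induction n) simp_all

lemma ups_mono: "m \<le> n \<Longrightarrow> ups i m \<omega> \<le> ups i n \<omega>"
  by (induction n) (auto simp: le_Suc_eq)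

lemma ups_measurable [measurable]: "ups i n \<in> measurable (stack_measure K) (count_space UNIV)"
proof (induction n)
  case 0 show ?case by simp
next
  case (Suc n)
  note [measurable] = Suc
  show ?case by simp
qed

text \<open>
  The least \<open>n\<close> is the length of the stack prefix that ends with the \<open>u\<close>-th up instruction.  If there are fewer than
  \<open>u\<close> up instructions, which has probability \<open>0\<close>, the value is unspecified.
\<close>

definition downs_before :: "nat \<Rightarrow> nat \<Rightarrow> (nat \<Rightarrow> nat) \<Rightarrow> nat" where
  "downs_before i u \<omega> = (LEAST n. ups i n \<omega> = u) - u"

lemma downs_before_eq:
  assumes "ups i (d + u) \<omega> = u" and "d + u > 0 \<Longrightarrow> instr \<omega> i (d + u - 1) = Suc i"
  shows "downs_before i u \<omega> = d"
proof -
  have "(LEAST n. ups i n \<omega> = u) = d + u"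
  proof (rule Least_equality)
    fix n assume n: "ups i n \<omega> = u"
    show "d + u \<le> n"
    proof (rule ccontr)
      assume "\<not> d + u \<le> n"
      then obtain m where m: "d + u = Suc m" "n \<le> m" by (cases "d + u") auto
      then have "ups i (Suc m) \<omega> = Suc (ups i m \<omega>)" using assms(2) by simp
      then show False using ups_mono[OF m(2), of i \<omega>] n m assms(1) by simp
    qed
  qed (fact assms(1))
  then show ?thesis by (simp add: downs_before_def)
qed

lemma downs_before_measurable [measurable]: "downs_before i u \<in> measurable (stack_measure K) (count_space UNIV)"
  unfolding downs_before_def by measurable

lemma downs_before_determined: "determined_by (site {i}) {\<omega>. downs_before i u \<omega> = d}"
proof -
  have "downs_before i u \<omega> = downs_before i u \<omega>'" if "\<forall>n\<in>site {i}. \<omega> n = \<omega>' n" for \<omega> \<omega>'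
  proof -
    have "ups i n \<omega> = ups i n \<omega>'" for n
      using that by (intro ups_cong) (simp add: instr_def)
    then show ?thesis by (simp add: downs_before_def)
  qed
  then show ?thesis unfolding determined_by_def by auto
qed

lemma emeasure_ups_instr:
  "emeasure (stack_measure K) {\<omega>. ups i n \<omega> = k \<and> instr \<omega> i n = y} =
   emeasure (stack_measure K) {\<omega>. ups i n \<omega> = k} * ennreal (pmf (K i) y)"
proof -
  have eq: "{\<omega>. ups i n \<omega> = k \<and> instr \<omega> i n = y} = {\<omega>. ups i n \<omega> = k} \<inter> {\<omega>. instr \<omega> i n = y}" by auto
  have "emeasure (stack_measure K) ({\<omega>. ups i n \<omega> = k} \<inter> {\<omega>. instr \<omega> i n = y}) = emeasure (stack_measure K) {\<omega>. ups i n \<omega> = k} * emeasure (stack_measure K) {\<omega>. instr \<omega> i n = y}"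
  proof (rule stack_indep)
    show "{\<omega>. ups i n \<omega> = k} \<in> sets (stack_measure K)"
      using measurable_sets[OF ups_measurable[of i n K], of "{k}"] by (simp add: vimage_def)
    show "{\<omega>. instr \<omega> i n = y} \<in> sets (stack_measure K)"
      using measurable_sets[OF instr_measurable[of i n K], of "{y}"] by (simp add: vimage_def)
    show "determined_by {prod_encode (i, c) | c. c < n} {\<omega>. ups i n \<omega> = k}"
      unfolding determined_by_def
    proof (intro allI impI)
      fix \<omega> \<omega>' assume a: "\<forall>n\<in>{prod_encode (i, c) |c. c < n}. \<omega> n = \<omega>' n" and "\<omega> \<in> {\<omega>. ups i n \<omega> = k}"
      moreover have "ups i n \<omega> = ups i n \<omega>'"
      proof (rule ups_cong)
        fix c assume "c < n"
        then have "prod_encode (i, c) \<in> {prod_encode (i, c) |c. c < n}" by blast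
        with a show "instr \<omega> i c = instr \<omega>' i c" unfolding instr_def by (rule bspec)
      qed
      ultimately show "\<omega>' \<in> {\<omega>. ups i n \<omega> = k}" by (simp only: mem_Collect_eq)
    qed
    show "determined_by {prod_encode (i, n)} {\<omega>. instr \<omega> i n = y}"
      by (simp add: determined_by_def instr_def)
    show "{prod_encode (i, c) |c. c < n} \<inter> {prod_encode (i, n)} = {}"
      by (auto simp: prod_encode_eq)
  qed
  then show ?thesis by (simp only: eq emeasure_instr)
qed

lemma emeasure_ups_not_up:
  "emeasure (stack_measure K) {\<omega>. ups i n \<omega> = k \<and> instr \<omega> i n \<noteq> y} =
   emeasure (stack_measure K) {\<omega>. ups i n \<omega> = k} * ennreal (1 - pmf (K i) y)"
proof -
  interpret prob_space "stack_measure K" by (rule prob_space_stack)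
  have s: "{\<omega>. ups i n \<omega> = k} \<in> sets (stack_measure K)"
    using measurable_sets[OF ups_measurable[of i n K], of "{k}"] by (simp add: vimage_def)
  have s2: "{\<omega>. instr \<omega> i n = y} \<in> sets (stack_measure K)"
    using measurable_sets[OF instr_measurable[of i n K], of "{y}"] by (simp add: vimage_def)
  have eq: "{\<omega>. ups i n \<omega> = k \<and> instr \<omega> i n \<noteq> y} = {\<omega>. ups i n \<omega> = k} - {\<omega>. ups i n \<omega> = k \<and> instr \<omega> i n = y}" by auto
  have "measure (stack_measure K) ({\<omega>. ups i n \<omega> = k} - {\<omega>. ups i n \<omega> = k \<and> instr \<omega> i n = y}) = measure (stack_measure K) {\<omega>. ups i n \<omega> = k} - measure (stack_measure K) {\<omega>. ups i n \<omega> = k \<and> instr \<omega> i n = y}"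
    using sets.Int[OF s s2] s by (intro finite_measure_Diff) (auto simp: Int_def)
  moreover have "measure (stack_measure K) {\<omega>. ups i n \<omega> = k \<and> instr \<omega> i n = y} = measure (stack_measure K) {\<omega>. ups i n \<omega> = k} * pmf (K i) y"
    unfolding measure_def emeasure_ups_instr by (simp only: enn2real_mult enn2real_ennreal pmf_nonneg)
  ultimately have "measure (stack_measure K) {\<omega>. ups i n \<omega> = k \<and> instr \<omega> i n \<noteq> y} = measure (stack_measure K) {\<omega>. ups i n \<omega> = k} * (1 - pmf (K i) y)"
    unfolding eq by (simp add: algebra_simps)
  then show ?thesis by (simp add: emeasure_eq_measure ennreal_mult pmf_le_1)
qed

lemma prob_ups:
  fixes K i defines "p \<equiv> pmf (K i) (Suc i)"
  shows "emeasure (stack_measure K) {\<omega>. ups i n \<omega> = k} = ennreal (real (n choose k) * p ^ k * (1 - p) ^ (n - k))"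
proof (induction n arbitrary: k)
  case 0
  interpret prob_space "stack_measure K" by (rule prob_space_stack)
  show ?case using emeasure_space_1 by (cases k) auto
next
  case (Suc n)
  have p: "0 \<le> p" "p \<le> 1" by (auto simp: p_def pmf_le_1)
  have m: "{\<omega>. ups i n \<omega> = k \<and> instr \<omega> i n \<noteq> y} \<in> sets (stack_measure K)"
    "{\<omega>. ups i n \<omega> = k \<and> instr \<omega> i n = y} \<in> sets (stack_measure K)" for k y
  proof -
    have s: "{\<omega>. ups i n \<omega> = k} \<in> sets (stack_measure K)"
      using measurable_sets[OF ups_measurable[of i n K], of "{k}"] by (simp add: vimage_def)
    have s2: "{\<omega>. instr \<omega> i n = y} \<in> sets (stack_measure K)"
      using measurable_sets[OF instr_measurable[of i n K], of "{y}"] by (simp add: vimage_def)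
    show "{\<omega>. ups i n \<omega> = k \<and> instr \<omega> i n \<noteq> y} \<in> sets (stack_measure K)"
      using sets.Diff[OF s s2] by (simp add: set_diff_eq)
    show "{\<omega>. ups i n \<omega> = k \<and> instr \<omega> i n = y} \<in> sets (stack_measure K)"
      using sets.Int[OF s s2] by (simp add: Int_def)
  qed
  show ?case
  proof (cases k)
    case 0
    have "{\<omega>. ups i (Suc n) \<omega> = k} = {\<omega>. ups i n \<omega> = 0 \<and> instr \<omega> i n \<noteq> Suc i}" using 0 by auto
    then have "emeasure (stack_measure K) {\<omega>. ups i (Suc n) \<omega> = k} = ennreal (real (n choose 0) * p ^ 0 * (1 - p) ^ (n - 0)) * ennreal (1 - p)"
      by (simp only: emeasure_ups_not_up Suc p_def)
    also have "\<dots> = ennreal (real (Suc n choose k) * p ^ k * (1 - p) ^ (Suc n - k))"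
      using p 0 by (simp add: ennreal_mult[symmetric] mult.commute)
    finally show ?thesis .
  next
    case (Suc k')
    have eq: "{\<omega>. ups i (Suc n) \<omega> = k} = {\<omega>. ups i n \<omega> = k' \<and> instr \<omega> i n = Suc i} \<union> {\<omega>. ups i n \<omega> = k \<and> instr \<omega> i n \<noteq> Suc i}"
      using Suc by auto
    have "emeasure (stack_measure K) {\<omega>. ups i (Suc n) \<omega> = k} = emeasure (stack_measure K) {\<omega>. ups i n \<omega> = k' \<and> instr \<omega> i n = Suc i} + emeasure (stack_measure K) {\<omega>. ups i n \<omega> = k \<and> instr \<omega> i n \<noteq> Suc i}"
      unfolding eq using m by (intro plus_emeasure[symmetric]) auto
    also have "\<dots> = ennreal (real (n choose k') * p ^ k' * (1 - p) ^ (n - k')) * ennreal p + ennreal (real (n choose k) * p ^ k * (1 - p) ^ (n - k)) * ennreal (1 - p)"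
      by (simp only: emeasure_ups_not_up emeasure_ups_instr Suc.IH p_def)
    also have "\<dots> = ennreal (real (n choose k') * p ^ k' * (1 - p) ^ (n - k') * p + real (n choose k) * p ^ k * (1 - p) ^ (n - k) * (1 - p))"
      using p by (simp add: ennreal_mult[symmetric] ennreal_plus[symmetric] del: ennreal_plus)
    also have "real (n choose k') * p ^ k' * (1 - p) ^ (n - k') * p + real (n choose k) * p ^ k * (1 - p) ^ (n - k) * (1 - p)
      = real (Suc n choose k) * p ^ k * (1 - p) ^ (Suc n - k)"
    proof (cases "k \<le> n")
      case True
      then have "Suc n - k = Suc (n - k)" "n - k' = Suc (n - k)" using Suc by auto
      then show ?thesis using Suc by (simp add: algebra_simps)
    next
      case False
      then have "n choose k = 0" by simp
      then show ?thesis using Suc by (simp add: algebra_simps)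
    qed
    finally show ?thesis .
  qed
qed

text \<open>
  Mass functions of total mass \<open>1\<close> cannot be ordered pointwise unless they are equal.
\<close>

lemma pmf_unique_of_le:
  fixes q :: "nat \<Rightarrow> ennreal" and P :: "nat pmf"
  assumes le: "\<And>d. ennreal (pmf P d) \<le> q d" and sum: "(\<Sum>d. q d) \<le> 1"
  shows "q d = ennreal (pmf P d)"
proof (rule antisym[OF _ le])
  have one: "(\<Sum>d. ennreal (pmf P d)) = 1" by (rule suminf_pmf)
  have "(\<Sum>e. ennreal (pmf P e) + (if e = d then q e - ennreal (pmf P e) else 0)) \<le> (\<Sum>e. q e)"
    using le by (intro suminf_le) (auto simp: add_diff_inverse_ennreal)
  also have "\<dots> \<le> 1" by (fact sum)
  also have "(\<Sum>e. ennreal (pmf P e) + (if e = d then q e - ennreal (pmf P e) else 0)) = 1 + (q d - ennreal (pmf P d))"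
    by (subst suminf_add[symmetric]) (auto simp: one suminf_single_ennreal)
  finally have "q d - ennreal (pmf P d) = 0"
    by (simp add: ennreal_add_left_cancel_le)
  then show "q d \<le> ennreal (pmf P d)" by (simp add: diff_eq_0_iff_ennreal)
qed

text \<open>
  The event that \<open>u\<close> ups are found among the first \<open>d + u\<close> instructions and the next one is up has the
  negative binomial probability and forces the value \<open>d\<close>.  This gives one inequality for every \<open>d\<close>, and equality follows because the
  total masses are \<open>1\<close> and at most \<open>1\<close>; the null event of too few ups is covered by the same argument.
\<close>

lemma law_downs_before:
  fixes K i defines "p \<equiv> pmf (K i) (Suc i)"
  assumes p: "0 < p"
  shows "emeasure (stack_measure K) {\<omega>. downs_before i (Suc u) \<omega> = d} = ennreal (pmf (neg_binomial_pmf (Suc u) p) d)"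
proof (rule pmf_unique_of_le)
  interpret prob_space "stack_measure K" by (rule prob_space_stack)
  have p01: "p \<in> {0<..1}" using p by (auto simp: p_def pmf_le_1)
  have s: "{\<omega>. downs_before i (Suc u) \<omega> = d} \<in> sets (stack_measure K)" for d
    using measurable_sets[OF downs_before_measurable[of i "Suc u" K], of "{d}"] by (simp add: vimage_def)
  show "ennreal (pmf (neg_binomial_pmf (Suc u) p) d) \<le> emeasure (stack_measure K) {\<omega>. downs_before i (Suc u) \<omega> = d}" for d
  proof -
    have "ennreal (pmf (neg_binomial_pmf (Suc u) p) d) = ennreal (real ((d + u) choose u) * p ^ u * (1 - p) ^ (d + u - u)) * ennreal p"
      using p01 binomial_symmetric[of d "d + u"] by (simp add: pmf_neg_binomial[OF p01] ennreal_mult[symmetric] mult_ac)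
    also have "\<dots> = emeasure (stack_measure K) {\<omega>. ups i (d + u) \<omega> = u \<and> instr \<omega> i (d + u) = Suc i}"
      by (simp only: emeasure_ups_instr prob_ups p_def)
    also have "\<dots> \<le> emeasure (stack_measure K) {\<omega>. downs_before i (Suc u) \<omega> = d}"
      by (rule emeasure_mono[OF _ s]) (auto intro!: downs_before_eq)
    finally show ?thesis .
  qed
  have "(\<Sum>d. emeasure (stack_measure K) {\<omega>. downs_before i (Suc u) \<omega> = d}) = emeasure (stack_measure K) (\<Union>d. {\<omega>. downs_before i (Suc u) \<omega> = d})"
    using s by (intro suminf_emeasure) (auto simp: disjoint_family_on_def)
  then show "(\<Sum>d. emeasure (stack_measure K) {\<omega>. downs_before i (Suc u) \<omega> = d}) \<le> 1"
    using emeasure_le_1 by simp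
qed

section \<open>The crossing profile from right to left\<close>

definition res_kernel :: "(nat \<Rightarrow> real) \<Rightarrow> nat \<Rightarrow> nat pmf" where
  "res_kernel r x = (if x = 0 then return_pmf 1 else
     map_pmf (\<lambda>b. if b then Suc x else x - 1) (bernoulli_pmf (r (x - 1) / (r (x - 1) + r x))))"

lemma pmf_res_kernel:
  assumes "\<And>x. r x > 0"
  shows "pmf (res_kernel r 0) y = (if y = 1 then 1 else 0)"
    and "pmf (res_kernel r (Suc x)) y =
      (if y = Suc (Suc x) then r x / (r x + r (Suc x)) else if y = x then r (Suc x) / (r x + r (Suc x)) else 0)"
proof -
  show "pmf (res_kernel r 0) y = (if y = 1 then 1 else 0)" by (simp add: res_kernel_def indicator_def)
  define p where "p = r x / (r x + r (Suc x))"
  have s: "r x + r (Suc x) > 0" using assms by (simp add: add_pos_pos)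
  have p: "0 \<le> p" "p \<le> 1" using assms[of x] assms[of "Suc x"] s by (auto simp: p_def less_imp_le)
  have q: "1 - p = r (Suc x) / (r x + r (Suc x))" using s by (simp add: p_def field_simps)
  have "pmf (res_kernel r (Suc x)) y = measure_pmf.prob (bernoulli_pmf p) ((\<lambda>b. if b then Suc (Suc x) else x) -` {y})"
    by (simp add: res_kernel_def p_def pmf_map cong: if_cong)
  also have "((\<lambda>b. if b then Suc (Suc x) else x) -` {y}) = (if y = Suc (Suc x) then {True} else if y = x then {False} else {})"
    by (auto split: if_splits)
  also have "measure_pmf.prob (bernoulli_pmf p) \<dots> = (if y = Suc (Suc x) then p else if y = x then 1 - p else 0)"
    using p by (simp add: measure_pmf_single)
  finally show "pmf (res_kernel r (Suc x)) y =
      (if y = Suc (Suc x) then r x / (r x + r (Suc x)) else if y = x then r (Suc x) / (r x + r (Suc x)) else 0)"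
    unfolding q by (simp add: p_def)
qed

lemma birth_death_res_kernel:
  assumes "\<And>x. r x > 0"
  shows "birth_death_kernel (res_kernel r)"
  unfolding birth_death_kernel_def
proof (intro conjI allI impI)
  fix x y
  show "pmf (res_kernel r x) y = 0" if "\<bar>int x - int y\<bar> > 1"
    using that by (cases x) (auto simp: pmf_res_kernel[OF assms])
  show "pmf (res_kernel r x) y > 0" if "\<bar>int x - int y\<bar> = 1"
    using that assms by (cases x) (auto simp: pmf_res_kernel[OF assms] intro!: divide_pos_pos add_pos_pos)
qed

lemma resistances_res_kernel:
  assumes "\<And>x. r x > 0"
  shows "resistances (res_kernel r) r"
  using assms by (simp add: resistances_def pmf_res_kernel[OF assms])

text \<open>
  \<open>profile b t\<close> is the candidate for the number of upcrossings of the edge \<open>{b - 1 - t, b - t}\<close> before the walk first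
  hits \<open>b\<close>, expressed by the stacks alone.  The last edge is crossed exactly once, and on every further edge to the right of the initial
  state the upcrossings exceed the downcrossings by one.
\<close>

primrec profile :: "nat \<Rightarrow> nat \<Rightarrow> (nat \<Rightarrow> nat) \<Rightarrow> nat" where
  "profile b 0 \<omega> = 1"
| "profile b (Suc t) \<omega> = Suc (downs_before (b - 1 - t) (profile b t \<omega>) \<omega>)"

lemma profile_pos: "0 < profile b t \<omega>" by (cases t) simp_all

lemma profile_measurable [measurable]: "profile b t \<in> measurable (stack_measure K) (count_space UNIV)"
proof (induction t)
  case 0 show ?case by simp
next
  case (Suc t)
  have "(\<lambda>\<omega>. (\<lambda>u \<omega>. Suc (downs_before (b - 1 - t) u \<omega>)) (profile b t \<omega>) \<omega>) \<in> measurable (stack_measure K) (count_space UNIV)"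
  proof (rule measurable_compose_countable[OF _ Suc])
    fix u
    show "(\<lambda>\<omega>. Suc (downs_before (b - 1 - t) u \<omega>)) \<in> measurable (stack_measure K) (count_space UNIV)"
      by (rule measurable_compose[OF downs_before_measurable]) simp
  qed
  then show ?case by simp
qed

lemma downs_before_cong:
  assumes "\<And>n. n \<in> site {i} \<Longrightarrow> \<omega> n = \<omega>' n"
  shows "downs_before i u \<omega> = downs_before i u \<omega>'"
proof -
  have "ups i n \<omega> = ups i n \<omega>'" for n
    by (intro ups_cong) (simp add: instr_def assms)
  then show ?thesis by (simp add: downs_before_def)
qed

lemma profile_cong:
  assumes "t \<le> b" and "\<And>n. n \<in> site {b - t..<b} \<Longrightarrow> \<omega> n = \<omega>' n"
  shows "profile b t \<omega> = profile b t \<omega>'"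
  using assms
proof (induction t)
  case (Suc t)
  have "profile b t \<omega> = profile b t \<omega>'"
  proof (rule Suc.IH)
    fix n assume "n \<in> site {b - t..<b}"
    moreover have "site {b - t..<b} \<subseteq> site {b - Suc t..<b}" by (rule site_mono) auto
    ultimately show "\<omega> n = \<omega>' n" using Suc.prems by blast
  qed (use Suc.prems in simp)
  moreover have "downs_before (b - 1 - t) u \<omega> = downs_before (b - 1 - t) u \<omega>'" for u
  proof (rule downs_before_cong)
    fix n assume "n \<in> site {b - 1 - t}"
    moreover have "site {b - 1 - t} \<subseteq> site {b - Suc t..<b}" using Suc.prems by (intro site_mono) auto
    ultimately show "\<omega> n = \<omega>' n" using Suc.prems by blast
  qed
  ultimately show ?case by simp
qed simp

text \<open>
  The stack at site \<open>b - 1 - t\<close> is independent of the stacks further to the right, which determine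
  \<open>profile b t\<close> and \<open>A\<close>.
\<close>

lemma profile_step:
  fixes K i p
  assumes t: "Suc t < b" and A: "A \<in> sets (stack_measure K)" "determined_by (site {b - t..<b}) A"
  defines "i \<equiv> b - 1 - t" defines "p \<equiv> pmf (K i) (Suc i)"
  assumes p: "0 < p"
  shows "(\<integral>\<^sup>+\<omega>. f (profile b (Suc t) \<omega>) * indicator A \<omega> \<partial>stack_measure K) =
    (\<integral>\<^sup>+\<omega>. (\<integral>\<^sup>+d. f (Suc d) \<partial>measure_pmf (neg_binomial_pmf (profile b t \<omega>) p)) * indicator A \<omega> \<partial>stack_measure K)"
proof -
  let ?S = "stack_measure K"
  have st: "emeasure ?S {\<omega>\<in>A. profile b t \<omega> = x \<and> profile b (Suc t) \<omega> = y} =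
    emeasure ?S {\<omega>\<in>A. profile b t \<omega> = x} * ennreal (pmf (map_pmf Suc (neg_binomial_pmf x p)) y)" for x y
  proof (cases x)
    case 0
    then have "{\<omega>\<in>A. profile b t \<omega> = x} = {}" "{\<omega>\<in>A. profile b t \<omega> = x \<and> profile b (Suc t) \<omega> = y} = {}"
      using profile_pos[of b t] by auto
    then show ?thesis by (simp only: emeasure_empty mult_zero_left)
  next
    case (Suc u)
    show ?thesis
    proof (cases y)
      case 0
      have "pmf (map_pmf Suc (neg_binomial_pmf x p)) 0 = 0" by (simp add: pmf_eq_0_set_pmf)
      moreover have "{\<omega>\<in>A. profile b t \<omega> = x \<and> profile b (Suc t) \<omega> = y} = {}" using 0 by auto
      ultimately show ?thesis using 0 by (simp only: emeasure_empty ennreal_0 mult_zero_right)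
    next
      case (Suc d)
      have eq: "{\<omega>\<in>A. profile b t \<omega> = x \<and> profile b (Suc t) \<omega> = y} =
        {\<omega>\<in>A. profile b t \<omega> = x} \<inter> {\<omega>. downs_before i x \<omega> = d}"
        using Suc by (auto simp: i_def)
      have s: "{\<omega>\<in>A. profile b t \<omega> = x} \<in> sets ?S"
        using sets.Int[OF A(1) measurable_sets[OF profile_measurable[of b t K], of "{x}"]]
        by (simp add: vimage_def Int_def)
      have s2: "{\<omega>. downs_before i x \<omega> = d} \<in> sets ?S"
        using measurable_sets[OF downs_before_measurable[of i x K], of "{d}"] by (simp add: vimage_def)
      have det: "determined_by (site {b - t..<b}) {\<omega>\<in>A. profile b t \<omega> = x}"
        unfolding determined_by_def
      proof (intro allI impI)
        fix \<omega> \<omega>' assume ag: "\<forall>n\<in>site {b - t..<b}. \<omega> n = \<omega>' n" and w: "\<omega> \<in> {\<omega>\<in>A. profile b t \<omega> = x}"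
        have "\<omega>' \<in> A" using A(2) ag w unfolding determined_by_def by blast
        moreover have "profile b t \<omega> = profile b t \<omega>'" using t ag by (intro profile_cong) auto
        ultimately show "\<omega>' \<in> {\<omega>\<in>A. profile b t \<omega> = x}" using w by simp
      qed
      have "emeasure ?S ({\<omega>\<in>A. profile b t \<omega> = x} \<inter> {\<omega>. downs_before i x \<omega> = d}) =
        emeasure ?S {\<omega>\<in>A. profile b t \<omega> = x} * emeasure ?S {\<omega>. downs_before i x \<omega> = d}"
        by (rule stack_indep[OF s det s2 downs_before_determined]) (rule site_disjoint, use t in \<open>auto simp: i_def\<close>)
      also have "emeasure ?S {\<omega>. downs_before i x \<omega> = d} = ennreal (pmf (neg_binomial_pmf x p) d)"
        unfolding \<open>x = Suc u\<close> p_def by (rule law_downs_before) (use p in \<open>simp add: p_def\<close>)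
      also have "pmf (neg_binomial_pmf x p) d = pmf (map_pmf Suc (neg_binomial_pmf x p)) y"
        unfolding \<open>y = Suc d\<close> by (rule pmf_map_inj'[symmetric]) simp
      finally show ?thesis unfolding eq .
    qed
  qed
  show ?thesis
    using nn_integral_one_step[OF A(1) profile_measurable profile_measurable, of b t b "Suc t" "\<lambda>u. map_pmf Suc (neg_binomial_pmf u p)" f, OF st]
    by (simp add: nn_integral_map_pmf)
qed

lemma sites_all: "determined_by (site S) UNIV" by (simp add: determined_by_def)

text \<open>
  The parameter is the probability that the walk, having crossed the edge upwards, reaches \<open>b\<close> before crossing it back.
\<close>

lemma profile_law:
  assumes r: "\<And>x. r x > 0" and t: "t < b"
  shows "(\<integral>\<^sup>+\<omega>. F (profile b t \<omega>) \<partial>stack_measure (res_kernel r)) =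
    (\<integral>\<^sup>+k. F (Suc k) \<partial>measure_pmf (geometric_pmf (r (b - 1 - t) / sum r {b - 1 - t..<b})))"
  using t
proof (induction t arbitrary: F)
  case 0
  interpret prob_space "stack_measure (res_kernel r)" by (rule prob_space_stack)
  have "{b - 1..<b} = {b - 1}" using 0 by auto
  then have "r (b - 1 - 0) / sum r {b - 1 - 0..<b} = 1" using r[of "b - 1"] by simp
  then show ?case by (simp add: emeasure_space_1[simplified])
next
  case (Suc t)
  define i where "i = b - 1 - t"
  obtain j where j: "i = Suc j" using Suc.prems by (cases i) (auto simp: i_def)
  have j': "b - 1 - Suc t = j" using j Suc.prems by (simp add: i_def)
  define R where "R = sum r {i..<b}"
  have Rp: "R > 0" unfolding R_def using Suc.prems r by (intro sum_pos) (auto simp: i_def)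
  have Ri: "R \<ge> r i" unfolding R_def using Suc.prems r by (intro member_le_sum) (auto simp: i_def less_imp_le)
  have "{j..<b} = insert j {i..<b}" using j Suc.prems by (auto simp: i_def)
  then have Rj: "sum r {j..<b} = r j + R" using j by (simp add: R_def)
  define p where "p = pmf (res_kernel r i) (Suc i)"
  have p: "p = r j / (r j + r i)" unfolding p_def j by (simp add: pmf_res_kernel[OF r])
  have p01: "0 < p" "p < 1" using r[of j] r[of i] by (auto simp: p field_simps add_pos_pos)
  have "(\<integral>\<^sup>+\<omega>. F (profile b (Suc t) \<omega>) \<partial>stack_measure (res_kernel r)) =
    (\<integral>\<^sup>+\<omega>. (\<integral>\<^sup>+d. F (Suc d) \<partial>measure_pmf (neg_binomial_pmf (profile b t \<omega>) p)) \<partial>stack_measure (res_kernel r))"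
    using profile_step[of t b UNIV "res_kernel r" F] Suc.prems p01 sites_all
    by (simp add: p_def i_def sets.top[of "stack_measure (res_kernel r)", simplified])
  also have "\<dots> = (\<integral>\<^sup>+k. (\<integral>\<^sup>+d. F (Suc d) \<partial>measure_pmf (neg_binomial_pmf (Suc k) p)) \<partial>measure_pmf (geometric_pmf (r i / R)))"
    using Suc.IH[of "\<lambda>u. \<integral>\<^sup>+d. F (Suc d) \<partial>measure_pmf (neg_binomial_pmf u p)"] Suc.prems by (simp add: i_def R_def)
  also have "\<dots> = (\<integral>\<^sup>+d. F (Suc d) \<partial>measure_pmf (bind_pmf (geometric_pmf (r i / R)) (\<lambda>k. neg_binomial_pmf (Suc k) p)))"
    by simp
  also have "bind_pmf (geometric_pmf (r i / R)) (\<lambda>k. neg_binomial_pmf (Suc k) p) = geometric_pmf (p * (r i / R) / (1 - p + p * (r i / R)))"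
    using Rp Ri r[of i] by (intro bind_geometric_neg_binomial p01) auto
  also have "p * (r i / R) / (1 - p + p * (r i / R)) = r j / (r j + R)"
  proof -
    define s where "s = r j + r i"
    have s: "s > 0" using r by (simp add: s_def add_pos_pos)
    have "1 - p = r i / s" using s by (simp add: p s_def field_simps)
    then have "1 - p + p * (r i / R) = r i / s + r j / s * (r i / R)" by (simp add: p s_def)
    also have "\<dots> = (r i / (s * R)) * (r j + R)" using s Rp by (simp add: field_simps)
    finally have "1 - p + p * (r i / R) = (r i / (s * R)) * (r j + R)" .
    moreover have "p * (r i / R) = (r i / (s * R)) * r j" by (simp add: p s_def[symmetric])
    ultimately show ?thesis using s Rp r[of i] by simp
  qed
  finally show ?case by (simp only: j' Rj)
qed

text \<open>
  Ville's inequality, in the form where the supermartingale property is only required on the event that the level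
  has not been reached yet.
\<close>

lemma (in prob_space) maximal_inequality:
  fixes Z :: "nat \<Rightarrow> 'a \<Rightarrow> ennreal"
  assumes Z[measurable]: "\<And>t. Z t \<in> borel_measurable M"
    and step: "\<And>t. t0 \<le> t \<Longrightarrow> t < t0 + n \<Longrightarrow>
      (\<integral>\<^sup>+\<omega>. Z (Suc t) \<omega> * indicator {\<omega>\<in>space M. \<forall>s\<in>{t0..t}. Z s \<omega> < \<theta>} \<omega> \<partial>M) \<le>
      (\<integral>\<^sup>+\<omega>. Z t \<omega> * indicator {\<omega>\<in>space M. \<forall>s\<in>{t0..t}. Z s \<omega> < \<theta>} \<omega> \<partial>M)"
  shows "\<theta> * emeasure M {\<omega>\<in>space M. \<exists>t\<in>{t0..t0+n}. \<theta> \<le> Z t \<omega>} \<le> (\<integral>\<^sup>+\<omega>. Z t0 \<omega> \<partial>M)"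
proof -
  define G where "G m = {\<omega>\<in>space M. \<forall>s\<in>{t0..<t0+m}. Z s \<omega> < \<theta>}" for m
  define H where "H m = {\<omega>\<in>space M. \<exists>s\<in>{t0..<t0+m}. \<theta> \<le> Z s \<omega>}" for m
  have [measurable]: "G m \<in> sets M" "H m \<in> sets M" for m unfolding G_def H_def by measurable
  have GS: "G (Suc m) = {\<omega>\<in>space M. \<forall>s\<in>{t0..t0+m}. Z s \<omega> < \<theta>}" for m
    unfolding G_def by (auto simp: less_Suc_eq_le)
  have peel: "\<theta> * emeasure M (H (Suc m)) + (\<integral>\<^sup>+\<omega>. Z (t0+m) \<omega> * indicator (G (Suc m)) \<omega> \<partial>M) \<le>
     \<theta> * emeasure M (H m) + (\<integral>\<^sup>+\<omega>. Z (t0+m) \<omega> * indicator (G m) \<omega> \<partial>M)" for m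
  proof -
    have "\<theta> * emeasure M (H (Suc m)) + (\<integral>\<^sup>+\<omega>. Z (t0+m) \<omega> * indicator (G (Suc m)) \<omega> \<partial>M) =
      (\<integral>\<^sup>+\<omega>. \<theta> * indicator (H (Suc m)) \<omega> + Z (t0+m) \<omega> * indicator (G (Suc m)) \<omega> \<partial>M)"
      by (subst nn_integral_add) (auto simp: nn_integral_cmult)
    also have "\<dots> \<le> (\<integral>\<^sup>+\<omega>. \<theta> * indicator (H m) \<omega> + Z (t0+m) \<omega> * indicator (G m) \<omega> \<partial>M)"
    proof (intro nn_integral_mono)
      fix \<omega> assume w: "\<omega> \<in> space M"
      show "\<theta> * indicator (H (Suc m)) \<omega> + Z (t0+m) \<omega> * indicator (G (Suc m)) \<omega> \<le> \<theta> * indicator (H m) \<omega> + Z (t0+m) \<omega> * indicator (G m) \<omega>"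
      proof (cases "\<omega> \<in> H m")
        case True
        then have "\<omega> \<in> H (Suc m)" "\<omega> \<notin> G m" "\<omega> \<notin> G (Suc m)" by (auto simp: H_def G_def not_less intro: bexI[rotated])
        then show ?thesis using True by simp
      next
        case False
        then have g: "\<omega> \<in> G m" using w by (auto simp: H_def G_def not_le)
        have hs: "\<omega> \<in> H (Suc m) \<longleftrightarrow> \<theta> \<le> Z (t0+m) \<omega>"
          using False w unfolding H_def by (auto simp: less_Suc_eq)
        have gs: "\<omega> \<in> G (Suc m) \<longleftrightarrow> \<not> \<theta> \<le> Z (t0+m) \<omega>"
          using g w unfolding G_def by (auto simp: less_Suc_eq not_le)
        show ?thesis using g False hs gs by (cases "\<theta> \<le> Z (t0+m) \<omega>") auto
      qed
    qed
    also have "\<dots> = \<theta> * emeasure M (H m) + (\<integral>\<^sup>+\<omega>. Z (t0+m) \<omega> * indicator (G m) \<omega> \<partial>M)"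
      by (subst nn_integral_add) (auto simp: nn_integral_cmult)
    finally show ?thesis .
  qed
  have main: "\<theta> * emeasure M (H m) + (\<integral>\<^sup>+\<omega>. Z (t0+m) \<omega> * indicator (G m) \<omega> \<partial>M) \<le> (\<integral>\<^sup>+\<omega>. Z t0 \<omega> \<partial>M)" if "m \<le> n" for m
    using that
  proof (induction m)
    case 0
    show ?case by (auto simp: H_def indicator_def intro!: nn_integral_mono)
  next
    case (Suc m)
    have "\<theta> * emeasure M (H (Suc m)) + (\<integral>\<^sup>+\<omega>. Z (t0+Suc m) \<omega> * indicator (G (Suc m)) \<omega> \<partial>M) \<le>
       \<theta> * emeasure M (H (Suc m)) + (\<integral>\<^sup>+\<omega>. Z (t0+m) \<omega> * indicator (G (Suc m)) \<omega> \<partial>M)"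
      using step[of "t0 + m"] Suc.prems unfolding GS by (intro add_left_mono) simp
    also note peel
    also have "\<theta> * emeasure M (H m) + (\<integral>\<^sup>+\<omega>. Z (t0+m) \<omega> * indicator (G m) \<omega> \<partial>M) \<le> (\<integral>\<^sup>+\<omega>. Z t0 \<omega> \<partial>M)"
      using Suc by simp
    finally show ?case .
  qed
  have "\<theta> * emeasure M (H (Suc n)) \<le> (\<integral>\<^sup>+\<omega>. Z t0 \<omega> \<partial>M)"
    using order_trans[OF peel[of n] main[of n]] by (meson le_add_same_cancel1 order_refl order_trans zero_le add_increasing2)
  moreover have "H (Suc n) = {\<omega>\<in>space M. \<exists>t\<in>{t0..t0+n}. \<theta> \<le> Z t \<omega>}"
    unfolding H_def by (auto simp: less_Suc_eq_le)
  ultimately show ?thesis by simp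
qed

text \<open>
  The maximal inequality for \<open>Psi\<close>, run leftwards from the edge \<open>a'\<close> to the edge \<open>a\<close>.  The stretch between \<open>a'\<close> and \<open>b\<close>
  provides the geometric start, at which \<open>Psi\<close> has mean \<open>1 + ln (W / R)\<close> with \<open>R\<close> its resistance; the level \<open>\<theta>\<close> is the value that \<open>Psi\<close> exceeds
  at an edge whose count is below \<open>\<beta> i\<close>.
\<close>

lemma block_bound:
  fixes r \<beta> :: "nat \<Rightarrow> real"
  assumes r: "\<And>x. r x > 0" and ab: "a < a'" "a' < b"
    and \<kappa>: "\<kappa> > 0" "\<And>i. i \<in> {a..<a'} \<Longrightarrow> \<beta> i * r i \<le> \<kappa>"
    and \<theta>: "\<theta> = ln (sum r {a..<b} / \<kappa>) - 1" "\<theta> > 0"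
  shows "emeasure (stack_measure (res_kernel r)) {\<omega>. \<exists>i\<in>{a..<a'}. real (profile b (b - 1 - i) \<omega>) < \<beta> i} \<le>
    ennreal ((1 + ln (sum r {a..<b} / sum r {a'..<b})) / \<theta>)"
proof -
  let ?S = "stack_measure (res_kernel r)"
  interpret prob_space ?S by (rule prob_space_stack)
  define W where "W = sum r {a..<b}"
  have W: "W > 0" unfolding W_def using ab r by (intro sum_pos) auto
  define c where "c i = sum r {a..<i}" for i
  define t0 where "t0 = b - 1 - a'"
  define n where "n = a' - a"
  define Z where "Z t \<omega> = ennreal (Psi W (c (b - 1 - t)) (r (b - 1 - t)) (profile b t \<omega>))" for t \<omega>
  have Zm: "Z t \<in> borel_measurable ?S" for t
    unfolding Z_def by (rule measurable_compose[OF profile_measurable]) simp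
  have "ennreal \<theta> * emeasure ?S {\<omega>\<in>space ?S. \<exists>t\<in>{t0..t0+n}. ennreal \<theta> \<le> Z t \<omega>} \<le> (\<integral>\<^sup>+\<omega>. Z t0 \<omega> \<partial>?S)"
  proof (rule maximal_inequality[OF Zm])
    fix t assume t: "t0 \<le> t" "t < t0 + n"
    define A where "A = {\<omega>\<in>space ?S. \<forall>s\<in>{t0..t}. Z s \<omega> < ennreal \<theta>}"
    define i where "i = b - 1 - t"
    obtain j where j: "i = Suc j" using t ab by (cases i) (auto simp: i_def t0_def n_def)
    have j': "b - 1 - Suc t = j" using j t by (simp add: i_def)
    have aj: "a \<le> j" using t ab j by (auto simp: i_def t0_def n_def)
    have tb: "Suc t < b" using t ab by (auto simp: t0_def n_def)
    note [measurable] = Zm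
    have As: "A \<in> sets ?S" unfolding A_def by measurable
    have Ad: "determined_by (site {b - t..<b}) A"
      unfolding determined_by_def
    proof (intro allI impI)
      fix \<omega> \<omega>' assume ag: "\<forall>n\<in>site {b - t..<b}. \<omega> n = \<omega>' n" and w: "\<omega> \<in> A"
      have "Z s \<omega> = Z s \<omega>'" if "s \<le> t" for s
      proof -
        have "site {b - s..<b} \<subseteq> site {b - t..<b}" using that by (intro site_mono) auto
        then have "profile b s \<omega> = profile b s \<omega>'" using that tb ag by (intro profile_cong) auto
        then show ?thesis by (simp add: Z_def)
      qed
      then show "\<omega>' \<in> A" using w by (auto simp: A_def)
    qed
    define p where "p = pmf (res_kernel r i) (Suc i)"
    have p: "p = r j / (r i + r j)" unfolding p_def j by (simp add: pmf_res_kernel[OF r] add.commute)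
    have pp: "0 < p" using r[of j] r[of i] by (simp add: p add_pos_pos)
    have cj: "c i = c j + r j" using aj by (simp add: c_def j)
    have c0: "0 \<le> c j" unfolding c_def using r by (intro sum_nonneg) (simp add: less_imp_le)
    have "(\<integral>\<^sup>+\<omega>. Z (Suc t) \<omega> * indicator A \<omega> \<partial>?S) =
      (\<integral>\<^sup>+\<omega>. (\<integral>\<^sup>+d. ennreal (Psi W (c j) (r j) (Suc d)) \<partial>measure_pmf (neg_binomial_pmf (profile b t \<omega>) p)) * indicator A \<omega> \<partial>?S)"
      unfolding Z_def j' p_def i_def by (rule profile_step[OF tb As Ad]) (use pp in \<open>simp add: p_def i_def\<close>)
    also have "\<dots> \<le> (\<integral>\<^sup>+\<omega>. Z t \<omega> * indicator A \<omega> \<partial>?S)"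
    proof (intro nn_integral_mono mult_right_mono)
      fix \<omega>
      have Zt: "Z t \<omega> = ennreal (Psi W (c i) (r i) (profile b t \<omega>))" by (simp only: Z_def i_def)
      have cij: "c i - r j = c j" using cj by simp
      have "(\<integral>\<^sup>+d. ennreal (Psi W (c i - r j) (r j) (Suc d)) \<partial>measure_pmf (neg_binomial_pmf (profile b t \<omega>) (r j / (r i + r j)))) \<le>
        ennreal (Psi W (c i) (r i) (profile b t \<omega>))"
        using c0 cj by (intro Psi_supermartingale W r profile_pos) simp
      then show "(\<integral>\<^sup>+d. ennreal (Psi W (c j) (r j) (Suc d)) \<partial>measure_pmf (neg_binomial_pmf (profile b t \<omega>) p)) \<le> Z t \<omega>"
        unfolding Zt p by (simp only: cij)
    qed simp
    finally show "(\<integral>\<^sup>+\<omega>. Z (Suc t) \<omega> * indicator {\<omega>\<in>space ?S. \<forall>s\<in>{t0..t}. Z s \<omega> < ennreal \<theta>} \<omega> \<partial>?S) \<le>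
      (\<integral>\<^sup>+\<omega>. Z t \<omega> * indicator {\<omega>\<in>space ?S. \<forall>s\<in>{t0..t}. Z s \<omega> < ennreal \<theta>} \<omega> \<partial>?S)"
      by (simp only: A_def)
  qed
  also have "(\<integral>\<^sup>+\<omega>. Z t0 \<omega> \<partial>?S) = ennreal (1 + ln (W / sum r {a'..<b}))"
  proof -
    have e: "b - 1 - t0 = a'" using ab by (simp add: t0_def)
    define R where "R = sum r {a'..<b}"
    have Rp: "R > 0" unfolding R_def using ab r by (intro sum_pos) auto
    have Ri: "R \<ge> r a'" unfolding R_def using ab r by (intro member_le_sum) (auto simp: less_imp_le)
    have WR: "W = c a' + R" unfolding W_def c_def R_def using ab by (intro sum.atLeastLessThan_concat[symmetric]) auto
    have c0: "0 \<le> c a'" unfolding c_def using r by (intro sum_nonneg) (simp add: less_imp_le)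
    have "(\<integral>\<^sup>+\<omega>. Z t0 \<omega> \<partial>?S) = (\<integral>\<^sup>+k. ennreal (Psi W (c a') (r a') (Suc k)) \<partial>measure_pmf (geometric_pmf (r a' / R)))"
      using profile_law[OF r, where t = t0 and b = b and F = "\<lambda>u. ennreal (Psi W (c a') (r a') u)"] ab
      unfolding e Z_def R_def by (simp only: t0_def)
    also have "\<dots> = ennreal ((r a' / (r a' / R) + c a') / W + ln W - ln (r a' / (r a' / R)))"
      using Rp Ri r[of a'] by (intro Psi_geometric W c0 r) auto
    also have "r a' / (r a' / R) = R" using r[of a'] by simp
    also have "(R + c a') / W + ln W - ln R = 1 + ln (W / R)" using W Rp WR by (simp add: ln_div add.commute)
    finally show ?thesis by (simp add: R_def)
  qed
  finally have 1: "ennreal \<theta> * emeasure ?S {\<omega>\<in>space ?S. \<exists>t\<in>{t0..t0+n}. ennreal \<theta> \<le> Z t \<omega>} \<le> ennreal (1 + ln (W / sum r {a'..<b}))" .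
  have sub: "{\<omega>. \<exists>i\<in>{a..<a'}. real (profile b (b - 1 - i) \<omega>) < \<beta> i} \<subseteq> {\<omega>\<in>space ?S. \<exists>t\<in>{t0..t0+n}. ennreal \<theta> \<le> Z t \<omega>}"
  proof safe
    fix \<omega> i assume i: "i \<in> {a..<a'}" and lt: "real (profile b (b - 1 - i) \<omega>) < \<beta> i"
    define u where "u = profile b (b - 1 - i) \<omega>"
    have u: "u > 0" unfolding u_def by (rule profile_pos)
    have e: "b - 1 - (b - 1 - i) = i" using i ab by simp
    have "harm (u - 1) \<le> 1 + ln (real u)" using harm_le_ln[of "u - 1"] u by simp
    moreover have "ln (u * r i) \<le> ln \<kappa>"
    proof -
      have "u * r i \<le> \<beta> i * r i" using lt r[of i] by (intro mult_right_mono) (auto simp: u_def)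
      also have "\<dots> \<le> \<kappa>" using \<kappa>(2)[OF i] .
      finally show ?thesis using u r[of i] by (intro ln_mono) auto
    qed
    moreover have "ln (u * r i) = ln (real u) + ln (r i)" using u r[of i] by (simp add: ln_mult)
    moreover have "0 \<le> c i" unfolding c_def using r by (intro sum_nonneg) (simp add: less_imp_le)
    then have "0 \<le> (r i * u + c i) / W" using W r[of i] by simp
    moreover have "ln (W / \<kappa>) = ln W - ln \<kappa>" using W \<kappa>(1) by (simp add: ln_div)
    ultimately have "\<theta> \<le> Psi W (c i) (r i) u" unfolding \<theta>(1) W_def[symmetric] Psi_def by linarith
    then have "ennreal \<theta> \<le> Z (b - 1 - i) \<omega>" unfolding Z_def e u_def[symmetric] by (rule ennreal_leI)
    moreover have "b - 1 - i \<in> {t0..t0 + n}" using i ab by (auto simp: t0_def n_def)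
    ultimately show "\<exists>t\<in>{t0..t0+n}. ennreal \<theta> \<le> Z t \<omega>" by blast
  qed simp
  note [measurable] = Zm
  have "emeasure ?S {\<omega>. \<exists>i\<in>{a..<a'}. real (profile b (b - 1 - i) \<omega>) < \<beta> i} \<le> emeasure ?S {\<omega>\<in>space ?S. \<exists>t\<in>{t0..t0+n}. ennreal \<theta> \<le> Z t \<omega>}"
    by (rule emeasure_mono[OF sub]) measurable
  also have "\<dots> = (ennreal \<theta> * emeasure ?S {\<omega>\<in>space ?S. \<exists>t\<in>{t0..t0+n}. ennreal \<theta> \<le> Z t \<omega>}) / ennreal \<theta>"
    using \<theta>(2) by (subst mult.commute, subst ennreal_mult_divide_eq) auto
  also have "\<dots> \<le> ennreal (1 + ln (W / sum r {a'..<b})) / ennreal \<theta>"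
    using 1 by (rule divide_right_mono_ennreal)
  also have "\<dots> = ennreal ((1 + ln (W / sum r {a'..<b})) / \<theta>)"
  proof (rule divide_ennreal)
    have "sum r {a'..<b} \<le> W" unfolding W_def using ab r by (intro sum_mono2) (auto simp: less_imp_le)
    moreover have "sum r {a'..<b} > 0" using ab r by (intro sum_pos) auto
    ultimately show "0 \<le> 1 + ln (W / sum r {a'..<b})" by simp
  qed (fact \<theta>(2))
  finally show ?thesis by (simp add: W_def)
qed

section \<open>Crossing counts of the driven walk\<close>

definition count_upto :: "nat \<Rightarrow> (nat \<Rightarrow> bool) \<Rightarrow> nat" where
  "count_upto n P = card {k. k < n \<and> P k}"

lemma count_upto_0 [simp]: "count_upto 0 P = 0" by (simp add: count_upto_def)

lemma count_upto_Suc [simp]: "count_upto (Suc n) P = count_upto n P + (if P n then 1 else 0)"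
proof -
  have "{k. k < Suc n \<and> P k} = {k. k < n \<and> P k} \<union> (if P n then {n} else {})"
    by (auto simp: less_Suc_eq)
  then show ?thesis by (simp add: count_upto_def)
qed

context
  fixes x0 :: nat and \<omega> :: "nat \<Rightarrow> nat"
begin

definition visits :: "nat \<Rightarrow> nat \<Rightarrow> nat" where "visits i n = count_upto n (\<lambda>k. walk x0 k \<omega> = i)"
definition upcross :: "nat \<Rightarrow> nat \<Rightarrow> nat" where "upcross i n = count_upto n (\<lambda>k. walk x0 k \<omega> = i \<and> walk x0 (Suc k) \<omega> = Suc i)"
definition downcross :: "nat \<Rightarrow> nat \<Rightarrow> nat" where "downcross i n = count_upto n (\<lambda>k. walk x0 k \<omega> = Suc i \<and> walk x0 (Suc k) \<omega> = i)"

lemma visits_0 [simp]: "visits i 0 = 0" and upcross_0 [simp]: "upcross i 0 = 0" and downcross_0 [simp]: "downcross i 0 = 0"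
  by (simp_all add: visits_def upcross_def downcross_def)

lemma visits_Suc: "visits i (Suc n) = visits i n + (if walk x0 n \<omega> = i then 1 else 0)"
  and upcross_Suc: "upcross i (Suc n) = upcross i n + (if walk x0 n \<omega> = i \<and> walk x0 (Suc n) \<omega> = Suc i then 1 else 0)"
  and downcross_Suc: "downcross i (Suc n) = downcross i n + (if walk x0 n \<omega> = Suc i \<and> walk x0 (Suc n) \<omega> = i then 1 else 0)"
  by (simp_all add: visits_def upcross_def downcross_def)

lemma walk_0: "walk x0 0 \<omega> = x0" by (simp add: walk_def)

lemma visits_count_list: "count_list (tl (past x0 n \<omega>)) i = visits i n"
proof (induction n)
  case 0 show ?case by simp
next
  case (Suc n)
  obtain h t where ht: "past x0 n \<omega> = h # t" using past_nonempty[of x0 n \<omega>] by (cases "past x0 n \<omega>") auto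
  have "walk x0 n \<omega> = h" by (simp only: walk_def ht list.sel)
  then show ?case using Suc by (simp add: ht visits_Suc)
qed

lemma walk_Suc: "walk x0 (Suc n) \<omega> = instr \<omega> (walk x0 n \<omega>) (visits (walk x0 n \<omega>) n)"
  by (simp add: walk_def visits_count_list[symmetric])

lemma upcross_eq_ups: "upcross i n = ups i (visits i n) \<omega>"
proof (induction n)
  case (Suc n)
  show ?case
  proof (cases "walk x0 n \<omega> = i")
    case True
    then show ?thesis using Suc walk_Suc[of n] by (simp add: upcross_Suc visits_Suc)
  next
    case False then show ?thesis using Suc by (simp add: upcross_Suc visits_Suc)
  qed
qed simp

lemma num_crossings_ge:
  "enat (upcross i n) \<le> num_crossings (\<lambda>n. walk x0 n \<omega>) i" "enat (downcross i n) \<le> num_crossings (\<lambda>n. walk x0 n \<omega>) i"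
proof -
  have le: "enat (card C) \<le> num_crossings (\<lambda>n. walk x0 n \<omega>) i" if "C \<subseteq> crossing_times (\<lambda>n. walk x0 n \<omega>) i" for C
    using card_mono[OF _ that] by (simp add: num_crossings_def)
  show "enat (upcross i n) \<le> num_crossings (\<lambda>n. walk x0 n \<omega>) i"
    unfolding upcross_def count_upto_def by (rule le) (auto simp: crossing_times_def)
  show "enat (downcross i n) \<le> num_crossings (\<lambda>n. walk x0 n \<omega>) i"
    unfolding downcross_def count_upto_def by (rule le) (auto simp: crossing_times_def)
qed

context
  assumes nbr: "\<And>i c. instr \<omega> i c = Suc i \<or> (0 < i \<and> instr \<omega> i c = i - 1)"
begin

lemma step_cases: "walk x0 (Suc n) \<omega> = Suc (walk x0 n \<omega>) \<or> (0 < walk x0 n \<omega> \<and> walk x0 (Suc n) \<omega> = walk x0 n \<omega> - 1)"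
  unfolding walk_Suc by (rule nbr)

lemma visits_split: "visits (Suc i) n = upcross (Suc i) n + downcross i n"
proof (induction n)
  case (Suc n)
  show ?case using Suc step_cases[of n] by (auto simp: visits_Suc upcross_Suc downcross_Suc)
qed simp

lemma net_crossings: "upcross i n + (if i < x0 then 1 else 0) = downcross i n + (if i < walk x0 n \<omega> then 1 else 0)"
proof (induction n)
  case 0 show ?case by (simp add: walk_0)
next
  case (Suc n)
  consider "walk x0 n \<omega> < i" | "walk x0 n \<omega> = i" | "walk x0 n \<omega> = Suc i" | "walk x0 n \<omega> > Suc i" by linarith
  then show ?case using Suc step_cases[of n]
    by cases (auto simp: upcross_Suc downcross_Suc split: if_splits)
qed

text \<open>
  A nearest-neighbour walk that is to the right of \<open>i\<close> must have left \<open>i\<close> upwards the last time.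
\<close>

lemma last_departure: "i < walk x0 n \<omega> \<Longrightarrow> 0 < visits i n \<Longrightarrow> instr \<omega> i (visits i n - 1) = Suc i"
proof (induction n)
  case (Suc n)
  show ?case
  proof (cases "walk x0 n \<omega> = i")
    case True
    then show ?thesis using Suc.prems step_cases[of n] walk_Suc[of n] by (auto simp: visits_Suc)
  next
    case False
    then have "i < walk x0 n \<omega>" using Suc.prems step_cases[of n] by auto
    then show ?thesis using Suc False by (simp add: visits_Suc)
  qed
qed simp

text \<open>
  By \<open>last_departure\<close> the instructions consumed at \<open>i + 1\<close> end with an up instruction, so their number is
  the least stack length containing all the ups.
\<close>

lemma downs_before_upcross:
  assumes "Suc i < walk x0 n \<omega>"
  shows "downs_before (Suc i) (upcross (Suc i) n) \<omega> = downcross i n"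
proof (rule downs_before_eq)
  have e: "downcross i n + upcross (Suc i) n = visits (Suc i) n" by (simp add: visits_split)
  show "ups (Suc i) (downcross i n + upcross (Suc i) n) \<omega> = upcross (Suc i) n"
    unfolding e by (rule upcross_eq_ups[symmetric])
  show "instr \<omega> (Suc i) (downcross i n + upcross (Suc i) n - 1) = Suc (Suc i)" if "0 < downcross i n + upcross (Suc i) n"
    using that assms unfolding e by (intro last_departure) auto
qed

text \<open>
  The Ray--Knight identity: both sides start with a single crossing next to \<open>b\<close>, and going left they obey the same recursion.
\<close>

lemma upcross_eq_profile:
  assumes hit: "walk x0 n \<omega> = b" "\<And>k. k < n \<Longrightarrow> walk x0 k \<omega> < b" and t: "t < b" "x0 \<le> b - 1 - t"
  shows "upcross (b - 1 - t) n = profile b t \<omega>"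
  using t
proof (induction t)
  case 0
  have "{k. k < n \<and> walk x0 k \<omega> = Suc (b - 1) \<and> walk x0 (Suc k) \<omega> = b - 1} = {}"
  proof (intro equals0I)
    fix k assume "k \<in> {k. k < n \<and> walk x0 k \<omega> = Suc (b - 1) \<and> walk x0 (Suc k) \<omega> = b - 1}"
    then show False using hit(2)[of k] 0 by simp
  qed
  then have "downcross (b - 1) n = 0" by (simp only: downcross_def count_upto_def card.empty)
  then show ?case using net_crossings[of "b - 1" n] hit(1) 0 by simp
next
  case (Suc t)
  define j where "j = b - 1 - Suc t"
  have j: "b - 1 - t = Suc j" using Suc.prems by (simp add: j_def)
  have x0j: "x0 \<le> j" using Suc.prems by (simp add: j_def)
  have IH: "upcross (Suc j) n = profile b t \<omega>" using Suc x0j unfolding j by simp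
  have "Suc j < walk x0 n \<omega>" using hit(1) Suc.prems by (simp add: j_def)
  then have "downs_before (Suc j) (profile b t \<omega>) \<omega> = downcross j n"
    using downs_before_upcross[of j n] by (simp add: IH)
  moreover have "upcross j n = Suc (downcross j n)"
    using net_crossings[of j n] hit(1) Suc.prems by (simp add: j_def)
  ultimately have "upcross j n = profile b (Suc t) \<omega>" by (simp only: profile.simps j)
  then show ?case by (simp only: j_def)
qed

lemma downcross_ge:
  assumes down: "\<And>c. c < m \<Longrightarrow> instr \<omega> (Suc j) c = j" and up: "0 < upcross (Suc j) n"
  shows "m \<le> downcross j n"
proof -
  have z: "ups (Suc j) c \<omega> = 0" if "c \<le> m" for c
    using that by (induction c) (simp_all add: down)
  have le: "ups (Suc j) (m + c) \<omega> \<le> c" for c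
    by (induction c) (simp_all add: z)
  have "\<not> visits (Suc j) n \<le> m"
    using z[of "visits (Suc j) n"] up by (auto simp: upcross_eq_ups)
  then obtain c where c: "visits (Suc j) n = m + c" by (metis le_add_diff_inverse nat_le_linear)
  then have "upcross (Suc j) n \<le> c" using le[of c] by (simp add: upcross_eq_ups)
  then show ?thesis using visits_split[of j n] c by simp
qed

text \<open>
  If every site in \<open>{1..A}\<close> is left downwards at its first \<open>m\<close> visits, then any walk that is later beyond \<open>A\<close> has crossed
  each lower edge at least \<open>m\<close> times: one upcrossing at a site forces the \<open>m\<close> downcrossings before it, and these force
  an upcrossing at the next lower site.
\<close>

lemma low_edges:
  assumes hit: "walk x0 n \<omega> = b" and A: "x0 \<le> A" "A < b" and m: "1 \<le> m"
    and down: "\<And>i c. 1 \<le> i \<Longrightarrow> i \<le> A \<Longrightarrow> c < m \<Longrightarrow> instr \<omega> i c = i - 1"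
  shows "j < A \<Longrightarrow> m \<le> downcross j n"
proof (induction "A - j" arbitrary: j)
  case (Suc d)
  have "0 < upcross (Suc j) n"
  proof (cases "Suc j = A")
    case True
    then show ?thesis using net_crossings[of "Suc j" n] hit A by simp
  next
    case False
    then have "m \<le> downcross (Suc j) n" using Suc.hyps(2) Suc.prems False by (intro Suc.hyps(1)) auto
    then show ?thesis using net_crossings[of "Suc j" n] hit A m Suc.prems by (auto split: if_splits)
  qed
  then show ?case using down[of "Suc j"] Suc.prems by (intro downcross_ge) auto
qed simp

end
end

section \<open>Divergence of the sum of \<open>1 / g s i\<close>\<close>

lemma iter_log_shift:
  assumes "x > 0" shows "iter_log (Suc j) x = iter_log j (ln x)"
  using assms by (induction j) simp_all

lemma log_star_1: "log_star (Suc 0) x = (if x \<ge> exp 1 then ln x else 1)"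
proof -
  have "x > 0" if "x \<ge> exp 1" using that by (rule less_le_trans[OF exp_gt_zero])
  then show ?thesis by (auto simp: log_star_def)
qed

lemma log_star_shift:
  assumes "x > 0" shows "log_star (Suc (Suc j)) x = log_star (Suc j) (ln x)"
  unfolding log_star_def diff_Suc_1 iter_log_shift[OF assms] ..

text \<open>
  The shift \<open>x \<mapsto> ln x\<close> produces nonpositive arguments from every \<open>x \<le> 1\<close>; on those only the default value occurs.
\<close>

lemma log_star_nonpos:
  assumes "x \<le> 0" shows "log_star (Suc j) x = 1"
proof (cases j)
  case 0
  have "\<not> exp 1 \<le> x" using assms exp_gt_zero[of "1::real"] by linarith
  then show ?thesis using 0 by (simp add: log_star_1)
next
  case (Suc k)
  have "iter_log (Suc k) x = None" using assms by (induction k) simp_all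
  then show ?thesis by (simp add: log_star_def Suc)
qed

lemma log_star_ge_1: "log_star (Suc j) x \<ge> 1"
proof (induction j arbitrary: x)
  case 0
  have "1 \<le> ln x" if "exp 1 \<le> x"
    using that ln_le_cancel_iff[of "exp 1" x] by (smt (verit) exp_gt_zero ln_exp)
  then show ?case by (simp add: log_star_1)
next
  case (Suc j)
  then show ?case by (cases "x > 0") (simp_all add: log_star_shift log_star_nonpos)
qed

lemma log_star_mono: "x \<le> y \<Longrightarrow> log_star (Suc j) x \<le> log_star (Suc j) y"
proof (induction j arbitrary: x y)
  case 0
  show ?case
  proof (cases "exp 1 \<le> x")
    case True
    have "x > 0" using True by (rule less_le_trans[OF exp_gt_zero])
    then show ?thesis using True 0 by (simp add: log_star_1)
  next
    case False then show ?thesis using log_star_ge_1[of 0 y] by (simp add: log_star_1)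
  qed
next
  case (Suc j)
  show ?case
  proof (cases "x > 0")
    case True
    then show ?thesis using Suc.prems Suc.IH[of "ln x" "ln y"] by (simp add: log_star_shift)
  next
    case False then show ?thesis using log_star_ge_1[of "Suc j" y] by (simp add: log_star_nonpos)
  qed
qed

lemma g_pos: "i > 0 \<Longrightarrow> g s i > 0"
proof -
  assume "i > 0"
  moreover have "log_star j x > 0" if j: "j \<in> {1..s}" for j x
  proof -
    obtain k where "j = Suc k" using j by (cases j) auto
    then show ?thesis using log_star_ge_1[of k x] by simp
  qed
  ultimately show ?thesis by (auto simp: g_def intro!: mult_pos_pos prod_pos)
qed

lemma g_mono: "i \<le> k \<Longrightarrow> g s i \<le> g s k"
proof -
  assume ik: "i \<le> k"
  have "0 \<le> log_star j (real i) \<and> log_star j (real i) \<le> log_star j (real k)" if j: "j \<in> {1..s}" for j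
  proof -
    obtain l where "j = Suc l" using j by (cases j) auto
    then show ?thesis using ik log_star_ge_1[of l "real i"] log_star_mono[of "real i" "real k" l] by simp
  qed
  then show ?thesis unfolding g_def using ik
    by (intro mult_mono prod_mono) (auto intro!: prod_nonneg)
qed

lemma g_0: "g s 0 = 0" by (simp add: g_def)

text \<open>
  Condensation replaces \<open>i\<close> by \<open>2 ^ n\<close>, so that each iterated logarithm of \<open>2 ^ n\<close> is at most the previous one of \<open>n\<close>
  (as \<open>ln 2 \<le> 1\<close>), and the condensed series for \<open>s + 1\<close> dominates the series for \<open>s\<close>.
\<close>

lemma not_summable_inverse_g: "\<not> summable (\<lambda>i. 1 / g s i)"
proof (induction s)
  case 0
  show ?case using not_summable_harmonic[where 'a=real] by (simp add: g_def inverse_eq_divide)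
next
  case (Suc s)
  have "summable (\<lambda>i. 1 / g (Suc s) i) \<longleftrightarrow> summable (\<lambda>n. 2^n * (1 / g (Suc s) (2^n)))"
  proof (rule condensation_test)
    show "1 / g (Suc s) (Suc m) \<le> 1 / g (Suc s) m" if "0 < m" for m
      using that g_pos[of m "Suc s"] g_mono[of m "Suc m" "Suc s"] by (intro divide_left_mono) (auto intro!: mult_pos_pos)
    show "0 \<le> 1 / g (Suc s) n" for n
      using g_pos[of n "Suc s"] by (cases n) (auto simp: g_0 less_imp_le)
  qed
  moreover have "\<not> summable (\<lambda>n. 2^n * (1 / g (Suc s) (2^n)))"
  proof
    assume a: "summable (\<lambda>n. 2^n * (1 / g (Suc s) (2^n)))"
    have "summable (\<lambda>n. 1 / g s n)"
    proof (rule summable_comparison_test_ev[OF _ a])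
      have "norm (1 / g s n) \<le> 2^n * (1 / g (Suc s) (2^n))" if n: "n \<ge> 2" for n
      proof -
        have ln2: "ln (2::real) \<le> 1" using ln_le_minus_one[of 2] by simp
        have l1: "log_star (Suc 0) (2^n) \<le> real n"
          using n ln2 mult_left_mono[OF ln2, of "real n"] by (simp add: log_star_1 ln_realpow)
        have lj: "log_star (Suc j) (2^n) \<le> log_star j (real n)" if j: "j \<in> {1..s}" for j
        proof -
          obtain k where k: "j = Suc k" using j by (cases j) auto
          have "log_star (Suc j) (2^n) = log_star (Suc k) (real n * ln 2)"
            by (simp add: k log_star_shift ln_realpow)
          also have "\<dots> \<le> log_star (Suc k) (real n)"
            using mult_left_mono[OF ln2, of "real n"] by (intro log_star_mono) simp
          finally show ?thesis by (simp add: k)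
        qed
        have nn: "0 \<le> log_star (Suc j) x" for j x using log_star_ge_1[of j x] by linarith
        have "(\<Prod>j=1..Suc s. log_star j (2^n)) = log_star (Suc 0) (2^n) * (\<Prod>j=1..s. log_star (Suc j) (2^n))"
          by (simp add: prod.atLeast_Suc_atMost prod.shift_bounds_cl_Suc_ivl del: prod.cl_ivl_Suc)
        also have "\<dots> \<le> real n * (\<Prod>j=1..s. log_star j (real n))"
          using l1 lj nn by (intro mult_mono prod_mono prod_nonneg) auto
        finally have "g (Suc s) (2^n) \<le> 2^n * g s n" by (simp add: g_def)
        then have "1 / g s n \<le> 2^n * (1 / g (Suc s) (2^n))"
          using g_pos[of n s] g_pos[of "2^n" "Suc s"] n by (simp add: field_simps)
        then show ?thesis using g_pos[of n s] n by simp
      qed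
      then show "\<forall>\<^sub>F n in sequentially. norm (1 / g s n) \<le> 2^n * (1 / g (Suc s) (2^n))"
        by (auto simp: eventually_sequentially)
    qed
    with Suc show False by simp
  qed
  ultimately show ?case by simp
qed

section \<open>A chain with prescribed crossing counts\<close>

lemma stack_AE_instr:
  assumes "\<And>y. y \<in> set_pmf (K i) \<Longrightarrow> Q y"
  shows "AE \<omega> in stack_measure K. Q (instr \<omega> i c)"
proof -
  define n where "n = prod_encode (i, c)"
  have K: "K (fst (prod_decode n)) = K i" by (simp add: n_def)
  have prod: "product_prob_space (\<lambda>n. measure_pmf (K (fst (prod_decode n))))" by unfold_locales
  have "AE y in measure_pmf (K (fst (prod_decode n))). Q y"
    unfolding K using assms by (rule AE_pmfI)
  then have "AE y in distr (stack_measure K) (measure_pmf (K (fst (prod_decode n)))) (\<lambda>\<omega>. \<omega> n). Q y"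
    unfolding stack_measure_def by (subst product_prob_space.PiM_component[OF prod]) auto
  moreover have "(\<lambda>\<omega>. \<omega> n) \<in> measurable (stack_measure K) (measure_pmf (K (fst (prod_decode n))))"
    unfolding stack_measure_def by (rule measurable_component_singleton) simp
  ultimately have "AE \<omega> in stack_measure K. Q (\<omega> n)" by (rule AE_distrD[rotated])
  then show ?thesis by (simp add: instr_def n_def)
qed

lemma (in birth_death_chain) finite_visits:
  assumes r: "resistances K r" and summ: "summable r"
  shows "AE \<omega> in M. \<forall>L. finite {n. X n \<omega> = L}"
  unfolding AE_all_countable
proof
  fix L
  define c where "c = pmf (K L) (Suc L) * r L"
  have c: "c > 0" using up_pos[of L] r by (simp add: c_def resistances_def)
  have m: "{\<omega>\<in>space M. X n \<omega> = L} \<in> sets M" for n by measurable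
  have "ennreal c * (\<integral>\<^sup>+\<omega>. (\<Sum>n. indicator {\<omega>\<in>space M. X n \<omega> = L} \<omega>) \<partial>M) =
     (\<Sum>n. ennreal c * emeasure M {\<omega>\<in>space M. X n \<omega> = L})"
    using m by (simp add: nn_integral_suminf)
  also have "\<dots> < \<infinity>"
    using expected_visits[OF r summ, of L] unfolding c_def by (rule order.strict_trans1) simp
  finally have "(\<integral>\<^sup>+\<omega>. (\<Sum>n. indicator {\<omega>\<in>space M. X n \<omega> = L} \<omega>) \<partial>M) \<noteq> \<infinity>"
    using c by (auto simp: ennreal_mult_top)
  then have "AE \<omega> in M. (\<Sum>n. indicator {\<omega>\<in>space M. X n \<omega> = L} \<omega> :: ennreal) \<noteq> \<infinity>"
    using m by (intro nn_integral_noteq_infinite) auto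
  then show "AE \<omega> in M. finite {n. X n \<omega> = L}" using AE_space
  proof eventually_elim
    fix \<omega> assume fin: "(\<Sum>n. indicator {\<omega>\<in>space M. X n \<omega> = L} \<omega> :: ennreal) \<noteq> \<infinity>" and w: "\<omega> \<in> space M"
    have "(\<Sum>n. indicator {\<omega>\<in>space M. X n \<omega> = L} \<omega> :: ennreal) = (\<Sum>n. indicator {n. X n \<omega> = L} n)"
      using w by (intro suminf_cong) (auto simp: indicator_def)
    also have "\<dots> = (\<integral>\<^sup>+n. indicator {n. X n \<omega> = L} n \<partial>count_space UNIV)"
      by (simp add: nn_integral_count_space_nat)
    also have "\<dots> = emeasure (count_space UNIV) {n. X n \<omega> = L}" by simp
    finally show "finite {n. X n \<omega> = L}" using fin by (auto simp: emeasure_count_space split: if_splits)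
  qed
qed

lemma (in birth_death_chain) transient_if_summable:
  assumes r: "resistances K r" and summ: "summable r"
  shows "transient M x0 X"
proof (unfold transient_def recurrent_def, rule notI)
  assume "AE \<omega> in M. infinite {n. X n \<omega> = x0}"
  with finite_visits[OF r summ] have "AE \<omega> in M. False" by eventually_elim auto
  then show False by (simp add: AE_False)
qed

text \<open>
  Finitely many visits to every state push the walk beyond \<open>b\<close>, and it cannot jump over \<open>b\<close>.
\<close>

lemma walk_hits:
  assumes nbr: "\<And>i c. instr \<omega> i c = Suc i \<or> (0 < i \<and> instr \<omega> i c = i - 1)"
    and fin: "\<And>L. finite {n. walk x0 n \<omega> = L}" and b: "x0 < b"
  shows "\<exists>n. walk x0 n \<omega> = b \<and> (\<forall>k<n. walk x0 k \<omega> < b)"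
proof -
  have ex: "\<exists>n. b \<le> walk x0 n \<omega>"
  proof (rule ccontr)
    assume "\<not> ?thesis"
    then have "(UNIV :: nat set) = (\<Union>L<b. {n. walk x0 n \<omega> = L})" by (auto simp: not_le)
    moreover have "finite (\<Union>L<b. {n. walk x0 n \<omega> = L})" using fin by auto
    ultimately show False using infinite_UNIV_nat by simp
  qed
  define n where "n = (LEAST n. b \<le> walk x0 n \<omega>)"
  have n: "b \<le> walk x0 n \<omega>" unfolding n_def using ex by (rule LeastI_ex)
  have lt: "walk x0 k \<omega> < b" if "k < n" for k
    using not_less_Least[of k "\<lambda>n. b \<le> walk x0 n \<omega>"] that by (simp add: n_def not_le)
  have "n \<noteq> 0" using n b by (cases "n = 0") (auto simp: walk_0)
  then obtain k where k: "n = Suc k" by (cases n) auto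
  have "walk x0 n \<omega> = b" using step_cases[OF nbr, of x0 k] lt[of k] n k by auto
  then show ?thesis using lt by blast
qed

lemma block_sequence:
  fixes f B :: "nat \<Rightarrow> real"
  assumes pos: "\<And>i. 0 < f i" and ns: "\<not> summable f"
  shows "\<exists>a :: nat \<Rightarrow> nat. a 0 = 0 \<and> (\<forall>k. a k < a (Suc k) \<and> B k \<le> sum f {a k..<a (Suc k)})"
proof -
  have ex: "\<exists>n>m. c \<le> sum f {m..<n}" for m c
  proof (rule ccontr)
    assume neg: "\<not> ?thesis"
    have "summable f"
    proof (rule summableI_nonneg_bounded)
      show "0 \<le> f i" for i using pos[of i] by simp
      show "sum f {..<n} \<le> sum f {..<m} + c" for n
      proof -
        have "m < Suc (max m n)" by simp
        then have lt: "sum f {m..<Suc (max m n)} < c" using neg not_le by blast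
        have "sum f {..<n} \<le> sum f {..<Suc (max m n)}" using pos by (intro sum_mono2) (auto simp: less_imp_le)
        also have "\<dots> = sum f {..<m} + sum f {m..<Suc (max m n)}"
          unfolding lessThan_atLeast0 by (rule sum.atLeastLessThan_concat[symmetric]) auto
        finally show ?thesis using lt by simp
      qed
    qed
    with ns show False ..
  qed
  have "\<exists>a :: nat \<Rightarrow> nat. \<forall>k. (k = 0 \<longrightarrow> a k = 0) \<and> (a k < a (Suc k) \<and> B k \<le> sum f {a k..<a (Suc k)})"
    by (rule dependent_nat_choice) (use ex in auto)
  then show ?thesis by auto
qed

text \<open>
  The blocks \<open>{a k..<a (k + 1)}\<close>.  The size of the sums is chosen such that their logarithm beats \<open>2 ^ k\<close>, which makes the failure
  probability of block \<open>k\<close> at most \<open>2 ^ -k\<close>.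
\<close>

locale block_chain =
  fixes h :: "nat \<Rightarrow> real" and a :: "nat \<Rightarrow> nat"
  assumes h_pos: "\<And>i. 0 < h i" and a0: "a 0 = 0" and a_less: "\<And>k. a k < a (Suc k)"
    and big: "\<And>k. exp (1 + 3 * 2 ^ k) \<le> (\<Sum>i = a k..<a (Suc k). 1 / h i)"
begin

definition S :: "nat \<Rightarrow> real" where "S k = (\<Sum>i = a k..<a (Suc k). 1 / h i)"
definition blk :: "nat \<Rightarrow> nat" where "blk i = (LEAST k. i < a (Suc k))"
definition r :: "nat \<Rightarrow> real" where "r i = (1/2) ^ Suc (blk i) / (S (blk i) * h i)"

lemma S_ge: "exp (1 + 3 * 2 ^ k) \<le> S k" using big by (simp add: S_def)

lemma S_pos: "0 < S k" using S_ge[of k] exp_gt_zero[of "1 + 3 * 2 ^ k"] by linarith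

lemma r_pos: "0 < r i" by (simp add: r_def S_pos h_pos)

lemma a_mono: "k \<le> l \<Longrightarrow> a k \<le> a l"
  using lift_Suc_mono_le[of a k l] a_less by (simp add: less_imp_le)

lemma a_ge: "k \<le> a k"
  by (induction k) (use a_less in \<open>auto intro: Suc_leI le_less_trans\<close>)

lemma blk_eq: "i \<in> {a k..<a (Suc k)} \<Longrightarrow> blk i = k"
  unfolding blk_def
proof (rule Least_equality)
  fix l assume i: "i \<in> {a k..<a (Suc k)}" and "i < a (Suc l)"
  show "k \<le> l"
  proof (rule ccontr)
    assume "\<not> k \<le> l"
    then have "a (Suc l) \<le> a k" by (intro a_mono) simp
    then show False using i \<open>i < a (Suc l)\<close> by simp
  qed
qed simp

lemma in_block: "i \<in> {a (blk i)..<a (Suc (blk i))}"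
proof -
  have 1: "i < a (Suc (blk i))" unfolding blk_def by (rule LeastI[of _ i]) (use a_ge[of "Suc i"] in simp)
  have "a (blk i) \<le> i"
  proof (cases "blk i")
    case 0 then show ?thesis by (simp add: a0)
  next
    case (Suc k)
    then have "\<not> i < a (Suc k)" using not_less_Least[of k "\<lambda>k. i < a (Suc k)"] by (simp add: blk_def)
    then show ?thesis by (simp add: Suc)
  qed
  with 1 show ?thesis by simp
qed

lemma r_block: "i \<in> {a k..<a (Suc k)} \<Longrightarrow> h i * r i = (1/2) ^ Suc k / S k"
  using h_pos[of i] by (simp add: r_def blk_eq)

lemma sum_block: "sum r {a k..<a (Suc k)} = (1/2) ^ Suc k"
proof -
  have "sum r {a k..<a (Suc k)} = (\<Sum>i = a k..<a (Suc k). (1/2) ^ Suc k / S k * (1 / h i))"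
    by (intro sum.cong refl) (simp add: r_def blk_eq)
  also have "\<dots> = (1/2) ^ Suc k / S k * S k" unfolding S_def by (rule sum_distrib_left[symmetric])
  finally show ?thesis using S_pos[of k] by simp
qed

lemma sum_initial: "sum r {..<a k} = 1 - (1/2) ^ k"
proof (induction k)
  case 0 then show ?case by (simp add: a0)
next
  case (Suc k)
  have "sum r {..<a (Suc k)} = sum r {..<a k} + sum r {a k..<a (Suc k)}"
    unfolding lessThan_atLeast0 by (rule sum.atLeastLessThan_concat[symmetric]) (use a_less[of k] in auto)
  then show ?case by (simp add: Suc sum_block)
qed

lemma summable_r: "summable r"
proof (rule summableI_nonneg_bounded)
  show "0 \<le> r i" for i using r_pos[of i] by simp
  show "sum r {..<n} \<le> 1" for n
  proof -
    have "sum r {..<n} \<le> sum r {..<a n}"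
      using r_pos a_ge[of n] by (intro sum_mono2) (auto simp: less_imp_le)
    moreover have "(0::real) \<le> (1/2) ^ n" by simp
    ultimately show ?thesis unfolding sum_initial by linarith
  qed
qed

abbreviation "K \<equiv> res_kernel r"
abbreviation "\<SS> \<equiv> stack_measure K"

text \<open>
  For block \<open>k\<close> the walk is run up to the right end of block \<open>k + 1\<close>: counts next to the hitting point are small, so the block
  needs a margin.
\<close>

definition bad :: "nat \<Rightarrow> (nat \<Rightarrow> nat) set" where
  "bad k = {\<omega>. \<exists>i\<in>{a k..<a (Suc k)}. real (profile (a (k + 2)) (a (k + 2) - 1 - i) \<omega>) < h i}"

lemma bad_sets: "bad k \<in> sets \<SS>"
proof -
  have "bad k = {\<omega>\<in>space \<SS>. \<exists>i\<in>{a k..<a (Suc k)}. real (profile (a (k + 2)) (a (k + 2) - 1 - i) \<omega>) < h i}"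
    by (simp add: bad_def)
  also have "\<dots> \<in> sets \<SS>" by measurable
  finally show ?thesis .
qed

text \<open>
  Block \<open>k\<close> has resistance \<open>2 ^ -(k+1)\<close> and the margin half of it, so the starting mean in \<open>block_bound\<close> is \<open>1 + ln 3 \<le> 3\<close>,
  while the level is at least \<open>3 * 2 ^ k\<close>.
\<close>

lemma emeasure_bad: "emeasure \<SS> (bad k) \<le> ennreal ((1/2) ^ k)"
proof -
  define \<kappa> where "\<kappa> = (1/2) ^ Suc k / S k"
  define b where "b = a (Suc (Suc k))"
  have \<kappa>: "\<kappa> > 0" using S_pos by (simp add: \<kappa>_def)
  have s1: "sum r {a (Suc k)..<b} = (1/2) ^ Suc (Suc k)" unfolding b_def by (rule sum_block)
  have "sum r {a k..<b} = sum r {a k..<a (Suc k)} + sum r {a (Suc k)..<b}"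
    unfolding b_def by (rule sum.atLeastLessThan_concat[symmetric]) (use a_less in \<open>auto simp: less_imp_le\<close>)
  then have s2: "sum r {a k..<b} = 3 * (1/2) ^ Suc (Suc k)" by (simp add: s1 sum_block)
  define \<theta> where "\<theta> = ln (sum r {a k..<b} / \<kappa>) - 1"
  have "sum r {a k..<b} / \<kappa> = 3 / 2 * S k" by (simp add: s2 \<kappa>_def)
  moreover have "S k \<le> 3 / 2 * S k" using S_pos[of k] by simp
  ultimately have "exp (1 + 3 * 2 ^ k) \<le> sum r {a k..<b} / \<kappa>" using S_ge[of k] by linarith
  then have "1 + 3 * 2 ^ k \<le> ln (sum r {a k..<b} / \<kappa>)"
    by (subst ln_ge_iff) (auto intro: less_le_trans[OF exp_gt_zero])
  then have \<theta>: "3 * 2 ^ k \<le> \<theta>" by (simp add: \<theta>_def)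
  have \<theta>0: "0 < \<theta>" using \<theta> by (rule less_le_trans[rotated]) simp
  have "emeasure \<SS> (bad k) \<le> ennreal ((1 + ln (sum r {a k..<b} / sum r {a (Suc k)..<b})) / \<theta>)"
    unfolding bad_def add_2_eq_Suc' b_def[symmetric]
    by (rule block_bound[OF r_pos a_less _ \<kappa> _ \<theta>_def \<theta>0]) (use a_less[of "Suc k"] r_block[of _ k] in \<open>auto simp: b_def \<kappa>_def\<close>)
  also have "sum r {a k..<b} / sum r {a (Suc k)..<b} = 3" by (simp add: s1 s2)
  also have "ennreal ((1 + ln 3) / \<theta>) \<le> ennreal ((1/2) ^ k)"
  proof (rule ennreal_leI)
    have "1 + ln 3 \<le> (3::real)" using ln_le_minus_one[of "3::real"] by simp
    then have "(1 + ln 3) / \<theta> \<le> 3 / (3 * 2 ^ k)" using \<theta> \<theta>0 by (intro frac_le) auto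
    also have "\<dots> = (1/2) ^ k" by (simp add: power_one_over)
    finally show "(1 + ln 3) / \<theta> \<le> (1/2) ^ k" .
  qed
  finally show ?thesis .
qed

definition good_tail :: "nat \<Rightarrow> (nat \<Rightarrow> nat) set" where
  "good_tail k = UNIV - (\<Union>l. bad (l + k))"

lemma good_tail_sets: "good_tail k \<in> sets \<SS>"
  unfolding good_tail_def using bad_sets sets.top[of \<SS>] by (simp add: sets.countable_UN sets.Diff)

lemma good_tail_2: "emeasure \<SS> (good_tail 2) > 0"
proof -
  interpret prob_space \<SS> by (rule prob_space_stack)
  have sums: "(\<lambda>l. (1/2::real) ^ (l + 2)) sums (1/2)"
    using sums_mult[OF geometric_sums[of "1/2::real"], of "(1/2)^2"] by (simp add: power_add mult.commute power2_eq_square)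
  have "emeasure \<SS> (\<Union>l. bad (l + 2)) \<le> (\<Sum>l. emeasure \<SS> (bad (l + 2)))"
    using bad_sets by (intro emeasure_subadditive_countably) auto
  also have "\<dots> \<le> (\<Sum>l. ennreal ((1/2) ^ (l + 2)))" by (intro suminf_le emeasure_bad) auto
  also have "\<dots> = ennreal (\<Sum>l. (1/2) ^ (l + 2))"
    by (rule suminf_ennreal2[OF _ sums_summable[OF sums]]) simp
  also have "(\<Sum>l. (1/2::real) ^ (l + 2)) = 1/2" by (rule sums_unique[OF sums, symmetric])
  finally have "ennreal (prob (\<Union>l. bad (l + 2))) \<le> ennreal (1/2)" unfolding emeasure_eq_measure .
  then have le: "prob (\<Union>l. bad (l + 2)) \<le> 1/2" by (subst (asm) ennreal_le_iff) simp_all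
  have "prob (good_tail 2) = 1 - prob (\<Union>l. bad (l + 2))"
    unfolding good_tail_def using bad_sets by (subst prob_compl[symmetric]) auto
  then have "prob (good_tail 2) > 0" using le by simp
  then show ?thesis by (simp add: emeasure_eq_measure)
qed

lemma good_tail_pos:
  assumes k: "2 \<le> k"
  shows "emeasure \<SS> (good_tail k) > 0"
proof -
  have "good_tail 2 \<subseteq> good_tail k"
  proof (unfold good_tail_def, intro Diff_mono subset_refl UN_least)
    fix l
    have "l + k = (l + k - 2) + 2" using k by linarith
    then show "bad (l + k) \<subseteq> (\<Union>l. bad (l + 2))" by (metis UNIV_I UN_upper)
  qed
  then have "emeasure \<SS> (good_tail 2) \<le> emeasure \<SS> (good_tail k)" by (rule emeasure_mono[OF _ good_tail_sets])
  with good_tail_2 show ?thesis by (rule less_le_trans)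
qed

text \<open>
  This locality leaves the stacks at the sites up to \<open>a k\<close> free, so that they can be prescribed independently.
\<close>

lemma good_tail_determined: "determined_by (site {a k<..}) (good_tail k)"
  unfolding determined_by_def
proof (intro allI impI)
  fix \<omega> \<omega>' assume ag: "\<forall>n\<in>site {a k<..}. \<omega> n = \<omega>' n" and w: "\<omega> \<in> good_tail k"
  have "\<omega> \<in> bad (l + k) \<longleftrightarrow> \<omega>' \<in> bad (l + k)" for l
  proof -
    have "profile (a (l + k + 2)) (a (l + k + 2) - 1 - i) \<omega> = profile (a (l + k + 2)) (a (l + k + 2) - 1 - i) \<omega>'"
      if i: "i \<in> {a (l + k)..<a (Suc (l + k))}" for i
    proof (rule profile_cong)
      have "a (Suc (l + k)) < a (l + k + 2)" using a_less[of "Suc (l + k)"] by simp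
      then have ib: "i < a (l + k + 2)" using i by simp
      fix n assume "n \<in> site {a (l + k + 2) - (a (l + k + 2) - 1 - i)..<a (l + k + 2)}"
      moreover have "site {a (l + k + 2) - (a (l + k + 2) - 1 - i)..<a (l + k + 2)} \<subseteq> site {a k<..}"
        using i ib a_mono[of k "l + k"] by (intro site_mono) auto
      ultimately show "\<omega> n = \<omega>' n" using ag by blast
    qed simp
    then show ?thesis unfolding bad_def by (auto simp del: atLeastLessThan_iff)
  qed
  then show "\<omega>' \<in> good_tail k" using w by (simp add: good_tail_def)
qed

definition pushed :: "nat \<Rightarrow> nat \<Rightarrow> (nat \<Rightarrow> nat) set" where
  "pushed A m = {\<omega>. \<forall>n\<in>prod_encode ` ({1..A} \<times> {..<m}). \<omega> n = fst (prod_decode n) - 1}"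

lemma pushed_iff: "\<omega> \<in> pushed A m \<longleftrightarrow> (\<forall>i\<in>{1..A}. \<forall>c<m. instr \<omega> i c = i - 1)"
  by (auto simp: pushed_def instr_def)

lemma pushed_sets: "pushed A m \<in> sets \<SS>"
proof -
  have "pushed A m = {\<omega>\<in>space \<SS>. \<forall>i\<in>{1..A}. \<forall>c\<in>{..<m}. instr \<omega> i c = i - 1}"
    by (auto simp: pushed_iff)
  also have "\<dots> \<in> sets \<SS>" by measurable
  finally show ?thesis .
qed

lemma pushed_pos: "emeasure \<SS> (pushed A m) > 0"
proof -
  have "emeasure \<SS> (pushed A m) = (\<Prod>n\<in>prod_encode ` ({1..A} \<times> {..<m}). ennreal (pmf (K (fst (prod_decode n))) (fst (prod_decode n) - 1)))"
    unfolding pushed_def by (rule emeasure_points) simp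
  also have "\<dots> > 0"
  proof -
    have "pmf (K i) (i - 1) > 0" if "i \<in> {1..A}" for i
      using birth_death_res_kernel[of r, OF r_pos] that unfolding birth_death_kernel_def by auto
    then have "0 < (\<Prod>n\<in>prod_encode ` ({1..A} \<times> {..<m}). pmf (K (fst (prod_decode n))) (fst (prod_decode n) - 1))"
      by (intro prod_pos) auto
    then show ?thesis by (subst prod_ennreal) auto
  qed
  finally show ?thesis .
qed

lemma pushed_determined: "determined_by (site {1..A}) (pushed A m)"
  unfolding determined_by_def pushed_iff by (auto simp: instr_def)

lemma walk_chain: "birth_death_chain \<SS> K x0 (walk x0)"
proof -
  interpret markov_chain \<SS> K x0 "walk x0" by (rule stack_markov_chain)
  show ?thesis by unfold_locales (rule birth_death_res_kernel[OF r_pos])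
qed

lemma walk_transient: "transient \<SS> x0 (walk x0)"
proof -
  interpret birth_death_chain \<SS> K x0 "walk x0" by (rule walk_chain)
  show ?thesis by (rule transient_if_summable[OF resistances_res_kernel[OF r_pos] summable_r])
qed

lemma crossings_large:
  assumes nbr: "\<And>i c. instr \<omega> i c = Suc i \<or> (0 < i \<and> instr \<omega> i c = i - 1)"
    and fin: "\<And>L. finite {n. walk x0 n \<omega> = L}"
    and x0: "x0 < a k" and m: "1 \<le> m" "\<And>i. i < a k \<Longrightarrow> h i \<le> real m"
    and good: "\<omega> \<in> good_tail k" and push: "\<omega> \<in> pushed (a k) m"
  shows "ennreal (h i) \<le> ennreal_of_enat (num_crossings (\<lambda>n. walk x0 n \<omega>) i)"
proof -
  have le: "ennreal (h i) \<le> ennreal_of_enat (num_crossings (\<lambda>n. walk x0 n \<omega>) i)"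
    if "h i \<le> real l" "enat l \<le> num_crossings (\<lambda>n. walk x0 n \<omega>) i" for l
  proof -
    have "ennreal (h i) \<le> ennreal_of_enat (enat l)" using that(1) by (simp add: ennreal_of_nat_eq_real_of_nat ennreal_leI)
    also have "\<dots> \<le> ennreal_of_enat (num_crossings (\<lambda>n. walk x0 n \<omega>) i)"
      by (simp only: ennreal_of_enat_le_iff that(2))
    finally show ?thesis .
  qed
  show ?thesis
  proof (cases "i < a k")
    case True
    obtain n where n: "walk x0 n \<omega> = Suc (a k)" using walk_hits[OF nbr fin less_SucI[OF x0]] by auto
    have "m \<le> downcross x0 \<omega> i n"
      by (rule low_edges[OF nbr n _ _ m(1) _ True]) (use x0 push in \<open>auto simp: pushed_iff\<close>)
    then have "h i \<le> real (downcross x0 \<omega> i n)" using m(2)[OF True] by linarith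
    then show ?thesis using num_crossings_ge(2) by (rule le)
  next
    case False
    define j where "j = blk i"
    have ij: "i \<in> {a j..<a (Suc j)}" unfolding j_def by (rule in_block)
    have jk: "k \<le> j"
    proof (rule ccontr)
      assume "\<not> k \<le> j"
      then have "a (Suc j) \<le> a k" by (intro a_mono) simp
      then show False using ij False by simp
    qed
    define b where "b = a (j + 2)"
    have ib: "i < b" "x0 \<le> i" using ij a_less[of "Suc j"] False x0 by (auto simp: b_def)
    obtain n where n: "walk x0 n \<omega> = b" "\<And>k. k < n \<Longrightarrow> walk x0 k \<omega> < b"
      using walk_hits[OF nbr fin le_less_trans[OF ib(2,1)]] by auto
    have e: "b - 1 - (b - 1 - i) = i" using ib by simp
    have up: "upcross x0 \<omega> i n = profile b (b - 1 - i) \<omega>"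
      using upcross_eq_profile[OF nbr n, of "b - 1 - i"] ib unfolding e by simp
    have "\<omega> \<notin> bad ((j - k) + k)" using good unfolding good_tail_def by blast
    then have "\<omega> \<notin> bad j" using jk by simp
    then have "h i \<le> real (profile b (b - 1 - i) \<omega>)" using ij unfolding bad_def b_def by (auto simp: not_less simp del: atLeastLessThan_iff)
    then show ?thesis unfolding up[symmetric] using num_crossings_ge(1) by (rule le)
  qed
qed

text \<open>
  The index \<open>k\<close> puts the initial state below the blocks under control and makes the tail of the failure probabilities
  less than \<open>1\<close>; the edges below \<open>a k\<close> are handled by pushing down \<open>m\<close> times.
\<close>

lemma crossings_large_pos:
  "\<P>(\<omega> in \<SS>. \<forall>i. ennreal (h i) \<le> ennreal_of_enat (num_crossings (\<lambda>n. walk x0 n \<omega>) i)) > 0"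
proof -
  interpret birth_death_chain \<SS> K x0 "walk x0" by (rule walk_chain)
  define k where "k = max 2 (Suc x0)"
  have x0: "x0 < a k" using a_ge[of k] by (simp add: k_def)
  have k2: "2 \<le> k" by (simp add: k_def)
  define m where "m = Suc (nat \<lceil>\<Sum>i<a k. h i\<rceil>)"
  have m: "1 \<le> m" "\<And>i. i < a k \<Longrightarrow> h i \<le> real m"
  proof -
    fix i assume "i < a k"
    then have "h i \<le> (\<Sum>i<a k. h i)" using h_pos by (intro member_le_sum) (auto simp: less_imp_le)
    then show "h i \<le> real m" unfolding m_def by linarith
  qed (simp add: m_def)
  have nbr: "AE \<omega> in \<SS>. \<forall>i c. instr \<omega> i c = Suc i \<or> (0 < i \<and> instr \<omega> i c = i - 1)"
    unfolding AE_all_countable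
  proof (intro allI stack_AE_instr)
    fix i y assume "y \<in> set_pmf (K i)"
    then have "pmf (K i) y \<noteq> 0" by (simp add: set_pmf_iff)
    then show "y = Suc i \<or> (0 < i \<and> y = i - 1)"
      by (cases i) (auto simp: pmf_res_kernel[OF r_pos] split: if_splits)
  qed
  have fin: "AE \<omega> in \<SS>. \<forall>L. finite {n. walk x0 n \<omega> = L}"
    by (rule finite_visits[OF resistances_res_kernel[OF r_pos] summable_r])
  have "0 < emeasure \<SS> (pushed (a k) m) * emeasure \<SS> (good_tail k)"
    using pushed_pos[of "a k" m] good_tail_pos[OF k2] by (simp add: ennreal_zero_less_mult_iff)
  also have "\<dots> = emeasure \<SS> (pushed (a k) m \<inter> good_tail k)"
    by (rule stack_indep[OF pushed_sets pushed_determined good_tail_sets good_tail_determined, symmetric]) (rule site_disjoint, auto)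
  also have "\<dots> \<le> emeasure \<SS> {\<omega>\<in>space \<SS>. \<forall>i. ennreal (h i) \<le> ennreal_of_enat (num_crossings (\<lambda>n. walk x0 n \<omega>) i)}"
  proof (rule emeasure_mono_AE)
    show "AE \<omega> in \<SS>. \<omega> \<in> pushed (a k) m \<inter> good_tail k \<longrightarrow> \<omega> \<in> {\<omega>\<in>space \<SS>. \<forall>i. ennreal (h i) \<le> ennreal_of_enat (num_crossings (\<lambda>n. walk x0 n \<omega>) i)}"
      using nbr fin
    proof eventually_elim
      case (elim \<omega>)
      have n: "instr \<omega> i c = Suc i \<or> (0 < i \<and> instr \<omega> i c = i - 1)" for i c using elim(1) by blast
      have f: "finite {n. walk x0 n \<omega> = L}" for L using elim(2) by blast
      show ?case using crossings_large[OF n f x0 m] by auto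
    qed
    show "{\<omega>\<in>space \<SS>. \<forall>i. ennreal (h i) \<le> ennreal_of_enat (num_crossings (\<lambda>n. walk x0 n \<omega>) i)} \<in> sets \<SS>"
      by measurable
  qed
  finally show ?thesis by (simp add: emeasure_eq_measure)
qed

end

lemma chain_with_many_crossings:
  fixes h :: "nat \<Rightarrow> real"
  assumes "\<And>i. 0 < h i" and "\<not> summable (\<lambda>i. 1 / h i)"
  shows "\<exists>K. \<forall>x0. \<exists>(M :: (nat \<Rightarrow> nat) measure) X. birth_death_chain M K x0 X \<and> transient M x0 X \<and>
    \<P>(\<omega> in M. \<forall>i. ennreal (h i) \<le> ennreal_of_enat (num_crossings (\<lambda>n. X n \<omega>) i)) > 0"
proof -
  obtain a :: "nat \<Rightarrow> nat" where a: "a 0 = 0" "\<And>k. a k < a (Suc k)"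
    "\<And>k. exp (1 + 3 * 2 ^ k) \<le> (\<Sum>i = a k..<a (Suc k). 1 / h i)"
    using block_sequence[of "\<lambda>i. 1 / h i" "\<lambda>k. exp (1 + 3 * 2 ^ k)"] assms by auto
  interpret block_chain h a by unfold_locales (use assms a in auto)
  show ?thesis using walk_chain walk_transient crossings_large_pos by blast
qed

section \<open>The theorem\<close>

theorem theorem4:
  "(\<forall>(M :: 'a measure) K x0 X.
      birth_death_chain M K x0 X \<and> transient M x0 X \<longrightarrow>
      (AE \<omega> in M. (\<Sum>i. 1 / ennreal_of_enat (num_crossings (\<lambda>n. X n \<omega>) i)) = \<infinity>)) \<and>
   (\<forall>s. \<exists>K c. c > 0 \<and>
      (\<forall>x0. \<exists>(M :: (nat \<Rightarrow> nat) measure) X.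
        birth_death_chain M K x0 X \<and> transient M x0 X \<and>
        \<P>(\<omega> in M. \<forall>i. ennreal (c * g s i) \<le>
          ennreal_of_enat (num_crossings (\<lambda>n. X n \<omega>) i)) > 0))"
proof (intro conjI allI impI)
  fix M :: "'a measure" and K x0 X
  assume "birth_death_chain M K x0 X \<and> transient M x0 X"
  then show "AE \<omega> in M. (\<Sum>i. 1 / ennreal_of_enat (num_crossings (\<lambda>n. X n \<omega>) i)) = \<infinity>"
    using birth_death_chain.transient_sum_inverse_crossings by blast
next
  fix s
  \<comment> \<open>The construction needs a positive target, but \<open>g s 0 = 0\<close>.\<close>
  define h where "h i = (if i = 0 then 1 else g s i)" for i
  have "0 < h i" for i by (simp add: h_def g_pos)
  moreover have "\<not> summable (\<lambda>i. 1 / h i)"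
  proof
    assume "summable (\<lambda>i. 1 / h i)"
    then have "summable (\<lambda>i. 1 / h (Suc i))" by (subst summable_Suc_iff)
    then have "summable (\<lambda>i. 1 / g s (Suc i))" by (simp add: h_def)
    then have "summable (\<lambda>i. 1 / g s i)" by (subst (asm) summable_Suc_iff)
    with not_summable_inverse_g show False ..
  qed
  ultimately obtain K where K: "\<forall>x0. \<exists>(M :: (nat \<Rightarrow> nat) measure) X.
      birth_death_chain M K x0 X \<and> transient M x0 X \<and>
      \<P>(\<omega> in M. \<forall>i. ennreal (h i) \<le> ennreal_of_enat (num_crossings (\<lambda>n. X n \<omega>) i)) > 0"
    using chain_with_many_crossings[of h] by blast
  have gh: "1 * g s i \<le> h i" for i by (simp add: h_def g_0)
  show "\<exists>K c. c > 0 \<and>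
      (\<forall>x0. \<exists>(M :: (nat \<Rightarrow> nat) measure) X.
        birth_death_chain M K x0 X \<and> transient M x0 X \<and>
        \<P>(\<omega> in M. \<forall>i. ennreal (c * g s i) \<le>
          ennreal_of_enat (num_crossings (\<lambda>n. X n \<omega>) i)) > 0)"
  proof (intro exI[of _ K] exI[of _ "1::real"] conjI allI)
    fix x0
    obtain M :: "(nat \<Rightarrow> nat) measure" and X where
      MX: "birth_death_chain M K x0 X" "transient M x0 X"
        "\<P>(\<omega> in M. \<forall>i. ennreal (h i) \<le> ennreal_of_enat (num_crossings (\<lambda>n. X n \<omega>) i)) > 0"
      using K by blast
    interpret birth_death_chain M K x0 X by (fact MX(1))
    have "\<P>(\<omega> in M. \<forall>i. ennreal (h i) \<le> ennreal_of_enat (num_crossings (\<lambda>n. X n \<omega>) i)) \<le>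
      \<P>(\<omega> in M. \<forall>i. ennreal (1 * g s i) \<le> ennreal_of_enat (num_crossings (\<lambda>n. X n \<omega>) i))"
    proof (rule finite_measure_mono)
      show "{\<omega>\<in>space M. \<forall>i. ennreal (h i) \<le> ennreal_of_enat (num_crossings (\<lambda>n. X n \<omega>) i)} \<subseteq>
        {\<omega>\<in>space M. \<forall>i. ennreal (1 * g s i) \<le> ennreal_of_enat (num_crossings (\<lambda>n. X n \<omega>) i)}"
        using order_trans[OF ennreal_leI[OF gh]] by blast
    qed measurable
    with MX show "\<exists>(M :: (nat \<Rightarrow> nat) measure) X.
        birth_death_chain M K x0 X \<and> transient M x0 X \<and>
        \<P>(\<omega> in M. \<forall>i. ennreal (1 * g s i) \<le>
          ennreal_of_enat (num_crossings (\<lambda>n. X n \<omega>) i)) > 0"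
      by (meson less_le_trans)
  qed simp
qed

end
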